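(* Let $\omega\in S^2$ be regular with respect to $D$ and assume that $D$ has a conical singularity from direction $\omega$, with $D\cap\{x\in\mathbb R^3: h_D(\omega)-\delta<x\cdot\omega<h_D(\omega)\}=D_{(p(\omega),\omega)}(\delta,Q)$. Assume that there are $\eta>0$, $0<\alpha\le 1$ and $\tilde\rho\in C^{0,\alpha}(\overline{B_\eta(p(\omega))})$ with $\rho(x)=\tilde\rho(x)$ for almost all $x\in B_\eta(p(\omega))\cap D$. Then, as $\tau\to\infty$, $$\tau^3e^{-\tau h_D(\omega)}e^{-i\sqrt{\tau^2+k^2}\,p(\omega)\cdot\vartheta}\,I_{\omega,\vartheta}(\tau)=\tilde\rho(p(\omega))\,C_{(p(\omega),\omega)}(\delta,Q,\vartheta)+O(\tau^{-\alpha})$$ and $$\tau^3e^{-\tau h_D(\omega)}e^{-i\sqrt{\tau^2+k^2}\,p(\omega)\cdot\vartheta}\,I'_{\omega,\vartheta}(\tau)=\tilde\rho(p(\omega))\,\bigl(h_D(\omega)+i\,p(\omega)\cdot\vartheta\bigr)\,C_{(p(\omega),\omega)}(\delta,Q,\vartheta)+O(\tau^{-\alpha}),$$ where the remainders $O(\tau^{-\alpha})$ are uniform with respect to $\vartheta\in S(\omega)$.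
   Context: Setting. $\Omega\subset\mathbb R^3$ is a bounded domain with $C^2$ boundary and outward unit normal $\nu$; $k\ge 0$. $D$ is a nonempty open set with $\overline D\subset\Omega$, $\rho\in L^2(D)$ is complex-valued, and $F=F_{\rho,D}$ equals $\rho$ on $D$ and $0$ on $\Omega\setminus D$. $u\in H^1(\Omega)$ (complex-valued) is an arbitrary weak solution of $\Delta u+k^2u=F$ in $\Omega$ (no boundary condition is prescribed). The normal derivative $\partial u/\partial\nu\in H^{-1/2}(\partial\Omega)$ is defined weakly by $\langle \partial u/\partial\nu,g|_{\partial\Omega}\rangle=\int_\Omega(\nabla u\cdot\nabla g-k^2ug+Fg)\,dx$ for $g\in H^1(\Omega)$, and boundary integrals containing it are understood as this pairing. Dot products are extended bilinearly (no conjugation) to complex vectors. For $\omega\in S^2$, $S(\omega)=\{\vartheta\in S^2:\omega\cdot\vartheta=0\}$. For $\vartheta\in S(\omega)$, $\tau>0$, put $v=e^{x\cdot(\tau\omega+i\sqrt{\tau^2+k^2}\,\vartheta)}$, $v_\tau=\partial_\tau v=\{x\cdot(\omega+i\frac{\tau}{\sqrt{\tau^2+k^2}}\vartheta)\}v$, and $$I_{\omega,\vartheta}(\tau)=\int_{\partial\Omega}\Bigl(\frac{\partial u}{\partial\nu}v-\frac{\partial v}{\partial\nu}u\Bigr)dS,\qquad I'_{\omega,\vartheta}(\tau)=\int_{\partial\Omega}\Bigl(\frac{\partial u}{\partial\nu}v_\tau-\frac{\partial v_\tau}{\partial\nu}u\Bigr)dS.$$ $h_D(\omega)=\sup_{x\in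 D}x\cdot\omega$. $\omega$ is regular with respect to $D$ if $\{x\in\overline D: x\cdot\omega=h_D(\omega)\}$ is a single point, denoted $p(\omega)$. For $p\in\mathbb R^3$, $\omega\in S^2$, $\delta>0$ and a nonempty bounded relatively open subset $Q$ of the plane $x\cdot\omega=p\cdot\omega-\delta$, let $D_{(p,\omega)}(\delta,Q)=\bigcup_{0<s<\delta}\{p+\frac{s}{\delta}(z-p): z\in Q\}$. For $\vartheta\in S(\omega)$, $$C_{(p,\omega)}(\delta,Q,\vartheta)=2s\int_{Q_s}\frac{dS_z}{\{s-i(z-p)\cdot\vartheta\}^3},\qquad Q_s=D_{(p,\omega)}(\delta,Q)\cap\{x: x\cdot\omega=p\cdot\omega-s\},$$ which does not depend on $s\in\,]0,\delta[$. If $\omega$ is regular with respect to $D$, $D$ has a conical singularity from direction $\omega$ if there exist $\delta>0$ and a nonempty bounded relatively open subset $Q$ of the plane $x\cdot\omega=h_D(\omega)-\delta$ such that $D\cap\{x: h_D(\omega)-\delta<x\cdot\omega<h_D(\omega)\}=D_{(p(\omega),\omega)}(\delta,Q)$. $B_\eta(p)$ is the open ball of radius $\eta$ centered at $p$. *)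

theory Defs
  imports "HOL-Analysis.Analysis"
begin

section \<open>Differentiability and vectors\<close>

text \<open>For open \<open>S\<close> this is the class of \<open>n\<close> times continuously differentiable functions on \<open>S\<close>.\<close>

primrec Ck_on ::
  "nat \<Rightarrow> ('a::euclidean_space \<Rightarrow> 'b::real_normed_vector) \<Rightarrow> 'a set \<Rightarrow> bool" where
  "Ck_on 0 f S \<longleftrightarrow> continuous_on S f"
| "Ck_on (Suc n) f S \<longleftrightarrow>
     f differentiable_on S \<and> (\<forall>b\<in>Basis. Ck_on n (\<lambda>x. frechet_derivative f (at x) b) S)"

definition grad :: "(real^'n \<Rightarrow> 'b::real_normed_vector) \<Rightarrow> real^'n \<Rightarrow> 'b^'n" where
  "grad f x = (\<chi> j. frechet_derivative f (at x) (axis j 1))"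

definition cvec :: "real^'n \<Rightarrow> complex^'n" where
  "cvec x = (\<chi> j. complex_of_real (x $ j))"

text \<open>The bilinear (not sesquilinear) dot product.\<close>

definition bdot :: "complex^'n \<Rightarrow> complex^'n \<Rightarrow> complex" where
  "bdot a b = (\<Sum>j\<in>UNIV. a $ j * b $ j)"

section \<open>Domains with \<open>C\<^sup>2\<close> boundary\<close>

text \<open>In the rigid coordinates \<open>A\<close> the set \<open>\<Omega>\<close> is, inside the open cylinder
  \<open>A ` (U \<times> {a<..<b})\<close>, the region strictly below the graph of the \<open>C\<^sup>2\<close> function \<open>\<phi>\<close>.
  An isometry \<open>A\<close> is automatically affine and onto here. Since the cylinder is open,
  \<open>frontier \<Omega>\<close> is the graph of \<open>\<phi>\<close> inside the cylinder.\<close>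

definition local_graph ::
  "(real^3) set \<Rightarrow> ((real^2) \<times> real \<Rightarrow> real^3) \<Rightarrow> (real^2) set \<Rightarrow> real \<Rightarrow> real
     \<Rightarrow> (real^2 \<Rightarrow> real) \<Rightarrow> bool" where
  "local_graph \<Omega> A U a b \<phi> \<longleftrightarrow>
     (\<forall>z w. dist (A z) (A w) = dist z w) \<and> open U \<and> Ck_on 2 \<phi> U \<and>
     (\<forall>y\<in>U. a < \<phi> y \<and> \<phi> y < b) \<and>
     \<Omega> \<inter> A ` (U \<times> {a<..<b}) = A ` {(y, t). y \<in> U \<and> a < t \<and> t < \<phi> y}"

definition C2_boundary :: "(real^3) set \<Rightarrow> bool" where
  "C2_boundary \<Omega> \<longleftrightarrow>
     (\<forall>x\<in>frontier \<Omega>. \<exists>A U a b \<phi>. local_graph \<Omega> A U a b \<phi> \<and> x \<in> A ` (U \<times> {a<..<b}))"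

definition graph_density :: "(real^2 \<Rightarrow> real) \<Rightarrow> real^2 \<Rightarrow> real" where
  "graph_density \<phi> y = sqrt (1 + (norm (grad \<phi> y))\<^sup>2)"

text \<open>\<open>A w - A 0\<close> is the linear part of \<open>A\<close> applied to \<open>w\<close>.\<close>

definition outward_normal :: "(real^3) set \<Rightarrow> real^3 \<Rightarrow> real^3" where
  "outward_normal \<Omega> x = (THE n. \<exists>A U a b \<phi> y. local_graph \<Omega> A U a b \<phi> \<and> y \<in> U \<and> x = A (y, \<phi> y) \<and>
     n = (1 / graph_density \<phi> y) *\<^sub>R (A (- grad \<phi> y, 1) - A 0))"

text \<open>The surface measure \<open>dS\<close> of \<open>frontier \<Omega>\<close>, as a Borel measure on the whole space: the measure
  carried by \<open>frontier \<Omega>\<close> that is \<open>sqrt (1 + |\<nabla>\<phi>|\<^sup>2) dy\<close> in every local graph representation.\<close>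

definition surface_measure :: "(real^3) set \<Rightarrow> (real^3) measure" where
  "surface_measure \<Omega> = (THE M. sets M = sets borel \<and> emeasure M (- frontier \<Omega>) = 0 \<and>
     (\<forall>A U a b \<phi>. local_graph \<Omega> A U a b \<phi> \<longrightarrow>
        (\<forall>B\<in>sets borel. B \<subseteq> A ` (U \<times> {a<..<b}) \<longrightarrow>
           emeasure M B =
             (\<integral>\<^sup>+y\<in>U. indicator B (A (y, \<phi> y)) * ennreal (graph_density \<phi> y) \<partial>lborel))))"

section \<open>Sobolev functions, traces and weak solutions\<close>

definition L2_on :: "(real^3) set \<Rightarrow> (real^3 \<Rightarrow> 'b::euclidean_space) \<Rightarrow> bool" where
  "L2_on S f \<longleftrightarrow> set_borel_measurable lebesgue S f \<and>
     set_integrable lebesgue S (\<lambda>x. (norm (f x))\<^sup>2)"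

definition test_function :: "(real^3) set \<Rightarrow> (real^3 \<Rightarrow> complex) \<Rightarrow> bool" where
  "test_function \<Omega> \<psi> \<longleftrightarrow> (\<forall>n. Ck_on n \<psi> UNIV) \<and>
     compact (closure {x. \<psi> x \<noteq> 0}) \<and> closure {x. \<psi> x \<noteq> 0} \<subseteq> \<Omega>"

text \<open>\<open>u \<in> H\<^sup>1(\<Omega>)\<close> with weak gradient \<open>Du\<close> (which is determined by \<open>u\<close> almost everywhere
  in \<open>\<Omega>\<close>).\<close>

definition H1_with_grad ::
  "(real^3) set \<Rightarrow> (real^3 \<Rightarrow> complex) \<Rightarrow> (real^3 \<Rightarrow> complex^3) \<Rightarrow> bool" where
  "H1_with_grad \<Omega> u Du \<longleftrightarrow> L2_on \<Omega> u \<and> L2_on \<Omega> Du \<and>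
     (\<forall>\<psi>. test_function \<Omega> \<psi> \<longrightarrow> (\<forall>j.
        (LINT x:\<Omega>|lebesgue. u x * grad \<psi> x $ j) = - (LINT x:\<Omega>|lebesgue. Du x $ j * \<psi> x)))"

text \<open>\<open>g\<close> represents the trace on \<open>frontier \<Omega>\<close> of the \<open>H\<^sup>1(\<Omega>)\<close> function \<open>u\<close> with weak gradient
  \<open>Du\<close>, the trace operator being the continuous extension to \<open>H\<^sup>1(\<Omega>)\<close>, with values in
  \<open>L\<^sup>2(frontier \<Omega>)\<close>, of the restriction map on \<open>C\<^sup>1\<close> functions. By the trace theorem every
  \<open>H\<^sup>1(\<Omega>)\<close> function on a bounded \<open>C\<^sup>2\<close> domain has a trace, unique almost everywhere with
  respect to the surface measure.\<close>

definition has_trace ::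
  "(real^3) set \<Rightarrow> (real^3 \<Rightarrow> complex) \<Rightarrow> (real^3 \<Rightarrow> complex^3) \<Rightarrow> (real^3 \<Rightarrow> complex) \<Rightarrow> bool" where
  "has_trace \<Omega> u Du g \<longleftrightarrow>
     g \<in> borel_measurable (surface_measure \<Omega>) \<and>
     integrable (surface_measure \<Omega>) (\<lambda>x. (cmod (g x))\<^sup>2) \<and>
     (\<exists>w :: nat \<Rightarrow> real^3 \<Rightarrow> complex. (\<forall>n. Ck_on 1 (w n) UNIV) \<and>
        (\<lambda>n. \<integral>\<^sup>+x\<in>\<Omega>. ennreal ((cmod (w n x - u x))\<^sup>2) \<partial>lebesgue) \<longlonglongrightarrow> 0 \<and>
        (\<lambda>n. \<integral>\<^sup>+x\<in>\<Omega>. ennreal ((norm (grad (w n) x - Du x))\<^sup>2) \<partial>lebesgue) \<longlonglongrightarrow> 0 \<and>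
        (\<lambda>n. \<integral>\<^sup>+x. ennreal ((cmod (w n x - g x))\<^sup>2) \<partial>surface_measure \<Omega>) \<longlonglongrightarrow> 0)"

text \<open>The source \<open>F\<close> extending \<open>\<rho>\<close> by zero outside \<open>D\<close>.\<close>

definition source :: "(real^3 \<Rightarrow> complex) \<Rightarrow> (real^3) set \<Rightarrow> real^3 \<Rightarrow> complex" where
  "source \<rho> D x = (if x \<in> D then \<rho> x else 0)"

text \<open>Weak form of \<open>\<Delta>u + k\<^sup>2u = F\<close> in \<open>\<Omega>\<close>.\<close>

definition weak_helmholtz ::
  "(real^3) set \<Rightarrow> real \<Rightarrow> (real^3 \<Rightarrow> complex) \<Rightarrow> (real^3 \<Rightarrow> complex) \<Rightarrow> (real^3 \<Rightarrow> complex^3)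
     \<Rightarrow> bool" where
  "weak_helmholtz \<Omega> k F u Du \<longleftrightarrow> (\<forall>\<psi>. test_function \<Omega> \<psi> \<longrightarrow>
     (LINT x:\<Omega>|lebesgue. - bdot (Du x) (grad \<psi> x) + complex_of_real (k\<^sup>2) * u x * \<psi> x)
       = (LINT x:\<Omega>|lebesgue. F x * \<psi> x))"

text \<open>The pairing of the weak normal derivative of \<open>u\<close> with the boundary values of the function
  \<open>g\<close> with gradient \<open>Dg\<close>.\<close>

definition normal_deriv_pairing ::
  "(real^3) set \<Rightarrow> real \<Rightarrow> (real^3 \<Rightarrow> complex) \<Rightarrow> (real^3 \<Rightarrow> complex) \<Rightarrow> (real^3 \<Rightarrow> complex^3)
     \<Rightarrow> (real^3 \<Rightarrow> complex) \<Rightarrow> (real^3 \<Rightarrow> complex^3) \<Rightarrow> complex" where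
  "normal_deriv_pairing \<Omega> k F u Du g Dg =
     (LINT x:\<Omega>|lebesgue. bdot (Du x) (Dg x) - complex_of_real (k\<^sup>2) * u x * g x + F x * g x)"

text \<open>The integral of \<open>(\<partial>u/\<partial>\<nu>) w - (\<partial>w/\<partial>\<nu>) u\<close> over \<open>frontier \<Omega>\<close> for a smooth function \<open>w\<close>,
  where \<open>tu\<close> is the trace of \<open>u\<close>.\<close>

definition boundary_form ::
  "(real^3) set \<Rightarrow> real \<Rightarrow> (real^3 \<Rightarrow> complex) \<Rightarrow> (real^3 \<Rightarrow> complex) \<Rightarrow> (real^3 \<Rightarrow> complex^3)
     \<Rightarrow> (real^3 \<Rightarrow> complex) \<Rightarrow> (real^3 \<Rightarrow> complex) \<Rightarrow> complex" where
  "boundary_form \<Omega> k F u Du tu w =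
     normal_deriv_pairing \<Omega> k F u Du w (grad w)
     - (LINT x:frontier \<Omega>|surface_measure \<Omega>.
          bdot (cvec (outward_normal \<Omega> x)) (grad w x) * tu x)"

section \<open>Complex geometrical optics solutions\<close>

definition S_perp :: "real^3 \<Rightarrow> (real^3) set" where
  "S_perp \<omega> = {\<theta>. norm \<theta> = 1 \<and> \<omega> \<bullet> \<theta> = 0}"

definition cgo :: "real \<Rightarrow> real^3 \<Rightarrow> real^3 \<Rightarrow> real \<Rightarrow> real^3 \<Rightarrow> complex" where
  "cgo k \<omega> \<theta> \<tau> x = exp (bdot (cvec x)
     (complex_of_real \<tau> *s cvec \<omega> + (\<i> * complex_of_real (sqrt (\<tau>\<^sup>2 + k\<^sup>2))) *s cvec \<theta>))"

definition cgo_tau :: "real \<Rightarrow> real^3 \<Rightarrow> real^3 \<Rightarrow> real \<Rightarrow> real^3 \<Rightarrow> complex" where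
  "cgo_tau k \<omega> \<theta> \<tau> x = bdot (cvec x)
     (cvec \<omega> + (\<i> * complex_of_real (\<tau> / sqrt (\<tau>\<^sup>2 + k\<^sup>2))) *s cvec \<theta>) * cgo k \<omega> \<theta> \<tau> x"

lemma bdot_cvec: "bdot (cvec x) (cvec y) = complex_of_real (x \<bullet> y)"
  by (simp add: bdot_def cvec_def inner_vec_def)

lemma bdot_add_right: "bdot a (b + c) = bdot a b + bdot a c"
  by (simp add: bdot_def sum.distrib distrib_left)

lemma bdot_scale_right: "bdot a (c *s b) = c * bdot a b"
  by (simp add: bdot_def sum_distrib_left mult_ac)

lemma cgo_tau_is_derivative:
  assumes "\<tau> > 0"
  shows "((\<lambda>t. cgo k \<omega> \<theta> t x) has_vector_derivative cgo_tau k \<omega> \<theta> \<tau> x) (at \<tau>)"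
proof -
  have pos: "\<tau>\<^sup>2 + k\<^sup>2 > 0"
    using assms by (simp add: add_pos_nonneg)
  have "((\<lambda>t. sqrt (t\<^sup>2 + k\<^sup>2)) has_real_derivative \<tau> / sqrt (\<tau>\<^sup>2 + k\<^sup>2)) (at \<tau>)"
    using pos by (auto intro!: derivative_eq_intros simp: field_simps)
  then have s: "((\<lambda>t. complex_of_real (sqrt (t\<^sup>2 + k\<^sup>2))) has_vector_derivative
      complex_of_real (\<tau> / sqrt (\<tau>\<^sup>2 + k\<^sup>2))) (at \<tau>)"
    by (rule has_vector_derivative_of_real)
  have t: "(complex_of_real has_vector_derivative 1) (at \<tau>)"
    using has_vector_derivative_of_real[OF DERIV_ident] by simp
  let ?a = "complex_of_real (x \<bullet> \<omega>)" and ?b = "\<i> * complex_of_real (x \<bullet> \<theta>)"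
  have lin: "((\<lambda>t. complex_of_real t * ?a + complex_of_real (sqrt (t\<^sup>2 + k\<^sup>2)) * ?b)
      has_vector_derivative 1 * ?a + complex_of_real (\<tau> / sqrt (\<tau>\<^sup>2 + k\<^sup>2)) * ?b) (at \<tau>)"
    by (intro has_vector_derivative_add has_vector_derivative_mult_left s t)
  have "((\<lambda>t. exp (complex_of_real t * ?a + complex_of_real (sqrt (t\<^sup>2 + k\<^sup>2)) * ?b))
      has_vector_derivative (1 * ?a + complex_of_real (\<tau> / sqrt (\<tau>\<^sup>2 + k\<^sup>2)) * ?b) *
        exp (complex_of_real \<tau> * ?a + complex_of_real (sqrt (\<tau>\<^sup>2 + k\<^sup>2)) * ?b)) (at \<tau>)"
    using field_vector_diff_chain_at[OF lin, of exp] DERIV_exp by (simp add: o_def)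
  then show ?thesis
    unfolding cgo_tau_def cgo_def bdot_add_right bdot_scale_right bdot_cvec
    by (simp add: mult_ac)
qed

section \<open>Conical singularities\<close>

definition support_fun :: "(real^3) set \<Rightarrow> real^3 \<Rightarrow> real" where
  "support_fun D \<omega> = (SUP x\<in>D. x \<bullet> \<omega>)"

definition regular_direction :: "(real^3) set \<Rightarrow> real^3 \<Rightarrow> bool" where
  "regular_direction D \<omega> \<longleftrightarrow> (\<exists>p. {x \<in> closure D. x \<bullet> \<omega> = support_fun D \<omega>} = {p})"

definition contact_point :: "(real^3) set \<Rightarrow> real^3 \<Rightarrow> real^3" where
  "contact_point D \<omega> = (THE p. {x \<in> closure D. x \<bullet> \<omega> = support_fun D \<omega>} = {p})"

text \<open>\<open>Q\<close> is an admissible base for a cone with vertex \<open>p\<close>, axis direction \<open>\<omega>\<close> and height \<open>\<delta>\<close>.\<close>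

definition cone_base :: "real^3 \<Rightarrow> real^3 \<Rightarrow> real \<Rightarrow> (real^3) set \<Rightarrow> bool" where
  "cone_base p \<omega> \<delta> Q \<longleftrightarrow> Q \<noteq> {} \<and> bounded Q \<and>
     openin (top_of_set {x. x \<bullet> \<omega> = p \<bullet> \<omega> - \<delta>}) Q"

definition cone_set :: "real^3 \<Rightarrow> real^3 \<Rightarrow> real \<Rightarrow> (real^3) set \<Rightarrow> (real^3) set" where
  "cone_set p \<omega> \<delta> Q = (\<Union>s\<in>{0<..<\<delta>}. (\<lambda>z. p + (s / \<delta>) *\<^sub>R (z - p)) ` Q)"

text \<open>\<open>D\<close> has a conical singularity from direction \<open>\<omega>\<close>, realised by \<open>\<delta>\<close> and \<open>Q\<close>.\<close>

definition conical_singularity ::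
  "(real^3) set \<Rightarrow> real^3 \<Rightarrow> real \<Rightarrow> (real^3) set \<Rightarrow> bool" where
  "conical_singularity D \<omega> \<delta> Q \<longleftrightarrow> regular_direction D \<omega> \<and> \<delta> > 0 \<and>
     cone_base (contact_point D \<omega>) \<omega> \<delta> Q \<and>
     D \<inter> {x. support_fun D \<omega> - \<delta> < x \<bullet> \<omega> \<and> x \<bullet> \<omega> < support_fun D \<omega>}
       = cone_set (contact_point D \<omega>) \<omega> \<delta> Q"

text \<open>Surface measure of the plane \<open>x \<bullet> \<omega> = c\<close>: the image of two-dimensional Lebesgue measure under
  an isometric parametrisation. It does not depend on the parametrisation.\<close>

definition plane_measure :: "real^3 \<Rightarrow> real \<Rightarrow> (real^3) measure" where
  "plane_measure \<omega> c = distr (lborel :: (real^2) measure) borel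
     (SOME E. (\<forall>y z. dist (E y) (E z) = dist y z) \<and> range E = {x. x \<bullet> \<omega> = c})"

text \<open>The value does not depend on the height \<open>s\<close> of the slice as long as \<open>0 < s < \<delta>\<close>.\<close>

definition cone_const ::
  "real^3 \<Rightarrow> real^3 \<Rightarrow> real \<Rightarrow> (real^3) set \<Rightarrow> real^3 \<Rightarrow> real \<Rightarrow> complex" where
  "cone_const p \<omega> \<delta> Q \<theta> s = 2 * complex_of_real s *
     (LINT z:cone_set p \<omega> \<delta> Q \<inter> {x. x \<bullet> \<omega> = p \<bullet> \<omega> - s}|plane_measure \<omega> (p \<bullet> \<omega> - s).
        1 / (complex_of_real s - \<i> * complex_of_real ((z - p) \<bullet> \<theta>)) ^ 3)"

definition holder_on :: "(real^3) set \<Rightarrow> real \<Rightarrow> (real^3 \<Rightarrow> complex) \<Rightarrow> bool" where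
  "holder_on S \<alpha> f \<longleftrightarrow> (\<exists>L. \<forall>x\<in>S. \<forall>y\<in>S. cmod (f x - f y) \<le> L * dist x y powr \<alpha>)"

text \<open>\<open>f\<^sub>\<theta>(\<tau>) = O(\<tau>\<^bsup>-\<alpha>\<^esup>)\<close> as \<open>\<tau> \<rightarrow> \<infinity>\<close>, uniformly for \<open>\<theta> \<in> \<Theta>\<close>.\<close>

definition uniformly_O ::
  "(real^3) set \<Rightarrow> real \<Rightarrow> (real^3 \<Rightarrow> real \<Rightarrow> complex) \<Rightarrow> bool" where
  "uniformly_O \<Theta> \<alpha> f \<longleftrightarrow>
     (\<exists>K. \<forall>\<^sub>F \<tau> in at_top. \<forall>\<theta>\<in>\<Theta>. cmod (f \<theta> \<tau>) \<le> K * \<tau> powr (- \<alpha>))"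

end

theory Submission
  imports Defs "HOL-Probability.Distributions"
begin

text \<open>
  For a solution \<open>v\<close> of \<open>\<Delta>v + k\<^sup>2v = 0\<close>, Green's formula turns the boundary form into
  \<open>\<integral>\<^sub>D \<rho> v\<close>. Green's formula for an \<open>H\<^sup>1\<close> function with a trace follows by approximation from the
  divergence theorem for \<open>C\<^sup>1\<close> functions, which is obtained chart by chart and glued with a partition of
  unity. The same divergence theorem, used in two overlapping charts, shows that the area measures of the
  two graphs agree, so that the surface measure exists and is unique.

  The normalised integrand decays like \<open>e\<^bsup>-\<tau>r\<^esup>\<close> in the depth \<open>r = (p - x) \<bullet> \<omega>\<close> below the vertex \<open>p\<close>. Up to
  \<open>O(\<tau>\<^bsup>-3-\<alpha>\<^esup>)\<close> the amplitude may be frozen at \<open>p\<close> by Hoelder continuity, \<open>sqrt (\<tau>\<^sup>2 + k\<^sup>2)\<close> may be replaced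
  by \<open>\<tau>\<close>, and \<open>D\<close> by the infinite cone over \<open>Q\<close>. The remaining integral is computed slice by slice from
  \<open>\<integral>\<^sub>0\<^sup>\<infinity> r\<^sup>2 e\<^bsup>-zr\<^esup> dr = 2 / z\<^sup>3\<close>.
\<close>

section \<open>Isometries and Lebesgue measure\<close>

text \<open>Both \<open>outward_normal\<close> and \<open>surface_measure\<close> are definite
  descriptions, so nothing can be computed with them until different charts are known to agree; this
  is why a large share of the work is geometric. The cut-off functions are only C^1 and are built
  from the square of a positive part. The power \<tau>^(-3) is the scaling of a three-dimensional
  cone: depths r of order 1 / \<tau> carry the mass. On the cone the distance to the vertex is at
  most a constant times r, so the Hoelder error is of order r^\<alpha>, and integrating it gains the
  factor \<tau>^(-\<alpha>). The errors of the other replacements are bounded by a relative order 1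
  / \<tau>, which for \<tau> \<ge> 1 is at most \<tau>^(-\<alpha>) because \<alpha> \<le> 1. All
  errors are estimated in absolute value, where \<theta> enters only through its unit length; hence
  the uniformity. The slice integral in \<open>cone_const\<close> arises because on each ray from
  the vertex the exponent is linear in r, so that the radial integral is explicit and only the
  direction of the ray is left to integrate over.\<close>

text \<open>Polarisation: after subtraction of \<open>A 0\<close> norms and distances are preserved,
  hence inner products. Expanding the squared norms of the additivity and homogeneity defects by
  inner products alone then gives 0.\<close>

lemma isometry_imp_linear:
  fixes A :: "'a::real_inner \<Rightarrow> 'b::real_inner"
  assumes "\<And>z w. dist (A z) (A w) = dist z w"
  shows "linear (\<lambda>w. A w - A 0)" "(A z - A 0) \<bullet> (A w - A 0) = z \<bullet> w"
proof -
  define f where "f w = A w - A 0" for w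
  have n: "norm (f z) = norm z" for z
    using assms[of z 0] by (simp add: dist_norm f_def)
  have d: "norm (f z - f w) = norm (z - w)" for z w
    using assms[of z w] by (simp add: dist_norm f_def)
  have i: "f z \<bullet> f w = z \<bullet> w" for z w
    using d[of z w] n[of z] n[of w] by (simp add: dot_norm_neg)
  then show "(A z - A 0) \<bullet> (A w - A 0) = z \<bullet> w" by (simp add: f_def)
  have "f (x + y) - (f x + f y) = 0" for x y
  proof -
    have "(f (x + y) - (f x + f y)) \<bullet> (f (x + y) - (f x + f y)) = 0"
      by (simp add: inner_diff_left inner_diff_right inner_add_left inner_add_right i)
    then show ?thesis by simp
  qed
  moreover have "f (c *\<^sub>R x) - c *\<^sub>R f x = 0" for c x
  proof -
    have "(f (c *\<^sub>R x) - c *\<^sub>R f x) \<bullet> (f (c *\<^sub>R x) - c *\<^sub>R f x) =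
      f (c *\<^sub>R x) \<bullet> f (c *\<^sub>R x) - 2 * c * (f x \<bullet> f (c *\<^sub>R x)) + c * c * (f x \<bullet> f x)"
      by (simp add: inner_diff_left inner_diff_right inner_commute algebra_simps)
    also have "\<dots> = 0" unfolding i by simp
    finally show ?thesis by simp
  qed
  ultimately have "linear f" by (intro linearI) simp_all
  then show "linear (\<lambda>w. A w - A 0)" by (simp add: f_def[abs_def])
qed

lemma isometry_continuous:
  fixes A :: "'a::metric_space \<Rightarrow> 'b::metric_space"
  assumes "\<And>z w. dist (A z) (A w) = dist z w"
  shows "continuous_on S A"
  using assms by (intro lipschitz_on_continuous_on[of 1] lipschitz_onI) auto

text \<open>\<open>lborel\<close> is determined by the measure of boxes. The preimage of a box is
  its image under the inverse map, which is orthogonal again and therefore keeps the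
  measure.\<close>

lemma lborel_distr_orthogonal:
  fixes f :: "real^'n::{finite,wellorder} \<Rightarrow> real^'n::_"
  assumes "orthogonal_transformation f"
  shows "distr lborel borel f = lborel"
proof (rule lborel_eqI[symmetric])
  have lin: "linear f" and bij: "bij f"
    using assms orthogonal_transformation_linear orthogonal_transformation_bij by auto
  then have [measurable]: "f \<in> borel_measurable borel"
    by (simp add: borel_measurable_continuous_onI linear_continuous_on linear_conv_bounded_linear)
  fix l u :: "real^'n::_" assume le: "\<And>b. b \<in> Basis \<Longrightarrow> l \<bullet> b \<le> u \<bullet> b"
  have o: "orthogonal_transformation (inv f)"
    using assms orthogonal_transformation_inv by blast
  have v: "f -` box l u = inv f ` box l u"
    using bij bij_vimage_eq_inv_image by blast
  have b: "box l u \<in> lmeasurable" by simp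
  have m: "inv f ` box l u \<in> lmeasurable" by (rule measurable_orthogonal_image[OF o b])
  have "emeasure (distr lborel borel f) (box l u) = emeasure lebesgue (inv f ` box l u)"
    using measurable_sets_borel[of f borel "box l u"]
    by (subst emeasure_distr) (auto simp: v[symmetric])
  also have "\<dots> = ennreal (measure lebesgue (inv f ` box l u))"
    using m by (simp add: emeasure_eq_measure2 )
  also have "\<dots> = ennreal (measure lebesgue (box l u))"
    by (simp add: measure_orthogonal_image[OF o b])
  finally show "emeasure (distr lborel borel f) (box l u) = (\<Prod>b\<in>Basis. (u - l) \<bullet> b)"
    using le by (simp add: measure_lborel_box_eq)
qed simp

text \<open>The source may be a product such as \<open>(real^2) \<times> real\<close>, so
  \<open>A\<close> is not itself a self-map to which orthogonality applies. It is factored into a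
  relabelling \<open>J\<close> of coordinates, an orthogonal map \<open>T\<close> of the target and
  a translation, each of which preserves \<open>lborel\<close>.\<close>

lemma lborel_distr_isometry:
  fixes A :: "'a::euclidean_space \<Rightarrow> real^'n::{finite,wellorder}"
  assumes iso: "\<And>z w. dist (A z) (A w) = dist z w" and dim: "DIM('a) = CARD('n)"
  shows "distr lborel borel A = lborel" "surj A"
proof -
  have "card (Basis::'a set) = card (Basis :: (real^'n::_) set)" using dim by simp
  then obtain \<sigma> where \<sigma>: "bij_betw \<sigma> (Basis::'a set) (Basis :: (real^'n::_) set)"
    using finite_same_card_bij[OF finite_Basis finite_Basis] by blast
  define \<iota> where "\<iota> = inv_into (Basis::'a set) \<sigma>"
  have \<iota>: "bij_betw \<iota> Basis Basis" unfolding \<iota>_def using \<sigma> by (rule bij_betw_inv_into)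
  have i1: "\<iota> (\<sigma> b) = b" if "b \<in> Basis" for b
    using \<sigma> that by (simp add: \<iota>_def bij_betw_inv_into_left)
  have i2: "\<sigma> (\<iota> b) = b" if "b \<in> Basis" for b
    using \<sigma> that by (simp add: \<iota>_def bij_betw_inv_into_right)
  have \<sigma>B: "\<sigma> b \<in> Basis" if "b \<in> Basis" for b using \<sigma> that bij_betwE by blast
  have \<iota>B: "\<iota> b \<in> Basis" if "b \<in> Basis" for b using \<iota> that bij_betwE by blast
  \<comment> \<open>\<open>J\<close> carries one basis to the other along the bijection
    \<open>\<sigma>\<close> and \<open>K\<close> is its inverse; the preimage of a box under
    \<open>J\<close> is a box with the same side lengths in another order.\<close>
  define J where "J x = (\<Sum>b\<in>Basis. (x \<bullet> b) *\<^sub>R \<sigma> b)" for x :: 'a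
  define K where "K x = (\<Sum>b\<in>Basis. (x \<bullet> b) *\<^sub>R \<iota> b)" for x :: "real^'n::_"
  have J\<sigma>: "J x \<bullet> \<sigma> b = x \<bullet> b" if "b \<in> Basis" for x b
  proof -
    have "J x \<bullet> \<sigma> b = (\<Sum>c\<in>Basis. (x \<bullet> c) * (\<sigma> c \<bullet> \<sigma> b))" by (simp add: J_def inner_sum_left)
    also have "\<dots> = (\<Sum>c\<in>Basis. if c = b then x \<bullet> c else 0)"
      using that i1 by (intro sum.cong refl) (auto simp: inner_Basis \<sigma>B, metis)
    finally show ?thesis using that by simp
  qed
  have Jb: "J x \<bullet> b = x \<bullet> \<iota> b" if "b \<in> Basis" for x b
    using J\<sigma>[OF \<iota>B[OF that]] i2[OF that] by simp
  have Kb: "K x \<bullet> b = x \<bullet> \<sigma> b" if "b \<in> Basis" for x b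
  proof -
    have "K x \<bullet> b = (\<Sum>c\<in>Basis. (x \<bullet> c) * (\<iota> c \<bullet> b))" by (simp add: K_def inner_sum_left)
    also have "\<dots> = (\<Sum>c\<in>Basis. if c = \<sigma> b then x \<bullet> c else 0)"
    proof (intro sum.cong refl)
      fix c :: "real^'n::_" assume c: "c \<in> Basis"
      have "\<iota> c = b \<longleftrightarrow> c = \<sigma> b" using i1[OF that] i2[OF c] by auto
      then show "(x \<bullet> c) * (\<iota> c \<bullet> b) = (if c = \<sigma> b then x \<bullet> c else 0)"
        using inner_Basis[OF \<iota>B[OF c] that] by auto
    qed
    finally show ?thesis using that \<sigma>B by simp
  qed
  have KJ: "K (J x) = x" for x by (rule euclidean_eqI) (simp add: Kb J\<sigma>)

  have Kin: "K x \<bullet> K y = x \<bullet> y" for x y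
  proof -
    have "K x \<bullet> K y = (\<Sum>b\<in>Basis. (x \<bullet> \<sigma> b) * (y \<bullet> \<sigma> b))"
      by (subst euclidean_inner) (simp add: Kb)
    also have "\<dots> = (\<Sum>b\<in>Basis. (x \<bullet> b) * (y \<bullet> b))"
      using sum.reindex_bij_betw[OF \<sigma>, of "\<lambda>b. (x \<bullet> b) * (y \<bullet> b)"] by simp
    finally show ?thesis by (simp add: euclidean_inner[symmetric])
  qed
  have linK: "linear K" unfolding K_def
    by (intro linearI) (simp_all add: inner_add_left scaleR_add_left sum.distrib scaleR_sum_right)
  have [measurable]: "J \<in> borel_measurable borel" unfolding J_def by measurable
  have [measurable]: "A \<in> borel_measurable borel"
  proof -
    have "continuous_on UNIV A" by (rule isometry_continuous[OF iso])
    then show ?thesis by (rule borel_measurable_continuous_onI)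
  qed
  have dJ: "distr lborel borel J = lborel"
  proof (rule lborel_eqI[symmetric])
    fix l u :: "real^'n::_" assume le: "\<And>b. b \<in> Basis \<Longrightarrow> l \<bullet> b \<le> u \<bullet> b"
    have "J -` box l u = box (K l) (K u)"
    proof (intro set_eqI)
      fix x
      have "x \<in> J -` box l u \<longleftrightarrow> (\<forall>i\<in>Basis. l \<bullet> i < x \<bullet> \<iota> i \<and> x \<bullet> \<iota> i < u \<bullet> i)"
        by (simp add: box_def Jb)
      also have "\<dots> \<longleftrightarrow> (\<forall>i\<in>Basis. l \<bullet> \<sigma> i < x \<bullet> i \<and> x \<bullet> i < u \<bullet> \<sigma> i)"
        using i1 i2 \<sigma>B \<iota>B by metis
      finally show "x \<in> J -` box l u \<longleftrightarrow> x \<in> box (K l) (K u)" by (simp add: box_def Kb)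
    qed
    then have "emeasure (distr lborel borel J) (box l u) = emeasure lborel (box (K l) (K u))"
      by (subst emeasure_distr) auto
    also have "\<dots> = (\<Prod>b\<in>Basis. (u - l) \<bullet> \<sigma> b)"
      using le \<sigma>B by (subst emeasure_lborel_box) (auto simp: inner_diff_left Kb)
    also have "\<dots> = (\<Prod>b\<in>Basis. (u - l) \<bullet> b)"
      using prod.reindex_bij_betw[OF \<sigma>, of "\<lambda>b. (u - l) \<bullet> b"] by simp
    finally show "emeasure (distr lborel borel J) (box l u) = (\<Prod>b\<in>Basis. (u - l) \<bullet> b)" .
  qed simp
  define T where "T x = A (K x) - A 0" for x
  have oT: "orthogonal_transformation T"
  proof -
    have "linear (\<lambda>w. A w - A 0)" by (rule isometry_imp_linear(1)[OF iso])
    from linear_compose[OF linK this] have "linear T" by (simp add: T_def[abs_def] o_def)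
    then show ?thesis unfolding orthogonal_transformation_def
      by (simp add: T_def isometry_imp_linear(2)[OF iso] Kin)
  qed
  have [measurable]: "T \<in> borel_measurable borel"
    by (rule borel_measurable_continuous_onI, rule linear_continuous_on)
      (use orthogonal_transformation_linear[OF oT] in \<open>simp add: linear_conv_bounded_linear\<close>)
  have A: "A = (\<lambda>x. A 0 + T (J x))" by (simp add: T_def KJ fun_eq_iff)
  have "distr lborel borel A = distr (distr (distr lborel borel J) borel T) borel (\<lambda>x. A 0 + x)"
    by (subst distr_distr, simp, simp, subst distr_distr, simp, simp, subst A) (simp add: o_def)
  also have "\<dots> = lborel" by (simp add: dJ lborel_distr_orthogonal[OF oT] lborel_distr_plus)
  finally show "distr lborel borel A = lborel" .
  show "surj A"
  proof (rule surjI)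
    fix y
    show "A (K (inv T (y - A 0))) = y"
      using surj_f_inv_f[OF orthogonal_transformation_surj[OF oT], of "y - A 0"] by (simp add: T_def)
  qed
qed

section \<open>The divergence theorem under a graph\<close>

lemma derivative_zero_outside:
  fixes f :: "'a::real_normed_vector \<Rightarrow> 'b::real_normed_vector"
  assumes "(f has_derivative f') (at x)" "closed K" "\<And>x. x \<notin> K \<Longrightarrow> f x = 0" "x \<notin> K"
  shows "f' v = 0"
proof -
  have "((\<lambda>x. 0) has_derivative f') (at x)"
    by (rule has_derivative_transform_within_open[OF assms(1), of "- K"]) (use assms in auto)
  then have "f' = (\<lambda>h. 0)" by (rule has_derivative_unique) simp
  then show ?thesis by simp
qed

lemma integrable_compact_support:
  fixes f :: "'a::euclidean_space \<Rightarrow> 'b::{banach, second_countable_topology}"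
  assumes "continuous_on K f" "compact K" "\<And>x. x \<notin> K \<Longrightarrow> f x = 0"
  shows "integrable lborel f"
proof -
  have "(\<lambda>x. indicator K x *\<^sub>R f x) = f" using assms(3) by (auto simp: fun_eq_iff indicator_def)
  then show ?thesis using borel_integrable_compact[OF assms(2,1)] by simp
qed

text \<open>Translation invariance of \<open>lborel\<close> makes the difference quotients of
  \<open>F\<close> along \<open>v\<close> integrate to 0, and dominated convergence hands this on to
  the directional derivative.\<close>

lemma integral_derivative_compact_support:
  fixes F :: "'a::euclidean_space \<Rightarrow> 'b::euclidean_space"
  assumes F: "\<And>x. (F has_derivative F' x) (at x)" and c: "continuous_on UNIV (\<lambda>x. F' x v)"
    and K: "compact K" "\<And>x. x \<notin> K \<Longrightarrow> F x = 0"
  shows "(LINT x|lborel. F' x v) = 0"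
proof (cases "v = 0")
  case True
  have "F' x 0 = 0" for x using F[of x] has_derivative_linear linear_0 by blast
  then show ?thesis using True by simp
next
  case False
  have z: "F' x v = 0" if "x \<notin> K" for x
    using derivative_zero_outside[OF F compact_imp_closed[OF K(1)] K(2) that] .
  have contF: "continuous_on S F" for S
    using F continuous_at_imp_continuous_on has_derivative_continuous by blast
  have intF: "integrable lborel F" by (rule integrable_compact_support[OF contF K])
  obtain B0 where B0: "\<And>x. x \<in> K \<Longrightarrow> norm (F' x v) \<le> B0"
    using compact_imp_bounded[OF compact_continuous_image[OF continuous_on_subset[OF c] K(1)]]
    by (auto simp: bounded_iff)
  \<comment> \<open>The maximum with 0 covers the points outside \<open>K\<close>, where the
    derivative vanishes, in case the bound found on \<open>K\<close> is negative.\<close>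
  define B where "B = max 0 B0"
  have B: "norm (F' x v) \<le> B" for x using B0[of x] z[of x] by (cases "x \<in> K") (auto simp: B_def)
  define h where "h n = (1 / real (Suc n)) *\<^sub>R v" for n
  define q where "q n x = real (Suc n) *\<^sub>R (F (h n + x) - F x)" for n x
  \<comment> \<open>\<open>K\<close> swept backwards along \<open>v\<close> for times in [0, 1]: one
    compact set containing the supports of all quotients \<open>q n\<close>, as the steps
    \<open>1 / Suc n\<close> are at most 1.\<close>
  define K2 where "K2 = (\<lambda>(t, x). x - t *\<^sub>R v) ` ({0..1} \<times> K)"
  have cK2: "compact K2" unfolding K2_def
    by (intro compact_continuous_image compact_Times K) (auto intro!: continuous_intros simp: split_beta)
  have hlim: "filterlim h (at 0) sequentially"
  proof (rule filterlim_atI)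
    have "(\<lambda>n. (1 / real (Suc n)) *\<^sub>R v) \<longlonglongrightarrow> 0 *\<^sub>R v"
      by (intro tendsto_intros) (use LIMSEQ_inverse_real_of_nat in \<open>simp add: inverse_eq_divide\<close>)
    then show "h \<longlonglongrightarrow> 0" by (simp add: h_def[abs_def])
  qed (use False in \<open>auto simp: h_def\<close>)
  have lim: "(\<lambda>n. q n x) \<longlonglongrightarrow> F' x v" for x
  proof -
    have l: "linear (F' x)" using F has_derivative_linear by blast
    have "((\<lambda>k. norm (F (x + k) - F x - F' x k) / norm k) \<longlongrightarrow> 0) (at 0)"
      using F[of x] by (simp add: has_derivative_at)
    then have "(\<lambda>n. norm (F (x + h n) - F x - F' x (h n)) / norm (h n)) \<longlonglongrightarrow> 0"
      by (rule filterlim_compose[OF _ hlim])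
    then have "(\<lambda>n. norm v * (norm (F (x + h n) - F x - F' x (h n)) / norm (h n))) \<longlonglongrightarrow> norm v * 0"
      by (rule tendsto_mult_left)
    moreover have "norm v * (norm (F (x + h n) - F x - F' x (h n)) / norm (h n)) = norm (q n x - F' x v)" for n
    proof -
      have "q n x - F' x v = real (Suc n) *\<^sub>R (F (x + h n) - F x - F' x (h n))"
        by (simp add: q_def h_def linear_scale[OF l] scaleR_diff_right add.commute)
      then have "norm (q n x - F' x v) = real (Suc n) * norm (F (x + h n) - F x - F' x (h n))"
        by simp
      moreover have "norm (h n) = norm v / real (Suc n)" by (simp add: h_def)
      ultimately show ?thesis using False by simp
    qed
    ultimately show ?thesis by (simp add: LIM_zero_iff tendsto_norm_zero_iff)
  qed
  have bd: "norm (q n x) \<le> B * indicator K2 x" for n x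
  proof (cases "x \<in> K2")
    case True
    have "norm (F (x + (1 / real (Suc n)) *\<^sub>R v) - F (x + 0 *\<^sub>R v)) \<le> B * norm (1 / real (Suc n) - 0)"
    proof (rule differentiable_bound[of UNIV "\<lambda>t. F (x + t *\<^sub>R v)" "\<lambda>t k. F' (x + t *\<^sub>R v) (k *\<^sub>R v)"])
      show "((\<lambda>t. F (x + t *\<^sub>R v)) has_derivative (\<lambda>k. F' (x + t *\<^sub>R v) (k *\<^sub>R v))) (at t within UNIV)" for t
        by (rule has_derivative_compose[of "\<lambda>t. x + t *\<^sub>R v", OF _ F]) (auto intro!: derivative_eq_intros)
      show "onorm (\<lambda>k. F' (x + t *\<^sub>R v) (k *\<^sub>R v)) \<le> B" for t
      proof (rule onorm_le)
        fix k :: real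
        have l: "linear (F' (x + t *\<^sub>R v))" using F has_derivative_linear by blast
        show "norm (F' (x + t *\<^sub>R v) (k *\<^sub>R v)) \<le> B * norm k"
          using mult_left_mono[OF B[of "x + t *\<^sub>R v"], of "\<bar>k\<bar>"] by (simp add: linear_scale[OF l] mult.commute)
      qed
    qed auto
    then have "norm (F (h n + x) - F x) \<le> B / real (Suc n)" by (simp add: h_def add.commute)
    then have "real (Suc n) * norm (F (h n + x) - F x) \<le> B" by (simp add: field_simps)
    then show ?thesis using True by (simp add: q_def del: of_nat_Suc)
  next
    case F: False
    have "x \<notin> K"
    proof
      assume "x \<in> K"
      then have "x - 0 *\<^sub>R v \<in> K2" unfolding K2_def by force
      then show False using F by simp
    qed
    moreover have "h n + x \<notin> K"
    proof
      assume "h n + x \<in> K"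
      then have "(h n + x) - (1 / real (Suc n)) *\<^sub>R v \<in> K2" unfolding K2_def by (intro image_eqI[of _ _ "(1 / real (Suc n), h n + x)"]) auto
      then show False using F by (simp add: h_def)
    qed
    ultimately show ?thesis using F K(2) by (simp add: q_def)
  qed
  have q0: "(LINT x|lborel. q n x) = 0" for n
  proof -
    have m: "F \<in> borel_measurable borel" using contF by (rule borel_measurable_continuous_onI)
    have d: "lborel = distr lborel borel ((+) (h n))" by (simp add: lborel_distr_plus)
    have i: "integrable lborel (\<lambda>x. F (h n + x))"
      using intF by (subst (asm) d, subst (asm) integrable_distr_eq) (use m in auto)
    have "(LINT x|lborel. F (h n + x)) = (LINT x|lborel. F x)"
      by (subst (2) d, subst integral_distr) (use m in auto)
    then show ?thesis using i intF by (simp add: q_def)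
  qed
  have "(\<lambda>n. LINT x|lborel. q n x) \<longlonglongrightarrow> (LINT x|lborel. F' x v)"
  proof (rule integral_dominated_convergence[where w = "\<lambda>x. B * indicator K2 x"])
    show "(\<lambda>x. F' x v) \<in> borel_measurable lborel" using borel_measurable_continuous_onI[OF c] by simp
    show "q n \<in> borel_measurable lborel" for n unfolding q_def
      by (simp, intro borel_measurable_continuous_onI continuous_intros continuous_on_compose2[OF contF[of UNIV]]) auto
    show "integrable lborel (\<lambda>x. B * indicator K2 x)"
      using cK2 by (intro integrable_mult_right integrable_real_indicator emeasure_bounded_finite)
        (auto simp: borel_compact compact_imp_bounded)
  qed (use lim bd in auto)
  then have "(\<lambda>n. 0::'b) \<longlonglongrightarrow> (LINT x|lborel. F' x v)" by (simp add: q0)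
  then show ?thesis using LIMSEQ_const_iff[of "0::'b"] by simp
qed

section \<open>Fubini, translation and the region below a graph\<close>

lemma integral_fst_lborel:
  fixes f :: "'a::euclidean_space \<times> 'b::euclidean_space \<Rightarrow> 'c::{banach, second_countable_topology}"
  assumes "integrable lborel f"
  shows "(LINT z|lborel. f z) = (LINT x|lborel. LINT y|lborel. f (x, y))"
    and "(LINT z|lborel. f z) = (LINT y|lborel. LINT x|lborel. f (x, y))"
    and "integrable lborel (\<lambda>x. LINT y|lborel. f (x, y))"
    and "integrable lborel (\<lambda>y. LINT x|lborel. f (x, y))"
proof -
  have i: "integrable (lborel \<Otimes>\<^sub>M lborel) f" using assms by (simp add: lborel_prod)
  have i': "integrable (lborel \<Otimes>\<^sub>M lborel) (\<lambda>(x, y). f (x, y))" using i by simp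
  show "(LINT z|lborel. f z) = (LINT x|lborel. LINT y|lborel. f (x, y))"
    using lborel_pair.integral_fst[OF i'] by (simp add: lborel_prod)
  show "(LINT z|lborel. f z) = (LINT y|lborel. LINT x|lborel. f (x, y))"
    using lborel_pair.integral_snd[OF i'] by (simp add: lborel_prod)
  show "integrable lborel (\<lambda>x. LINT y|lborel. f (x, y))"
    using lborel_pair.integrable_fst[OF i'] by simp
  show "integrable lborel (\<lambda>y. LINT x|lborel. f (x, y))"
    using lborel_pair.integrable_snd[OF i'] by simp
qed

lemma integral_shift_real:
  fixes f :: "real \<Rightarrow> 'b::euclidean_space"
  shows "(LINT t|lborel. f t) = (LINT s|lborel. f (c + s))"
  using lborel_integral_real_affine[of 1 f c] by simp

text \<open>After the shear \<open>t = \<phi> y + s\<close> the part of the integrand tangential to the graph is, for every fixed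
  \<open>s\<close>, the derivative of a compactly supported function of \<open>y\<close>, so that only the vertical part contributes.\<close>

lemma graph_divergence:
  fixes g :: "'a::euclidean_space \<times> real \<Rightarrow> 'b::euclidean_space"
  assumes U: "open U" and \<phi>: "\<And>y. y \<in> U \<Longrightarrow> (\<phi> has_derivative \<phi>' y) (at y)"
    and c\<phi>': "continuous_on U (\<lambda>y. \<phi>' y v)"
    and g: "\<And>z. (g has_derivative g' z) (at z)" and cg': "\<And>w. continuous_on UNIV (\<lambda>z. g' z w)"
    and K: "compact K" "K \<subseteq> U \<times> {a<..}" "\<And>z. z \<notin> K \<Longrightarrow> g z = 0"
  shows "(LINT z|lborel. indicator {(y, t). y \<in> U \<and> a < t \<and> t < \<phi> y} z *\<^sub>R g' z (v, c)) =
    (LINT y|lborel. indicator U y *\<^sub>R ((c - \<phi>' y v) *\<^sub>R g (y, \<phi> y)))"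
proof -
  have c\<phi>: "continuous_on U \<phi>"
    using \<phi> by (meson continuous_at_imp_continuous_on has_derivative_continuous)
  have contg: "continuous_on S g" for S
    using g continuous_at_imp_continuous_on has_derivative_continuous by blast
  have z: "g' z w = 0" if "z \<notin> K" for z w
    using derivative_zero_outside[OF g compact_imp_closed[OF K(1)] K(3) that] .
  have lin: "linear (g' z)" for z using g has_derivative_linear by blast
  let ?S = "{(y, t). y \<in> U \<and> a < t \<and> t < \<phi> y}"
  have oS: "open ?S"
  proof -
    have "open ((U \<times> UNIV) \<inter> (\<lambda>z. snd z - \<phi> (fst z)) -` {..<0})"
      by (intro continuous_open_preimage open_Times U continuous_intros continuous_on_compose2[OF c\<phi>]) auto
    moreover have "?S = ((U \<times> UNIV) \<inter> (\<lambda>z. snd z - \<phi> (fst z)) -` {..<0}) \<inter> (UNIV \<times> {a<..})" by auto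
    ultimately show ?thesis by (auto intro!: open_Int open_Times)
  qed
  define K' where "K' = (\<lambda>z. (fst z, snd z - \<phi> (fst z))) ` K"
  have cK': "compact K'" unfolding K'_def
    by (intro compact_continuous_image K continuous_intros continuous_on_compose2[OF c\<phi>]) (use K in auto)
  have K'U: "K' \<subseteq> U \<times> UNIV" using K by (auto simp: K'_def)
  have inK': "(y, s) \<in> K'" if "(y, \<phi> y + s) \<in> K" for y s
    unfolding K'_def by (rule image_eqI[OF _ that]) simp
  \<comment> \<open>The derivative of \<open>g\<close> in the direction
    \<open>(v, \<phi>' v)\<close> tangent to the graph, in the sheared coordinates, where the region
    becomes \<open>s < 0\<close>.\<close>
  define H where "H z = (if fst z \<in> U then g' (fst z, \<phi> (fst z) + snd z) (v, \<phi>' (fst z) v) else 0)" for z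
  have H0: "H z = 0" if "z \<notin> K'" for z
    using that inK'[of "fst z" "snd z"] z by (auto simp: H_def)
  have cz: "continuous_on (U \<times> UNIV) (\<lambda>z. (fst z, \<phi> (fst z) + snd z))"
    by (intro continuous_intros continuous_on_compose2[OF c\<phi>]) auto
  have cgz: "continuous_on (U \<times> UNIV) (\<lambda>z. g' (fst z, \<phi> (fst z) + snd z) w)" for w
    by (rule continuous_on_compose2[OF cg' cz]) auto
  have split: "g' z (v, d) = g' z (v, 0) + d *\<^sub>R g' z (0, 1)" for z d
    using linear_add[OF lin[of z], of "(v, 0)" "(0, d)"] linear_scale[OF lin[of z], of d "(0, 1)"] by simp
  have "continuous_on (U \<times> UNIV) (\<lambda>z. g' (fst z, \<phi> (fst z) + snd z) (v, 0) +
      \<phi>' (fst z) v *\<^sub>R g' (fst z, \<phi> (fst z) + snd z) (0, 1))"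
    by (intro continuous_intros cgz continuous_on_compose2[OF c\<phi>']) auto
  then have "continuous_on (U \<times> UNIV) H"
    by (rule continuous_on_cong[THEN iffD1, rotated -1]) (auto simp: H_def split[symmetric])
  then have iH: "integrable lborel H"
    by (intro integrable_compact_support[OF _ cK' H0]) (rule continuous_on_subset[OF _ K'U])
  have iH2: "integrable lborel (\<lambda>z. indicator (UNIV \<times> {..<0}) z *\<^sub>R H z)"
    by (rule integrable_mult_indicator[OF _ iH]) (simp add: open_Times)
  have H_slice: "(LINT y|lborel. H (y, s)) = 0" for s
  proof -
    \<comment> \<open>The extension by 0 stays differentiable: \<open>F\<close> vanishes on the
      complement of the projection of \<open>K\<close>, an open set that together with
      \<open>U\<close> covers the space.\<close>
    define F where "F y = (if y \<in> U then g (y, \<phi> y + s) else 0)" for y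
    define F' where "F' y w = (if y \<in> U then g' (y, \<phi> y + s) (w, \<phi>' y w) else 0)" for y w
    have cfK: "compact (fst ` K)" by (intro compact_continuous_image K continuous_intros)
    have fKU: "fst ` K \<subseteq> U" using K by auto
    have F0: "F y = 0" if "y \<notin> fst ` K" for y
      using that K(3)[of "(y, \<phi> y + s)"] by (force simp: F_def)
    have F'0: "F' y w = 0" if "y \<notin> fst ` K" for y w
      using that z[of "(y, \<phi> y + s)"] by (force simp: F'_def)
    have "(F has_derivative F' y) (at y)" for y
    proof (cases "y \<in> U")
      case True
      have "((\<lambda>y. g (y, \<phi> y + s)) has_derivative (\<lambda>w. g' (y, \<phi> y + s) (w, \<phi>' y w))) (at y)"
        by (rule has_derivative_compose[of "\<lambda>y. (y, \<phi> y + s)", OF _ g])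
          (auto intro!: derivative_eq_intros \<phi> True)
      then have "(F has_derivative (\<lambda>w. g' (y, \<phi> y + s) (w, \<phi>' y w))) (at y)"
        by (rule has_derivative_transform_within_open[OF _ U True]) (simp add: F_def)
      then show ?thesis using True by (simp add: F'_def[abs_def])
    next
      case False
      have "((\<lambda>y. 0) has_derivative (\<lambda>w. 0)) (at y)" by simp
      then have "(F has_derivative (\<lambda>w. 0)) (at y)"
        by (rule has_derivative_transform_within_open[of _ _ _ _ "- fst ` K"])
          (use False fKU cfK F0 in \<open>auto simp: compact_imp_closed\<close>)
      then show ?thesis using False by (simp add: F'_def[abs_def])
    qed
    moreover have "continuous_on UNIV (\<lambda>y. F' y v)"
    proof -
      have eq: "F' y v = H (y, s)" for y by (simp add: F'_def H_def)
      have "continuous_on U (\<lambda>y. F' y v)" unfolding eq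
        by (rule continuous_on_compose2[OF \<open>continuous_on (U \<times> UNIV) H\<close>]) (auto intro!: continuous_intros)
      moreover have "continuous_on (- fst ` K) (\<lambda>y. F' y v)"
        by (rule continuous_on_cong[THEN iffD2, OF refl _ continuous_on_const[of _ 0]]) (simp add: F'0)
      ultimately have "continuous_on (U \<union> - fst ` K) (\<lambda>y. F' y v)"
        using U cfK by (intro continuous_on_open_Un) (auto simp: compact_imp_closed)
      moreover have "U \<union> - fst ` K = UNIV" using fKU by blast
      ultimately show ?thesis by simp
    qed
    ultimately have "(LINT y|lborel. F' y v) = 0"
      by (rule integral_derivative_compact_support[OF _ _ cfK F0])
    then show ?thesis unfolding F'_def H_def fst_conv snd_conv .
  qed
  have inner: "(LINT t|lborel. indicator ?S (y, t) *\<^sub>R g' (y, t) (v, c)) =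
      (LINT s|lborel. indicator (UNIV \<times> {..<0}) (y, s) *\<^sub>R H (y, s)) +
      indicator U y *\<^sub>R ((c - \<phi>' y v) *\<^sub>R g (y, \<phi> y))" for y
  proof (cases "y \<in> U")
    case False
    then show ?thesis by (simp add: H_def)
  next
    case True
    \<comment> \<open>With this \<open>M\<close> the height \<open>\<phi> y - M\<close> is at most
      \<open>a\<close>, where \<open>g\<close> and its derivative vanish; the half line
      \<open>s < 0\<close> can then be cut to the compact interval from \<open>-M\<close> to
      0.\<close>
    define M where "M = \<bar>\<phi> y - a\<bar>"
    define P where "P w s = g' (y, \<phi> y + s) w" for w s
    have cP: "continuous_on T (P w)" for T w unfolding P_def[abs_def]
      by (rule continuous_on_compose2[OF cg']) (auto intro!: continuous_intros)
    have P0: "P w s = 0" if "s \<le> a - \<phi> y" for w s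
      unfolding P_def by (rule z) (use K that in auto)
    have ae: "AE s in lborel. indicator {..<0} s *\<^sub>R P w s = indicator {-M..0} s *\<^sub>R P w s" for w
      using AE_lborel_singleton[of 0]
    proof eventually_elim
      case (elim s)
      then show ?case using P0[of s w] by (auto simp: indicator_def M_def)
    qed
    have i: "integrable lborel (\<lambda>s. indicator {-M..0} s *\<^sub>R P w s)" for w
      by (intro borel_integrable_compact cP) simp
    have m: "(\<lambda>s. indicator {..<0} s *\<^sub>R P w s) \<in> borel_measurable lborel" for w
      using borel_measurable_continuous_onI[OF cP[of UNIV w]] by measurable
    have i2: "integrable lborel (\<lambda>s. indicator {..<0} s *\<^sub>R P w s)" for w
      using integrable_cong_AE[OF m _ ae] i borel_measurable_integrable[OF i] by blast
    have "(LINT s|lborel. indicator {..<0} s *\<^sub>R P (0,1) s) = (LINT s|lborel. indicator {-M..0} s *\<^sub>R P (0,1) s)"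
      by (rule integral_cong_AE[OF m borel_measurable_integrable[OF i] ae])
    also have "\<dots> = g (y, \<phi> y + 0) - g (y, \<phi> y + (- M))"
    proof (rule integral_FTC_atLeastAtMost)
      fix s :: real
      have "((\<lambda>s. g (y, \<phi> y + s)) has_derivative (\<lambda>k. g' (y, \<phi> y + s) (0, k))) (at s)"
        by (rule has_derivative_compose[of "\<lambda>s. (y, \<phi> y + s)", OF _ g]) (auto intro!: derivative_eq_intros)
      moreover have "g' (y, \<phi> y + s) (0, k) = k *\<^sub>R P (0,1) s" for k
        using linear_scale[OF lin, of _ k "(0, 1)"] by (simp add: P_def)
      ultimately show "((\<lambda>s. g (y, \<phi> y + s)) has_vector_derivative P (0,1) s) (at s within {-M..0})"
        by (simp add: has_vector_derivative_def has_derivative_at_withinI)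
    qed (auto simp: M_def cP)
    also have "g (y, \<phi> y + (- M)) = 0" by (rule K(3)) (use K in \<open>auto simp: M_def\<close>)
    finally have ftc: "(LINT s|lborel. indicator {..<0} s *\<^sub>R P (0,1) s) = g (y, \<phi> y)" by simp
    \<comment> \<open>The decomposition
      \<open>(v, c) = (v, \<phi>' v) + (c - \<phi>' v) (0, 1)\<close> into a tangential and a
      vertical vector; the vertical part has just been integrated to the boundary value.\<close>
    have e1: "indicator ?S (y, \<phi> y + s) *\<^sub>R g' (y, \<phi> y + s) (v, c) =
      indicator {..<0} s *\<^sub>R P (v, \<phi>' y v) s + (c - \<phi>' y v) *\<^sub>R (indicator {..<0} s *\<^sub>R P (0,1) s)" for s
    proof -
      have "g' (y, \<phi> y + s) (v, c) = P (v, \<phi>' y v) s + (c - \<phi>' y v) *\<^sub>R P (0,1) s"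
        unfolding P_def by (subst (1 2) split) (simp add: algebra_simps)
      moreover have "indicator ?S (y, \<phi> y + s) *\<^sub>R g' (y, \<phi> y + s) (v, c) = indicator {..<0} s *\<^sub>R g' (y, \<phi> y + s) (v, c)"
        using True P0[of s "(v,c)"] by (cases "s \<le> a - \<phi> y") (auto simp: indicator_def P_def)
      ultimately show ?thesis by (simp only: scaleR_add_right scaleR_left_commute)
    qed
    have "(LINT t|lborel. indicator ?S (y, t) *\<^sub>R g' (y, t) (v, c)) =
      (LINT s|lborel. indicator ?S (y, \<phi> y + s) *\<^sub>R g' (y, \<phi> y + s) (v, c))"
      by (rule integral_shift_real)
    also have "\<dots> = (LINT s|lborel. indicator {..<0} s *\<^sub>R P (v, \<phi>' y v) s) +
        (c - \<phi>' y v) *\<^sub>R (LINT s|lborel. indicator {..<0} s *\<^sub>R P (0,1) s)"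
      unfolding e1 by (subst Bochner_Integration.integral_add) (simp_all only: i2 integrable_scaleR_right integral_scaleR_right)
    also have "(LINT s|lborel. indicator {..<0} s *\<^sub>R P (v, \<phi>' y v) s) =
      (LINT s|lborel. indicator (UNIV \<times> {..<0}) (y, s) *\<^sub>R H (y, s))"
      using True by (simp add: H_def P_def indicator_times)
    finally show ?thesis using True ftc by simp
  qed
  have iL: "integrable lborel (\<lambda>z. indicator ?S z *\<^sub>R g' z (v, c))"
    by (rule integrable_mult_indicator[OF _ integrable_compact_support[OF continuous_on_subset[OF cg'] K(1) z]])
      (use oS in auto)
  have iR: "integrable lborel (\<lambda>y. indicator U y *\<^sub>R ((c - \<phi>' y v) *\<^sub>R g (y, \<phi> y)))"
  proof (rule integrable_compact_support[where K = "fst ` K"])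
    show "continuous_on (fst ` K) (\<lambda>y. indicator U y *\<^sub>R ((c - \<phi>' y v) *\<^sub>R g (y, \<phi> y)))"
    proof (rule continuous_on_cong[THEN iffD2, OF refl])
      show "continuous_on (fst ` K) (\<lambda>y. (c - \<phi>' y v) *\<^sub>R g (y, \<phi> y))"
        by (intro continuous_intros continuous_on_compose2[OF contg[of UNIV]]
            continuous_on_subset[OF c\<phi>] continuous_on_subset[OF c\<phi>']) (use K in auto)
    qed (use K in auto)
    show "compact (fst ` K)" by (intro compact_continuous_image K continuous_intros)
    show "indicator U y *\<^sub>R ((c - \<phi>' y v) *\<^sub>R g (y, \<phi> y)) = 0" if "y \<notin> fst ` K" for y
      using that K(3)[of "(y, \<phi> y)"] by force
  qed
  have "(LINT z|lborel. indicator ?S z *\<^sub>R g' z (v, c)) =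
     (LINT y|lborel. (LINT s|lborel. indicator (UNIV \<times> {..<0}) (y, s) *\<^sub>R H (y, s)) +
      indicator U y *\<^sub>R ((c - \<phi>' y v) *\<^sub>R g (y, \<phi> y)))"
    unfolding integral_fst_lborel(1)[OF iL] inner ..
  also have "\<dots> = (LINT y|lborel. LINT s|lborel. indicator (UNIV \<times> {..<0}) (y, s) *\<^sub>R H (y, s)) +
      (LINT y|lborel. indicator U y *\<^sub>R ((c - \<phi>' y v) *\<^sub>R g (y, \<phi> y)))"
    by (rule Bochner_Integration.integral_add[OF integral_fst_lborel(3)[OF iH2] iR])
  \<comment> \<open>The order is exchanged because the tangential part integrates to 0 over
    \<open>y\<close> at fixed \<open>s\<close>, not over \<open>s\<close> at fixed
    \<open>y\<close>.\<close>
  also have "(LINT y|lborel. LINT s|lborel. indicator (UNIV \<times> {..<0}) (y, s) *\<^sub>R H (y, s)) =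
    (LINT s|lborel. LINT y|lborel. indicator (UNIV \<times> {..<0}) (y, s) *\<^sub>R H (y, s))"
    using integral_fst_lborel(1,2)[OF iH2] by simp
  also have "\<dots> = 0" by (simp add: indicator_times H_slice)
  finally show ?thesis by simp
qed

section \<open>Boundary charts\<close>

definition lin_part :: "('a::real_vector \<Rightarrow> 'b::real_vector) \<Rightarrow> 'a \<Rightarrow> 'b" where
  "lin_part A w = A w - A 0"

text \<open>The unnormalised upward normal of the graph. Its length is \<open>graph_density\<close>,
  so that the vector surface element is \<open>graph_normal\<close> times \<open>dy\<close>.\<close>

definition graph_normal :: "((real^2) \<times> real \<Rightarrow> real^3) \<Rightarrow> (real^2 \<Rightarrow> real) \<Rightarrow> real^2 \<Rightarrow> real^3" where
  "graph_normal A \<phi> y = lin_part A (- grad \<phi> y, 1)"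

text \<open>The derivative is carried as an explicit function, which keeps products and compositions
  computable. Continuity is asked for in every fixed direction, the form in which the integrals use
  it.\<close>

definition C1_deriv :: "('a::real_normed_vector \<Rightarrow> 'b::real_normed_vector) \<Rightarrow> ('a \<Rightarrow> 'a \<Rightarrow> 'b) \<Rightarrow> bool" where
  "C1_deriv f f' \<longleftrightarrow> (\<forall>x. (f has_derivative f' x) (at x)) \<and> (\<forall>v. continuous_on UNIV (\<lambda>x. f' x v))"

lemma C1_derivD:
  assumes "C1_deriv f f'"
  shows "(f has_derivative f' x) (at x)" "continuous_on S (\<lambda>x. f' x v)" "continuous_on S f" "linear (f' x)"
proof -
  show "(f has_derivative f' x) (at x)" using assms by (simp add: C1_deriv_def)
  then show "linear (f' x)" by (rule has_derivative_linear)
  show "continuous_on S (\<lambda>x. f' x v)" using assms by (auto simp: C1_deriv_def intro: continuous_on_subset)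
  show "continuous_on S f" using assms unfolding C1_deriv_def
    by (meson continuous_at_imp_continuous_on has_derivative_continuous)
qed

section \<open>Gradients and directional derivatives\<close>

lemma frechet_derivative_grad:
  fixes f :: "real^'n \<Rightarrow> 'b::real_normed_vector"
  assumes "f differentiable (at x)"
  shows "frechet_derivative f (at x) v = (\<Sum>j\<in>UNIV. v $ j *\<^sub>R grad f x $ j)"
proof -
  have l: "linear (frechet_derivative f (at x))" using assms by (rule linear_frechet_derivative)
  have "v = (\<Sum>j\<in>UNIV. v $ j *\<^sub>R axis j 1)"
    by (simp add: vec_eq_iff axis_def if_distrib cong: if_cong)
  then have "frechet_derivative f (at x) v = frechet_derivative f (at x) (\<Sum>j\<in>UNIV. v $ j *\<^sub>R axis j 1)" by simp
  also have "\<dots> = (\<Sum>j\<in>UNIV. v $ j *\<^sub>R grad f x $ j)"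
    by (simp add: linear_sum[OF l] linear_scale[OF l] grad_def)
  finally show ?thesis .
qed

lemma frechet_derivative_grad_real:
  fixes f :: "real^'n \<Rightarrow> real"
  assumes "f differentiable (at x)"
  shows "frechet_derivative f (at x) v = grad f x \<bullet> v"
  unfolding frechet_derivative_grad[OF assms] by (simp add: inner_vec_def mult.commute)

text \<open>\<open>Ck_on\<close> speaks only of basis directions; linearity of the derivative
  extends continuity to an arbitrary direction \<open>v\<close>.\<close>

lemma Ck_on_continuous_partial:
  fixes f :: "'a::euclidean_space \<Rightarrow> 'b::real_normed_vector"
  assumes "Ck_on (Suc n) f S" "open S"
  shows "x \<in> S \<Longrightarrow> (f has_derivative frechet_derivative f (at x)) (at x)"
    and "continuous_on S (\<lambda>x. frechet_derivative f (at x) v)"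
proof -
  have d: "f differentiable (at x)" if "x \<in> S" for x
    using assms that by (auto simp: differentiable_on_eq_differentiable_at)
  show "x \<in> S \<Longrightarrow> (f has_derivative frechet_derivative f (at x)) (at x)"
    using d frechet_derivative_works by blast
  have c: "continuous_on S (\<lambda>x. frechet_derivative f (at x) b)" if "b \<in> Basis" for b
    using assms(1) that by (cases n) (auto intro: differentiable_imp_continuous_on)
  have e: "frechet_derivative f (at x) v = (\<Sum>b\<in>Basis. (v \<bullet> b) *\<^sub>R frechet_derivative f (at x) b)" if "x \<in> S" for x
  proof -
    have l: "linear (frechet_derivative f (at x))" using d[OF that] by (rule linear_frechet_derivative)
    show ?thesis
      by (subst euclidean_representation[of v, symmetric]) (simp only: linear_sum[OF l] linear_scale[OF l])
  qed
  show "continuous_on S (\<lambda>x. frechet_derivative f (at x) v)"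
    by (rule continuous_on_cong[THEN iffD2, OF refl e]) (auto intro!: continuous_intros c)
qed

lemma C1_deriv_Ck_on:
  fixes f :: "'a::euclidean_space \<Rightarrow> 'b::real_normed_vector"
  assumes "Ck_on (Suc n) f UNIV"
  shows "C1_deriv f (\<lambda>x. frechet_derivative f (at x))"
  using Ck_on_continuous_partial[OF assms] by (auto simp: C1_deriv_def)

section \<open>Geometry of a single chart\<close>

locale graph_chart =
  fixes \<Omega> :: "(real^3) set" and A U a b \<phi>
  assumes lg: "local_graph \<Omega> A U a b \<phi>"
begin

definition cyl :: "(real^3) set" where "cyl = A ` (U \<times> {a<..<b})"

lemma iso: "dist (A z) (A w) = dist z w" using lg unfolding local_graph_def by blast
lemma open_U: "open U" using lg by (auto simp: local_graph_def)
lemma bounds: "y \<in> U \<Longrightarrow> a < \<phi> y" "y \<in> U \<Longrightarrow> \<phi> y < b" using lg by (auto simp: local_graph_def)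

lemma inj_A: "A z = A w \<longleftrightarrow> z = w"
  using iso[of z w] by auto

lemma surj_A: "surj A"
  using lborel_distr_isometry(2)[of A, OF iso] by simp

lemma distr_A: "distr lborel borel A = lborel"
  using lborel_distr_isometry(1)[of A, OF iso] by simp

lemma cont_A: "continuous_on S A"
  by (rule isometry_continuous[OF iso])

lemma inv_A [simp]: "inv A (A z) = z" "A (inv A x) = x"
  using surj_A inj_A by (auto simp: inj_def surj_f_inv_f intro!: inv_f_f)

lemma cont_inv_A: "continuous_on S (inv A)"
  by (rule isometry_continuous) (metis iso inv_A(2))

lemma lin_part_A: "linear (lin_part A)" "lin_part A z \<bullet> lin_part A w = z \<bullet> w"
  using isometry_imp_linear[of A, OF iso] by (auto simp: lin_part_def[abs_def])

lemma A_add: "A (z + w) = A z + lin_part A w"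
  using linear_add[OF lin_part_A(1), of z w] by (simp add: lin_part_def algebra_simps)

lemma lin_part_ex: obtains w where "e = lin_part A w"
proof
  show "e = lin_part A (inv A (A 0 + e))" by (simp add: lin_part_def)
qed

lemma A_deriv: "(A has_derivative lin_part A) (at z)"
proof -
  have "bounded_linear (lin_part A)" using lin_part_A(1) by (simp add: linear_conv_bounded_linear)
  then have "((\<lambda>z. A 0 + lin_part A z) has_derivative lin_part A) (at z)"
    by (auto intro!: derivative_eq_intros bounded_linear_imp_has_derivative)
  moreover have "(\<lambda>z. A 0 + lin_part A z) = A" by (simp add: lin_part_def)
  ultimately show ?thesis by simp
qed

lemma mem_cyl: "A z \<in> cyl \<longleftrightarrow> fst z \<in> U \<and> a < snd z \<and> snd z < b"
  using inj_A by (cases z) (force simp: cyl_def)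

lemma open_cyl: "open cyl"
proof -
  have "cyl = inv A -` (U \<times> {a<..<b})"
  proof (intro set_eqI)
    fix x
    show "x \<in> cyl \<longleftrightarrow> x \<in> inv A -` (U \<times> {a<..<b})"
      using mem_cyl[of "inv A x"] by (simp add: mem_Times_iff)
  qed
  moreover have "open (inv A -` (U \<times> {a<..<b}))"
    using cont_inv_A[of UNIV] by (intro open_vimage open_Times open_U) auto
  ultimately show ?thesis by simp
qed

lemma Omega_cyl: "y \<in> U \<Longrightarrow> a < t \<Longrightarrow> t < b \<Longrightarrow> A (y, t) \<in> \<Omega> \<longleftrightarrow> t < \<phi> y"
proof -
  assume y: "y \<in> U" "a < t" "t < b"
  have eq: "\<Omega> \<inter> A ` (U \<times> {a<..<b}) = A ` {(y, t). y \<in> U \<and> a < t \<and> t < \<phi> y}"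
    using lg by (auto simp: local_graph_def)
  have "A (y, t) \<in> \<Omega> \<longleftrightarrow> A (y, t) \<in> A ` {(y, t). y \<in> U \<and> a < t \<and> t < \<phi> y}"
    unfolding eq[symmetric] using y by auto
  also have "\<dots> \<longleftrightarrow> t < \<phi> y" using y inj_A by auto
  finally show ?thesis .
qed

lemma phi_deriv: "y \<in> U \<Longrightarrow> (\<phi> has_derivative (\<lambda>v. grad \<phi> y \<bullet> v)) (at y)"
proof -
  assume y: "y \<in> U"
  have ck: "Ck_on (Suc 1) \<phi> U" using lg by (simp add: local_graph_def numeral_2_eq_2)
  have d: "(\<phi> has_derivative frechet_derivative \<phi> (at y)) (at y)"
    using Ck_on_continuous_partial(1)[OF ck open_U y] .
  then have "\<phi> differentiable (at y)" by (auto simp: differentiable_def)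
  from frechet_derivative_grad_real[OF this]
  have "frechet_derivative \<phi> (at y) = (\<lambda>v. grad \<phi> y \<bullet> v)" by (simp add: fun_eq_iff)
  with d show ?thesis by simp
qed

lemma cont_phi: "continuous_on U \<phi>"
  using phi_deriv by (meson continuous_at_imp_continuous_on has_derivative_continuous)

lemma cont_grad: "continuous_on U (grad \<phi>)"
proof -
  have ck: "Ck_on (Suc 1) \<phi> U" using lg by (simp add: local_graph_def numeral_2_eq_2)
  show ?thesis unfolding grad_def
    by (intro continuous_on_vec_lambda Ck_on_continuous_partial(2)[OF ck open_U])
qed

lemma graph_density_pos: "graph_density \<phi> y > 0" "graph_density \<phi> y \<ge> 1"
proof -
  show "graph_density \<phi> y \<ge> 1" by (simp add: graph_density_def)
  then show "graph_density \<phi> y > 0" by simp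
qed

lemma cont_density: "continuous_on U (graph_density \<phi>)"
  unfolding graph_density_def[abs_def] by (intro continuous_intros cont_grad)

lemma cont_graph_normal: "continuous_on U (graph_normal A \<phi>)"
  unfolding graph_normal_def[abs_def] lin_part_def
  by (intro continuous_intros continuous_on_compose2[OF cont_A[of UNIV]] cont_grad) auto

lemma norm_graph_normal: "norm (graph_normal A \<phi> y) = graph_density \<phi> y"
  by (simp add: norm_eq_sqrt_inner graph_normal_def lin_part_A graph_density_def power2_norm_eq_inner add.commute)

lemma inner_graph_normal: "lin_part A (v, c) \<bullet> graph_normal A \<phi> y = c - grad \<phi> y \<bullet> v"
  by (simp add: graph_normal_def lin_part_A inner_commute)

lemma frontier_graph:
  assumes "open \<Omega>" "y \<in> U"
  shows "A (y, \<phi> y) \<in> frontier \<Omega>" "A (y, \<phi> y) \<in> cyl"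
proof -
  show c: "A (y, \<phi> y) \<in> cyl" using assms bounds by (simp add: mem_cyl)
  have n: "A (y, \<phi> y) \<notin> \<Omega>" using assms bounds Omega_cyl[of y "\<phi> y"] by auto
  have "A (y, \<phi> y) \<in> closure \<Omega>"
    unfolding closure_approachable
  proof (intro allI impI)
    fix e :: real assume "e > 0"
    \<comment> \<open>The first entry keeps \<open>t\<close> within \<open>e / 2\<close> of the
      graph, the second one keeps it above the floor \<open>a\<close> of the cylinder.\<close>
    define t where "t = max (\<phi> y - e / 2) ((a + \<phi> y) / 2)"
    have t: "a < t" "t < \<phi> y" "\<phi> y - e / 2 \<le> t"
      using \<open>e > 0\<close> bounds(1)[OF assms(2)] by (auto simp: t_def max_def field_simps)
    have "A (y, t) \<in> \<Omega>" using t bounds(2)[OF assms(2)] Omega_cyl[OF assms(2)] by auto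
    moreover have "dist (A (y, t)) (A (y, \<phi> y)) < e"
      using t \<open>e > 0\<close> by (simp add: iso dist_Pair_Pair dist_real_def)
    ultimately show "\<exists>x\<in>\<Omega>. dist x (A (y, \<phi> y)) < e" by blast
  qed
  then show "A (y, \<phi> y) \<in> frontier \<Omega>" using n assms(1) by (simp add: frontier_def interior_open)
qed

text \<open>Inside the cylinder a point below the graph lies in the open set \<Omega>, and a point
  above it has a neighbourhood that misses \<Omega>; neither can be a frontier point.\<close>

lemma frontier_cyl:
  assumes "open \<Omega>" "x \<in> frontier \<Omega>" "x \<in> cyl"
  obtains y where "y \<in> U" "x = A (y, \<phi> y)"
proof -
  obtain y t where x: "x = A (y, t)" and y: "y \<in> U" "a < t" "t < b" using assms(3) by (auto simp: cyl_def)
  have "x \<notin> \<Omega>" "x \<in> closure \<Omega>" using assms by (auto simp: frontier_def interior_open)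
  have "\<not> t < \<phi> y" using Omega_cyl[OF y] \<open>x \<notin> \<Omega>\<close> x by auto
  moreover have "\<not> \<phi> y < t"
  proof
    assume lt: "\<phi> y < t"
    let ?W = "inv A -` ((U \<times> {a<..<b}) \<inter> {z \<in> U \<times> UNIV. \<phi> (fst z) - snd z < 0})"
    have "open ((U \<times> UNIV) \<inter> (\<lambda>z. \<phi> (fst z) - snd z) -` {..<0})"
      by (intro continuous_open_preimage open_Times open_U continuous_intros continuous_on_compose2[OF cont_phi]) auto
    moreover have "{z \<in> U \<times> UNIV. \<phi> (fst z) - snd z < 0} = (U \<times> UNIV) \<inter> (\<lambda>z. \<phi> (fst z) - snd z) -` {..<0}" by auto
    ultimately have "open ?W"
      using cont_inv_A[of UNIV] by (intro open_vimage open_Int open_Times open_U) auto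
    moreover have "x \<in> ?W" using x y lt by simp
    moreover have "?W \<inter> \<Omega> = {}"
    proof (intro equals0I)
      fix w assume w: "w \<in> ?W \<inter> \<Omega>"
      obtain y' t' where i: "inv A w = (y', t')" by fastforce
      then have "w = A (y', t')" by (metis inv_A(2))
      then show False using w i Omega_cyl[of y' t'] by auto
    qed
    ultimately have "x \<in> ?W" "?W \<inter> closure \<Omega> = {}" by (simp_all add: open_Int_closure_eq_empty)
    then show False using \<open>x \<in> closure \<Omega>\<close> by (simp only: disjoint_iff)
  qed
  ultimately have "t = \<phi> y" by simp
  then show ?thesis using that x y by blast
qed

text \<open>In the coordinates of \<open>A\<close> this is \<open>graph_divergence\<close> for
  \<open>e = lin_part A (v, c)\<close>; the weight \<open>c - grad \<phi> y \<bullet> v\<close>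
  found there is the inner product of \<open>e\<close> with \<open>graph_normal\<close>.\<close>

lemma chart_divergence:
  fixes f :: "real^3 \<Rightarrow> 'b::euclidean_space"
  assumes \<Omega>: "open \<Omega>" and f: "C1_deriv f f'" and K: "compact K" "K \<subseteq> cyl" "\<And>x. x \<notin> K \<Longrightarrow> f x = 0"
  shows "(LINT x|lborel. indicator \<Omega> x *\<^sub>R f' x e) =
    (LINT y|lborel. indicator U y *\<^sub>R ((e \<bullet> graph_normal A \<phi> y) *\<^sub>R f (A (y, \<phi> y))))"
proof -
  obtain v c where e: "e = lin_part A (v, c)" using lin_part_ex by (metis surj_pair)
  have z: "f' x w = 0" if "x \<notin> K" for x w
    using derivative_zero_outside[OF C1_derivD(1)[OF f] compact_imp_closed[OF K(1)] K(3) that] .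
  define K' where "K' = inv A ` K"
  have K': "compact K'" "K' \<subseteq> U \<times> {a<..}" "\<And>z. z \<notin> K' \<Longrightarrow> A z \<notin> K"
  proof -
    show "compact K'" unfolding K'_def by (intro compact_continuous_image cont_inv_A K)
    show "K' \<subseteq> U \<times> {a<..}"
    proof
      fix z assume "z \<in> K'"
      then have "A z \<in> cyl" using K(2) by (auto simp: K'_def)
      then show "z \<in> U \<times> {a<..}" by (cases z) (simp add: mem_cyl)
    qed
    show "A z \<notin> K" if "z \<notin> K'" for z using that unfolding K'_def by (metis image_eqI inv_A(1))
  qed
  have cA: "A \<in> borel_measurable borel" by (rule borel_measurable_continuous_onI[OF cont_A])
  have "(LINT x|lborel. indicator \<Omega> x *\<^sub>R f' x e) = (LINT x|distr lborel borel A. indicator \<Omega> x *\<^sub>R f' x e)"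
    by (simp add: distr_A)
  also have "\<dots> = (LINT z|lborel. indicator \<Omega> (A z) *\<^sub>R f' (A z) e)"
    using cA \<Omega> borel_measurable_continuous_onI[OF C1_derivD(2)[OF f]]
    by (subst integral_distr) (auto intro!: borel_measurable_scaleR)
  \<comment> \<open>\<Omega> is a region under a graph only within the cylinder; this suffices, as
    \<open>f'\<close> vanishes off \<open>K\<close>.\<close>
  also have "\<dots> = (LINT z|lborel. indicator {(y, t). y \<in> U \<and> a < t \<and> t < \<phi> y} z *\<^sub>R f' (A z) (lin_part A (v, c)))"
  proof (intro Bochner_Integration.integral_cong refl)
    fix z
    show "indicator \<Omega> (A z) *\<^sub>R f' (A z) e =
      indicator {(y, t). y \<in> U \<and> a < t \<and> t < \<phi> y} z *\<^sub>R f' (A z) (lin_part A (v, c))"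
    proof (cases "A z \<in> K")
      case True
      then have "A z \<in> cyl" using K by auto
      then show ?thesis using Omega_cyl[of "fst z" "snd z"] e by (cases z) (auto simp: mem_cyl indicator_def)
    qed (simp add: z)
  qed
  also have "\<dots> = (LINT y|lborel. indicator U y *\<^sub>R ((c - grad \<phi> y \<bullet> v) *\<^sub>R f (A (y, \<phi> y))))"
  proof (rule graph_divergence[where g = "\<lambda>z. f (A z)" and g' = "\<lambda>z w. f' (A z) (lin_part A w)"
        and \<phi>' = "\<lambda>y v. grad \<phi> y \<bullet> v" and K = K'])
    show "open U" by (rule open_U)
    show "(\<phi> has_derivative (\<bullet>) (grad \<phi> y)) (at y)" if "y \<in> U" for y using phi_deriv[OF that] .
    show "continuous_on U (\<lambda>y. grad \<phi> y \<bullet> v)" by (intro continuous_intros cont_grad)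
    show "((\<lambda>z. f (A z)) has_derivative (\<lambda>w. f' (A z) (lin_part A w))) (at z)" for z
      by (rule has_derivative_compose[OF A_deriv C1_derivD(1)[OF f]])
    show "continuous_on UNIV (\<lambda>z. f' (A z) (lin_part A w))" for w
      by (rule continuous_on_compose2[OF C1_derivD(2)[OF f, of UNIV] cont_A]) auto
    show "f (A z) = 0" if "z \<notin> K'" for z using K'(3)[OF that] K(3) by blast
  qed (use K' in auto)
  finally show ?thesis by (simp add: e inner_graph_normal)
qed

text \<open>The height \<open>\<psi> t\<close> of the graph above the moving point has at 0 the
  value 0 and the derivative \<open>-(v \<bullet> graph_normal A \<phi> y)\<close>, whose sign
  decides on which side of the graph the ray starts.\<close>

lemma inside_outside:
  assumes "y \<in> U"
  shows "v \<bullet> graph_normal A \<phi> y < 0 \<Longrightarrow> \<forall>\<^sub>F t in at_right 0. A (y, \<phi> y) + t *\<^sub>R v \<in> \<Omega>"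
    and "v \<bullet> graph_normal A \<phi> y > 0 \<Longrightarrow> \<forall>\<^sub>F t in at_right 0. A (y, \<phi> y) + t *\<^sub>R v \<notin> \<Omega>"
proof -
  obtain w c where v: "v = lin_part A (w, c)" using lin_part_ex by (metis surj_pair)
  have eq: "A (y, \<phi> y) + t *\<^sub>R v = A (y + t *\<^sub>R w, \<phi> y + t * c)" for t
    using A_add[of "(y, \<phi> y)" "t *\<^sub>R (w, c)"] linear_scale[OF lin_part_A(1), of t "(w, c)"] by (simp add: v)
  have cyl: "\<forall>\<^sub>F t in at_right 0. A (y + t *\<^sub>R w, \<phi> y + t * c) \<in> cyl"
  proof -
    have "((\<lambda>t. A (y + t *\<^sub>R w, \<phi> y + t * c)) \<longlongrightarrow> A (y + 0 *\<^sub>R w, \<phi> y + 0 * c)) (at_right 0)"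
      by (rule continuous_on_tendsto_compose[OF cont_A[of UNIV]]) (auto intro!: tendsto_eq_intros)
    then show ?thesis
      by (rule topological_tendstoD[OF _ open_cyl]) (use assms bounds in \<open>simp add: mem_cyl\<close>)
  qed
  define \<psi> where "\<psi> t = \<phi> (y + t *\<^sub>R w) - (\<phi> y + t * c)" for t
  have "((\<lambda>t. \<phi> (y + t *\<^sub>R w)) has_derivative (\<lambda>h. grad \<phi> y \<bullet> (h *\<^sub>R w))) (at 0)"
    by (rule has_derivative_compose[of "\<lambda>t. y + t *\<^sub>R w"])
      (use phi_deriv[OF assms] in \<open>auto intro!: derivative_eq_intros\<close>)
  then have "((\<lambda>t. \<phi> (y + t *\<^sub>R w)) has_real_derivative grad \<phi> y \<bullet> w) (at 0)"
    by (simp add: has_field_derivative_def mult.commute[of _ "grad \<phi> y \<bullet> w"] mult_commute_abs)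
  then have d: "(\<psi> has_real_derivative grad \<phi> y \<bullet> w - c) (at 0)"
    unfolding \<psi>_def by (auto intro!: derivative_eq_intros)
  have vN: "v \<bullet> graph_normal A \<phi> y = c - grad \<phi> y \<bullet> w" by (simp add: v inner_graph_normal)
  have \<psi>0: "\<psi> 0 = 0" by (simp add: \<psi>_def)
  { assume "v \<bullet> graph_normal A \<phi> y < 0"
    then obtain d where "d > 0" "\<And>h. h > 0 \<Longrightarrow> h < d \<Longrightarrow> \<psi> 0 < \<psi> (0 + h)"
      using DERIV_pos_inc_right[OF d] vN by auto
    then have "\<forall>\<^sub>F t in at_right 0. \<psi> t > 0"
      unfolding eventually_at_right_field using \<psi>0 by auto
    then show "\<forall>\<^sub>F t in at_right 0. A (y, \<phi> y) + t *\<^sub>R v \<in> \<Omega>"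
      using cyl by eventually_elim (use Omega_cyl in \<open>auto simp: eq mem_cyl \<psi>_def\<close>) }
  { assume "v \<bullet> graph_normal A \<phi> y > 0"
    then obtain d where "d > 0" "\<And>h. h > 0 \<Longrightarrow> h < d \<Longrightarrow> \<psi> (0 + h) < \<psi> 0"
      using DERIV_neg_dec_right[OF d] vN by auto
    then have "\<forall>\<^sub>F t in at_right 0. \<psi> t < 0"
      unfolding eventually_at_right_field using \<psi>0 by auto
    then show "\<forall>\<^sub>F t in at_right 0. A (y, \<phi> y) + t *\<^sub>R v \<notin> \<Omega>"
      using cyl by eventually_elim (use Omega_cyl in \<open>auto simp: eq mem_cyl \<psi>_def\<close>) }
qed

end

section \<open>Independence of the unit normal from the chart\<close>

lemma inner_less_one:
  fixes x y :: "'a::real_inner"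
  assumes "norm x = 1" "norm y = 1" "x \<noteq> y"
  shows "x \<bullet> y < 1"
proof -
  have "0 < (norm (x - y))\<^sup>2" using assms(3) by simp
  also have "\<dots> = 2 - 2 * (x \<bullet> y)"
    using assms(1,2) by (simp add: power2_norm_eq_inner inner_diff_left inner_diff_right inner_commute norm_eq_1)
  finally show ?thesis by simp
qed

text \<open>If the unit normals \<open>n\<close> and \<open>n'\<close> differed, the direction \<open>n' - n\<close> would point into \<open>\<Omega>\<close> according to the
  first chart and out of it according to the second.\<close>

lemma normal_unique:
  assumes "graph_chart \<Omega> A U a b \<phi>" "graph_chart \<Omega> A' U' a' b' \<phi>'"
    and y: "y \<in> U" "y' \<in> U'" and eq: "A (y, \<phi> y) = A' (y', \<phi>' y')"
  shows "(1 / graph_density \<phi> y) *\<^sub>R graph_normal A \<phi> y = (1 / graph_density \<phi>' y') *\<^sub>R graph_normal A' \<phi>' y'"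
    (is "?n = ?n'")
proof (rule ccontr)
  interpret g1: graph_chart \<Omega> A U a b \<phi> by fact
  interpret g2: graph_chart \<Omega> A' U' a' b' \<phi>' by fact
  have n: "norm ?n = 1" "norm ?n' = 1"
    using g1.graph_density_pos(1)[of y] g2.graph_density_pos(1)[of y']
    by (simp_all add: g1.norm_graph_normal g2.norm_graph_normal)
  assume "?n \<noteq> ?n'"
  then have lt: "?n \<bullet> ?n' < 1"
    by (rule inner_less_one[OF n])
  define v where "v = ?n' - ?n"
  have "v \<bullet> ?n < 0" "v \<bullet> ?n' > 0"
    using lt n unfolding v_def inner_diff_left by (simp_all only: inner_commute[of ?n' ?n] dot_square_norm) simp_all
  then have "v \<bullet> graph_normal A \<phi> y < 0" "v \<bullet> graph_normal A' \<phi>' y' > 0"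
    using g1.graph_density_pos(1)[of y] g2.graph_density_pos(1)[of y']
    by (auto simp: zero_less_divide_iff divide_less_0_iff)
  then have "\<forall>\<^sub>F t in at_right (0::real). False"
    using g1.inside_outside(1)[OF y(1), of v] g2.inside_outside(2)[OF y(2), of v] eq
      eventually_conj[of "\<lambda>t. A (y, \<phi> y) + t *\<^sub>R v \<in> \<Omega>"] by fastforce
  then show False by simp
qed

text \<open>By \<open>normal_unique\<close> all candidates in the description of
  \<open>outward_normal\<close> coincide, so every chart computes it.\<close>

lemma (in graph_chart) outward_normal_eq:
  assumes "y \<in> U"
  shows "outward_normal \<Omega> (A (y, \<phi> y)) = (1 / graph_density \<phi> y) *\<^sub>R graph_normal A \<phi> y"
  unfolding outward_normal_def
proof (rule the_equality)
  show "\<exists>A' U' a' b' \<phi>' y'. local_graph \<Omega> A' U' a' b' \<phi>' \<and> y' \<in> U' \<and> A (y, \<phi> y) = A' (y', \<phi>' y') \<and>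
    (1 / graph_density \<phi> y) *\<^sub>R graph_normal A \<phi> y = (1 / graph_density \<phi>' y') *\<^sub>R (A' (- grad \<phi>' y', 1) - A' 0)"
    by (rule exI[of _ A], rule exI[of _ U], rule exI[of _ a], rule exI[of _ b], rule exI[of _ \<phi>], rule exI[of _ y])
      (use lg assms in \<open>simp add: graph_normal_def lin_part_def\<close>)
next
  fix n
  assume "\<exists>A' U' a' b' \<phi>' y'. local_graph \<Omega> A' U' a' b' \<phi>' \<and> y' \<in> U' \<and> A (y, \<phi> y) = A' (y', \<phi>' y') \<and>
    n = (1 / graph_density \<phi>' y') *\<^sub>R (A' (- grad \<phi>' y', 1) - A' 0)"
  then obtain A' U' a' b' \<phi>' y' where *: "local_graph \<Omega> A' U' a' b' \<phi>'" "y' \<in> U'" "A (y, \<phi> y) = A' (y', \<phi>' y')"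
    "n = (1 / graph_density \<phi>' y') *\<^sub>R graph_normal A' \<phi>' y'"
    by (auto simp: graph_normal_def lin_part_def)
  then show "n = (1 / graph_density \<phi> y) *\<^sub>R graph_normal A \<phi> y"
    using normal_unique[of \<Omega> A U a b \<phi> A' U' a' b' \<phi>' y y'] assms lg by (auto simp: graph_chart_def)
qed

section \<open>Comparison of the chart measures\<close>

text \<open>Squaring removes the corner of the positive part: the difference quotient at 0 is
  \<open>max 0 h\<close>. All cut-off functions below are made from this C^1 function.\<close>

lemma DERIV_max_sq: "((\<lambda>t::real. (max 0 t)\<^sup>2) has_real_derivative 2 * max 0 t) (at t)"
proof -
  consider "t > 0" | "t < 0" | "t = 0" by linarith
  then show ?thesis
  proof cases
    case 1
    have "((\<lambda>t::real. t\<^sup>2) has_real_derivative 2 * max 0 t) (at t)"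
      using 1 by (auto intro!: derivative_eq_intros)
    then show ?thesis
      by (rule has_field_derivative_transform_within[where d = t]) (use 1 in \<open>auto simp: dist_real_def\<close>)
  next
    case 2
    have "((\<lambda>t::real. 0) has_real_derivative 2 * max 0 t) (at t)" using 2 by simp
    then show ?thesis
      by (rule has_field_derivative_transform_within[where d = "- t"]) (use 2 in \<open>auto simp: dist_real_def\<close>)
  next
    case 3
    have "(\<lambda>h::real. ((max 0 (0 + h))\<^sup>2 - (max 0 0)\<^sup>2) / h) = (\<lambda>h. max 0 h)"
      by (auto simp: fun_eq_iff max_def power2_eq_square)
    moreover have "((\<lambda>h::real. max 0 h) \<longlongrightarrow> max 0 0) (at 0)" by (intro tendsto_intros)
    ultimately show ?thesis unfolding 3 DERIV_def by simp
  qed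
qed

text \<open>Positive exactly on the open ball when \<open>r > 0\<close>. The squared distance is
  used because, unlike the norm, it is differentiable at the centre.\<close>

definition bump :: "'a::real_inner \<Rightarrow> real \<Rightarrow> 'a \<Rightarrow> real" where
  "bump c r x = (max 0 (r\<^sup>2 - (x - c) \<bullet> (x - c)))\<^sup>2"

definition bump_deriv :: "'a::real_inner \<Rightarrow> real \<Rightarrow> 'a \<Rightarrow> 'a \<Rightarrow> real" where
  "bump_deriv c r x h = 2 * max 0 (r\<^sup>2 - (x - c) \<bullet> (x - c)) * (- 2 * ((x - c) \<bullet> h))"

lemma bump_C1: "C1_deriv (bump c r) (bump_deriv c r)"
  unfolding C1_deriv_def
proof (intro conjI allI)
  fix x
  let ?q = "\<lambda>x. r\<^sup>2 - (x - c) \<bullet> (x - c)"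
  have "(?q has_derivative (\<lambda>h. - 2 * ((x - c) \<bullet> h))) (at x)"
    by (auto intro!: derivative_eq_intros simp: inner_commute fun_eq_iff)
  moreover have "((\<lambda>t. (max 0 t)\<^sup>2) has_derivative (\<lambda>k. k * (2 * max 0 (?q x)))) (at (?q x))"
    using DERIV_max_sq[of "?q x"] by (simp add: has_field_derivative_def mult_commute_abs)
  ultimately have "((\<lambda>x. (max 0 (?q x))\<^sup>2) has_derivative (\<lambda>h. (- 2 * ((x - c) \<bullet> h)) * (2 * max 0 (?q x)))) (at x)"
    by (rule has_derivative_compose)
  then show "(bump c r has_derivative bump_deriv c r x) (at x)"
    by (simp add: bump_def[abs_def] bump_deriv_def[abs_def] mult_ac)
next
  fix v show "continuous_on UNIV (\<lambda>x. bump_deriv c r x v)"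
    unfolding bump_deriv_def by (intro continuous_intros)
qed

lemma bump_pos: "0 \<le> bump c r x" "r > 0 \<Longrightarrow> bump c r x > 0 \<longleftrightarrow> x \<in> ball c r" "r > 0 \<Longrightarrow> x \<notin> ball c r \<Longrightarrow> bump c r x = 0"
proof -
  show "0 \<le> bump c r x" by (simp add: bump_def)
  have "x \<in> ball c r \<longleftrightarrow> r\<^sup>2 - (x - c) \<bullet> (x - c) > 0" if "r > 0"
    using that abs_le_square_iff[of r "dist c x"]
    by (simp add: dot_square_norm dist_norm norm_minus_commute not_le[symmetric])
  then show "r > 0 \<Longrightarrow> bump c r x > 0 \<longleftrightarrow> x \<in> ball c r" "r > 0 \<Longrightarrow> x \<notin> ball c r \<Longrightarrow> bump c r x = 0"
    by (auto simp: bump_def max_def)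
qed

lemma C1_deriv_scaleR:
  fixes f :: "'a::real_normed_vector \<Rightarrow> real" and g :: "'a \<Rightarrow> 'b::real_normed_vector"
  assumes "C1_deriv f f'" "C1_deriv g g'"
  shows "C1_deriv (\<lambda>x. f x *\<^sub>R g x) (\<lambda>x h. f x *\<^sub>R g' x h + f' x h *\<^sub>R g x)"
  unfolding C1_deriv_def
  by (intro conjI allI has_derivative_scaleR continuous_intros C1_derivD(1,2,3)[OF assms(1)] C1_derivD(1,2,3)[OF assms(2)])

text \<open>Regularity of the outer function is required only on the range of \<open>f\<close>,
  since it may have a pole elsewhere, as \<open>t / (1 + t)\<close> does at -1.\<close>

lemma C1_deriv_real_compose:
  fixes f :: "'a::real_normed_vector \<Rightarrow> real" and q :: "real \<Rightarrow> real"
  assumes f: "C1_deriv f f'" and q: "\<And>x. (q has_real_derivative q' (f x)) (at (f x))"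
    and q': "continuous_on (range f) q'"
  shows "C1_deriv (\<lambda>x. q (f x)) (\<lambda>x h. q' (f x) * f' x h)"
  unfolding C1_deriv_def
proof (intro conjI allI)
  fix x
  show "((\<lambda>x. q (f x)) has_derivative (\<lambda>h. q' (f x) * f' x h)) (at x)"
    using has_derivative_compose[OF C1_derivD(1)[OF f] q[of x, unfolded has_field_derivative_def]] .
next
  fix v show "continuous_on UNIV (\<lambda>x. q' (f x) * f' x v)"
    by (intro continuous_intros C1_derivD(2)[OF f] continuous_on_compose2[OF q' C1_derivD(3)[OF f]]) auto
qed

text \<open>By Lindelof \<open>S\<close> is a countable union of balls. Weighted partial sums of
  their bumps increase to infinity on \<open>S\<close> and vanish elsewhere, and
  \<open>t / (1 + t)\<close> maps them into [0, 1).\<close>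

lemma open_C1_approx:
  fixes S :: "'a::euclidean_space set"
  assumes "open S"
  obtains f :: "nat \<Rightarrow> 'a \<Rightarrow> real" and f' K where
    "\<And>n. C1_deriv (f n) (f' n)" "\<And>n. compact (K n)" "\<And>n. K n \<subseteq> S" "\<And>n x. x \<notin> K n \<Longrightarrow> f n x = 0"
    "\<And>n x. 0 \<le> f n x" "\<And>x. incseq (\<lambda>n. f n x)" "\<And>x. (\<lambda>n. f n x) \<longlonglongrightarrow> indicator S x"
proof -
  \<comment> \<open>Closed balls inside \<open>S\<close> are demanded so that finite unions of them
    are compact subsets of \<open>S\<close> that can serve as supports.\<close>
  define \<B> where "\<B> = {(c, r). r > 0 \<and> cball c r \<subseteq> S}"
  have "\<Union> ((\<lambda>(c, r). ball c r) ` \<B>) = S"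
  proof
    show "\<Union> ((\<lambda>(c, r). ball c r) ` \<B>) \<subseteq> S" by (auto simp: \<B>_def subset_iff)
    show "S \<subseteq> \<Union> ((\<lambda>(c, r). ball c r) ` \<B>)"
    proof
      fix x assume "x \<in> S"
      then obtain r where "r > 0" "cball x r \<subseteq> S" using assms open_contains_cball by blast
      then show "x \<in> \<Union> ((\<lambda>(c, r). ball c r) ` \<B>)" by (intro UN_I[of "(x, r)"]) (auto simp: \<B>_def)
    qed
  qed
  moreover obtain F where F: "F \<subseteq> (\<lambda>(c, r). ball c r) ` \<B>" "countable F" "\<Union> F = \<Union> ((\<lambda>(c, r). ball c r) ` \<B>)"
    using Lindelof[of "(\<lambda>(c, r). ball c r) ` \<B>"] by (auto simp: split_beta)
  ultimately have FS: "\<Union> F = S" by simp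
  obtain B where B: "B \<subseteq> \<B>" "countable B" "F = (\<lambda>(c, r). ball c r) ` B"
    using countable_subset_image[of F "\<lambda>(c, r). ball c r" \<B>] F by blast
  show ?thesis
  proof (cases "B = {}")
    case True
    then have S: "S = {}" using FS B by simp
    show ?thesis
      by (rule that[of "\<lambda>_ _. 0" "\<lambda>_ _ _. 0" "\<lambda>_. {}"]) (auto simp: C1_deriv_def S incseq_def)
  next
    case False
    define p where "p = from_nat_into B"
    have pB: "p i \<in> \<B>" for i using False B from_nat_into[of B] by (auto simp: p_def)
    have rp: "range p = B" using False B by (simp add: p_def range_from_nat_into)
    have r: "snd (p i) > 0" "cball (fst (p i)) (snd (p i)) \<subseteq> S" for i using pB[of i] by (auto simp: \<B>_def)
    \<comment> \<open>The factor \<open>real n\<close> sends the sum to infinity even at a point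
      covered by a single ball of the sequence.\<close>
    define s where "s n x = real n * (\<Sum>i<n. bump (fst (p i)) (snd (p i)) x)" for n x
    define s' where "s' n x h = real n * (\<Sum>i<n. bump_deriv (fst (p i)) (snd (p i)) x h)" for n x h
    have s: "C1_deriv (s n) (s' n)" for n unfolding C1_deriv_def s_def s'_def
      by (intro conjI allI continuous_intros derivative_intros C1_derivD(1,2)[OF bump_C1])
    have s0: "s n x \<ge> 0" for n x by (simp add: s_def bump_pos sum_nonneg)
    have smono: "s n x \<le> s m x" if "n \<le> m" for n m x
      unfolding s_def using that by (intro mult_mono sum_mono2) (auto simp: bump_pos sum_nonneg)
    define q where "q t = t / (1 + t)" for t :: real
    define q' where "q' t = 1 / (1 + t)\<^sup>2" for t :: real
    show ?thesis
    proof (rule that[of "\<lambda>n x. q (s n x)" "\<lambda>n x h. q' (s n x) * s' n x h" "\<lambda>n. \<Union>i<n. cball (fst (p i)) (snd (p i))"])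
      show "C1_deriv (\<lambda>x. q (s n x)) (\<lambda>x h. q' (s n x) * s' n x h)" for n
      proof (rule C1_deriv_real_compose[OF s])
        fix x
        have "1 + s n x \<noteq> 0" using s0[of n x] by linarith
        then show "(q has_real_derivative q' (s n x)) (at (s n x))"
          unfolding q_def[abs_def] q'_def
          by (auto intro!: derivative_eq_intros simp: divide_simps power2_eq_square)
      next
        have "1 + t \<noteq> 0" if tr: "t \<in> range (s n)" for t
        proof -
          obtain x where "t = s n x" using tr by auto
          then show ?thesis using s0[of n x] by linarith
        qed
        then show "continuous_on (range (s n)) q'" unfolding q'_def[abs_def]
          by (intro continuous_intros) auto
      qed
      show "compact (\<Union>i<n. cball (fst (p i)) (snd (p i)))" for n by (intro compact_UN) auto
      show "(\<Union>i<n. cball (fst (p i)) (snd (p i))) \<subseteq> S" for n using r by auto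
      show "q (s n x) = 0" if "x \<notin> (\<Union>i<n. cball (fst (p i)) (snd (p i)))" for n x
      proof -
        have "bump (fst (p i)) (snd (p i)) x = 0" if "i < n" for i
          using that \<open>x \<notin> (\<Union>i<n. cball (fst (p i)) (snd (p i)))\<close> by (intro bump_pos(3) r) force
        then show ?thesis by (simp add: q_def s_def)
      qed
      show "0 \<le> q (s n x)" for n x using s0[of n x] by (simp add: q_def)
      have qm: "q t \<le> q u" if "0 \<le> t" "t \<le> u" for t u using that by (simp add: q_def field_simps)
      show "incseq (\<lambda>n. q (s n x))" for x unfolding incseq_def using qm[OF s0 smono] by blast
      show "(\<lambda>n. q (s n x)) \<longlonglongrightarrow> indicator S x" for x
      proof (cases "x \<in> S")
        case True
        then obtain z where z: "z \<in> B" "x \<in> ball (fst z) (snd z)"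
          unfolding FS[symmetric] B(3) by (auto simp: split_beta)
        then obtain i where "z = p i" using rp by auto
        with z have i: "x \<in> ball (fst (p i)) (snd (p i))" by simp
        define \<beta> where "\<beta> = bump (fst (p i)) (snd (p i)) x"
        have \<beta>: "\<beta> > 0" unfolding \<beta>_def using bump_pos(2)[OF r(1)[of i], of "fst (p i)" x] i by blast
        have ge: "real n * \<beta> \<le> s n x" if "n > i" for n
          unfolding s_def \<beta>_def using that by (intro mult_left_mono member_le_sum) (auto simp: bump_pos)
        have "(\<lambda>n. q (real n * \<beta>)) \<longlonglongrightarrow> 1" unfolding q_def using \<beta> by real_asymp
        then have "(\<lambda>n. q (s n x)) \<longlonglongrightarrow> 1"
        proof (rule tendsto_sandwich[rotated 2, OF _ tendsto_const])
          show "\<forall>\<^sub>F n in sequentially. q (real n * \<beta>) \<le> q (s n x)"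
            using eventually_gt_at_top[of i] by eventually_elim (use ge \<beta> in \<open>auto intro!: qm\<close>)
          show "\<forall>\<^sub>F n in sequentially. q (s n x) \<le> 1"
          proof (intro always_eventually allI)
            fix n show "q (s n x) \<le> 1" using s0[of n x] by (simp add: q_def divide_le_eq)
          qed
        qed
        then show ?thesis using True by simp
      next
        case False
        have "bump (fst (p i)) (snd (p i)) x = 0" for i
          using False r(2)[of i] by (intro bump_pos(3) r) (auto dest: subsetD[of _ _ x])
        then have "s n x = 0" for n by (simp add: s_def)
        then show ?thesis using False by (simp add: q_def)
      qed
    qed
  qed
qed

text \<open>The factor \<open>indicator U y\<close> in the map only serves to make it measurable; the density vanishes
  outside \<open>U\<close>.\<close>

definition chart_measure :: "((real^2) \<times> real \<Rightarrow> real^3) \<Rightarrow> (real^2) set \<Rightarrow> (real^2 \<Rightarrow> real) \<Rightarrow> (real^2 \<Rightarrow> real) \<Rightarrow> (real^3) measure" where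
  "chart_measure A U \<phi> d = distr (density lborel (\<lambda>y. ennreal (indicator U y * d y))) borel
      (\<lambda>y. indicator U y *\<^sub>R A (y, \<phi> y))"

context graph_chart begin

lemma meas_G [measurable]: "(\<lambda>y. indicator U y *\<^sub>R A (y, \<phi> y)) \<in> borel_measurable borel"
  using open_U by (intro borel_measurable_continuous_on_indicator)
    (auto intro!: continuous_on_compose2[OF cont_A[of UNIV]] continuous_intros cont_phi)

lemma sets_chart_measure [simp]: "sets (chart_measure A U \<phi> d) = sets borel" "space (chart_measure A U \<phi> d) = UNIV"
  by (simp_all add: chart_measure_def)

lemma measurable_chart_measure [measurable_cong]: "sets (chart_measure A U \<phi> d) = sets borel"
  by simp

lemma nn_integral_chart_measure:
  assumes d: "continuous_on U d" and [measurable]: "h \<in> borel_measurable borel"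
  shows "nn_integral (chart_measure A U \<phi> d) h = (\<integral>\<^sup>+y\<in>U. h (A (y, \<phi> y)) * ennreal (d y) \<partial>lborel)"
proof -
  have [measurable]: "(\<lambda>y. indicator U y * d y) \<in> borel_measurable borel"
    using borel_measurable_continuous_on_indicator[OF _ d] open_U by simp
  have "nn_integral (chart_measure A U \<phi> d) h =
      (\<integral>\<^sup>+y. ennreal (indicator U y * d y) * h (indicator U y *\<^sub>R A (y, \<phi> y)) \<partial>lborel)"
    unfolding chart_measure_def by (subst nn_integral_distr) (simp_all add: nn_integral_density)
  also have "\<dots> = (\<integral>\<^sup>+y\<in>U. h (A (y, \<phi> y)) * ennreal (d y) \<partial>lborel)"
    by (intro nn_integral_cong) (simp add: indicator_def mult.commute)
  finally show ?thesis .
qed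

lemma emeasure_chart_measure:
  assumes d: "continuous_on U d" and [measurable]: "B \<in> sets borel"
  shows "emeasure (chart_measure A U \<phi> d) B = (\<integral>\<^sup>+y\<in>U. indicator B (A (y, \<phi> y)) * ennreal (d y) \<partial>lborel)"
  using nn_integral_chart_measure[OF d, of "indicator B"] by simp

text \<open>Over every \<open>y\<close> in \<open>U\<close> there is a point of \<Omega>, and
  \<open>A\<close> is isometric. The resulting finite area of \<open>U\<close> is what the
  uniqueness theorem for measures asks for when chart measures are compared.\<close>

lemma bounded_U:
  assumes "bounded \<Omega>"
  shows "bounded U"
proof -
  obtain R where R: "\<And>x. x \<in> \<Omega> \<Longrightarrow> norm x \<le> R" using assms by (auto simp: bounded_iff)
  have "norm y \<le> R + norm (A 0)" if y: "y \<in> U" for y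
  proof -
    define t where "t = (a + \<phi> y) / 2"
    have "A (y, t) \<in> \<Omega>" using Omega_cyl[OF y, of t] bounds[OF y] by (simp add: t_def)
    then have "norm (A (y, t)) \<le> R" by (rule R)
    moreover have "norm (y, t) = norm (A (y, t) - A 0)"
      using iso[of "(y, t)" 0] by (simp add: dist_norm)
    moreover have "norm y \<le> norm (y, t)" using norm_fst_le[of y t] by simp
    ultimately show ?thesis using norm_triangle_ineq4[of "A (y, t)" "A 0"] by linarith
  qed
  then show ?thesis by (auto simp: bounded_iff)
qed

lemma support_integrable:
  fixes f :: "real^3 \<Rightarrow> real"
  assumes d: "continuous_on U d" and f: "continuous_on UNIV f" and K: "compact K" "K \<subseteq> cyl" "\<And>x. x \<notin> K \<Longrightarrow> f x = 0"
  shows "integrable lborel (\<lambda>y. indicator U y *\<^sub>R (d y *\<^sub>R f (A (y, \<phi> y))))"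
proof (rule integrable_compact_support[where K = "fst ` inv A ` K"])
  have sub: "fst ` inv A ` K \<subseteq> U" using K(2) by (auto simp: cyl_def)
  show "continuous_on (fst ` inv A ` K) (\<lambda>y. indicator U y *\<^sub>R (d y *\<^sub>R f (A (y, \<phi> y))))"
  proof (rule continuous_on_cong[THEN iffD2, OF refl])
    show "continuous_on (fst ` inv A ` K) (\<lambda>y. d y *\<^sub>R f (A (y, \<phi> y)))"
      by (intro continuous_intros continuous_on_compose2[OF f] continuous_on_compose2[OF cont_A[of UNIV]]
            continuous_on_subset[OF cont_phi sub] continuous_on_subset[OF d sub]) auto
    show "indicator U y *\<^sub>R (d y *\<^sub>R f (A (y, \<phi> y))) = d y *\<^sub>R f (A (y, \<phi> y))" if "y \<in> fst ` inv A ` K" for y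
      using subsetD[OF sub that] by simp
  qed
  show "compact (fst ` inv A ` K)" by (intro compact_continuous_image K continuous_intros cont_inv_A)
  show "indicator U y *\<^sub>R (d y *\<^sub>R f (A (y, \<phi> y))) = 0" if "y \<notin> fst ` inv A ` K" for y
  proof -
    have "A (y, \<phi> y) \<notin> K" using that by (metis fst_conv image_eqI inv_A(1))
    then show ?thesis using K(3) by simp
  qed
qed

end

text \<open>No change of variables between the charts is needed. In the vertical direction \<open>e\<close> of the first chart the
  divergence theorem expresses one volume integral in both charts, with weight \<open>1\<close> in the first one and
  \<open>d2\<close> in the second one, so that the two weighted measures agree on the overlap.\<close>

locale two_charts = g1: graph_chart \<Omega> A1 U1 a1 b1 \<phi>1 + g2: graph_chart \<Omega> A2 U2 a2 b2 \<phi>2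
  for \<Omega> A1 U1 a1 b1 \<phi>1 A2 U2 a2 b2 \<phi>2 +
  assumes open_Omega: "open \<Omega>" and bounded_Omega: "bounded \<Omega>"
begin

definition e where "e = lin_part A1 (0, 1)"

text \<open>On the overlap of the cylinders the inner product is positive; truncation at 0 makes
  \<open>d2\<close> a nonnegative continuous density on all of \<open>U2\<close>.\<close>

definition d2 where "d2 y = max 0 (e \<bullet> graph_normal A2 \<phi>2 y)"

definition W where "W = g1.cyl \<inter> g2.cyl"

lemma e_n1: "e \<bullet> graph_normal A1 \<phi>1 y = 1"
  by (simp add: e_def g1.inner_graph_normal)

lemma cont_d2: "continuous_on U2 d2"
  unfolding d2_def[abs_def] by (intro continuous_intros g2.cont_graph_normal)

text \<open>At a common boundary point the unit normals agree. Pairing both with \<open>e\<close>,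
  for which \<open>e \<bullet> graph_normal A1 \<phi>1 y = 1\<close>, gives the quotient of the two
  area densities.\<close>

lemma density_ratio:
  assumes "y2 \<in> U2" "A2 (y2, \<phi>2 y2) \<in> W"
  shows "graph_density \<phi>1 (fst (inv A1 (A2 (y2, \<phi>2 y2)))) * (e \<bullet> graph_normal A2 \<phi>2 y2) = graph_density \<phi>2 y2"
    "e \<bullet> graph_normal A2 \<phi>2 y2 > 0"
proof -
  have "A2 (y2, \<phi>2 y2) \<in> frontier \<Omega>" using g2.frontier_graph[OF open_Omega assms(1)] by simp
  then obtain y1 where y1: "y1 \<in> U1" "A2 (y2, \<phi>2 y2) = A1 (y1, \<phi>1 y1)"
    using g1.frontier_cyl[OF open_Omega] assms by (auto simp: W_def)
  have "(1 / graph_density \<phi>1 y1) *\<^sub>R graph_normal A1 \<phi>1 y1 = (1 / graph_density \<phi>2 y2) *\<^sub>R graph_normal A2 \<phi>2 y2"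
    by (rule normal_unique[OF g1.graph_chart_axioms g2.graph_chart_axioms y1(1) assms(1) y1(2)[symmetric]])
  then have "e \<bullet> ((1 / graph_density \<phi>1 y1) *\<^sub>R graph_normal A1 \<phi>1 y1) = e \<bullet> ((1 / graph_density \<phi>2 y2) *\<^sub>R graph_normal A2 \<phi>2 y2)"
    by simp
  then have *: "1 / graph_density \<phi>1 y1 = (e \<bullet> graph_normal A2 \<phi>2 y2) / graph_density \<phi>2 y2"
    by (simp add: e_n1)
  have p: "graph_density \<phi>1 y1 > 0" "graph_density \<phi>2 y2 > 0" using g1.graph_density_pos g2.graph_density_pos by auto
  show "graph_density \<phi>1 (fst (inv A1 (A2 (y2, \<phi>2 y2)))) * (e \<bullet> graph_normal A2 \<phi>2 y2) = graph_density \<phi>2 y2"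
    using * p by (simp add: y1 field_simps)
  have "(e \<bullet> graph_normal A2 \<phi>2 y2) / graph_density \<phi>2 y2 > 0" using * p(1) by (metis zero_less_divide_1_iff)
  then show "e \<bullet> graph_normal A2 \<phi>2 y2 > 0" using p(2) by (simp add: zero_less_divide_iff)
qed

text \<open>For a C^1 function supported in \<open>S\<close> both chart integrals equal the same
  volume integral of its derivative along \<open>e\<close>. Monotone convergence to the indicator of
  \<open>S\<close> gives the measures.\<close>

lemma emeasure_open_eq:
  assumes "open S" "S \<subseteq> W"
  shows "emeasure (chart_measure A1 U1 \<phi>1 (\<lambda>_. 1)) S = emeasure (chart_measure A2 U2 \<phi>2 d2) S"
proof -
  obtain f :: "nat \<Rightarrow> real^3 \<Rightarrow> real" and f' K where
    f: "\<And>n. C1_deriv (f n) (f' n)" and K: "\<And>n. compact (K n)" "\<And>n. K n \<subseteq> S" "\<And>n x. x \<notin> K n \<Longrightarrow> f n x = 0"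
    and f0: "\<And>n x. 0 \<le> f n x" and fm: "\<And>x. incseq (\<lambda>n. f n x)" and fl: "\<And>x. (\<lambda>n. f n x) \<longlonglongrightarrow> indicator S x"
    using open_C1_approx[OF assms(1)] by metis
  have [measurable]: "f n \<in> borel_measurable borel" for n
    by (rule borel_measurable_continuous_onI[OF C1_derivD(3)[OF f]])
  have sup: "indicator S x = (SUP n. ennreal (f n x))" for x
  proof -
    have "incseq (\<lambda>n. ennreal (f n x))" using fm[of x] f0 by (auto simp: incseq_def intro!: ennreal_leI)
    from LIMSEQ_SUP[OF this] tendsto_ennrealI[OF fl[of x]] have "(SUP n. ennreal (f n x)) = ennreal (indicator S x)"
      using LIMSEQ_unique by blast
    then show ?thesis by (simp add: ennreal_indicator)
  qed
  have em: "emeasure M S = (SUP n. \<integral>\<^sup>+x. ennreal (f n x) \<partial>M)" if M: "sets M = sets borel" for M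
  proof -
    have "emeasure M S = (\<integral>\<^sup>+x. (SUP n. ennreal (f n x)) \<partial>M)"
      unfolding sup[symmetric] using assms(1) M by simp
    also have "\<dots> = (SUP n. \<integral>\<^sup>+x. ennreal (f n x) \<partial>M)"
    proof (rule nn_integral_monotone_convergence_SUP)
      show "incseq (\<lambda>n x. ennreal (f n x))"
        by (intro incseq_SucI le_funI ennreal_leI) (use fm in \<open>simp add: incseq_Suc_iff\<close>)
      show "(\<lambda>x. ennreal (f n x)) \<in> borel_measurable M" for n by (subst measurable_cong_sets[OF M refl]) simp
    qed
    finally show ?thesis .
  qed
  have "(\<integral>\<^sup>+x. ennreal (f n x) \<partial>(chart_measure A1 U1 \<phi>1 (\<lambda>_. 1))) = (\<integral>\<^sup>+x. ennreal (f n x) \<partial>(chart_measure A2 U2 \<phi>2 d2))" for n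
  proof -
    have K1: "K n \<subseteq> g1.cyl" "K n \<subseteq> g2.cyl" using K(2) assms(2) by (auto simp: W_def)
    have cf: "continuous_on UNIV (f n)" by (rule C1_derivD(3)[OF f])
    have "(\<integral>\<^sup>+x. ennreal (f n x) \<partial>(chart_measure A1 U1 \<phi>1 (\<lambda>_. 1))) =
        (\<integral>\<^sup>+y. ennreal (indicator U1 y *\<^sub>R (1 *\<^sub>R f n (A1 (y, \<phi>1 y)))) \<partial>lborel)"
      by (subst g1.nn_integral_chart_measure) (auto intro!: nn_integral_cong simp: indicator_def)
    also have "\<dots> = ennreal (LINT y|lborel. indicator U1 y *\<^sub>R (1 *\<^sub>R f n (A1 (y, \<phi>1 y))))"
      by (intro nn_integral_eq_integral g1.support_integrable[OF _ cf K(1) K1(1) K(3)]) (auto simp: f0)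
    also have "(LINT y|lborel. indicator U1 y *\<^sub>R (1 *\<^sub>R f n (A1 (y, \<phi>1 y)))) = (LINT x|lborel. indicator \<Omega> x *\<^sub>R f' n x e)"
      by (subst g1.chart_divergence[OF open_Omega f K(1) K1(1) K(3)]) (simp_all add: e_n1)
    also have "\<dots> = (LINT y|lborel. indicator U2 y *\<^sub>R ((e \<bullet> graph_normal A2 \<phi>2 y) *\<^sub>R f n (A2 (y, \<phi>2 y))))"
      by (rule g2.chart_divergence[OF open_Omega f K(1) K1(2) K(3)])
    also have "\<dots> = (LINT y|lborel. indicator U2 y *\<^sub>R (d2 y *\<^sub>R f n (A2 (y, \<phi>2 y))))"
    proof (intro Bochner_Integration.integral_cong refl)
      fix y
      show "indicator U2 y *\<^sub>R ((e \<bullet> graph_normal A2 \<phi>2 y) *\<^sub>R f n (A2 (y, \<phi>2 y))) =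
        indicator U2 y *\<^sub>R (d2 y *\<^sub>R f n (A2 (y, \<phi>2 y)))"
      proof (cases "y \<in> U2 \<and> A2 (y, \<phi>2 y) \<in> K n")
        case True
        then have "A2 (y, \<phi>2 y) \<in> W" using K(2) assms(2) by auto
        then show ?thesis using density_ratio(2)[of y] True by (simp add: d2_def)
      next
        case False
        then show ?thesis using K(3) by (auto simp: indicator_def)
      qed
    qed
    also have "ennreal \<dots> = (\<integral>\<^sup>+y. ennreal (indicator U2 y *\<^sub>R (d2 y *\<^sub>R f n (A2 (y, \<phi>2 y)))) \<partial>lborel)"
      by (intro nn_integral_eq_integral[symmetric] g2.support_integrable[OF cont_d2 cf K(1) K1(2) K(3)]) (auto simp: f0 d2_def)
    also have "\<dots> = (\<integral>\<^sup>+x. ennreal (f n x) \<partial>(chart_measure A2 U2 \<phi>2 d2))"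
    proof (subst g2.nn_integral_chart_measure[OF cont_d2], simp, intro nn_integral_cong)
      fix y
      have "d2 y \<ge> 0" by (simp add: d2_def)
      then show "ennreal (indicator U2 y *\<^sub>R (d2 y *\<^sub>R f n (A2 (y, \<phi>2 y)))) =
          ennreal (f n (A2 (y, \<phi>2 y))) * ennreal (d2 y) * indicator U2 y"
        by (cases "y \<in> U2") (simp_all add: ennreal_mult'[symmetric] mult.commute)
    qed
    finally show ?thesis .
  qed
  then show ?thesis by (simp add: em)
qed

text \<open>Open sets form an intersection-stable generator, so agreement on them extends to Borel
  sets. Multiplication by the area density of the first chart then turns the weights 1 and
  \<open>d2\<close> into the two area densities, by \<open>density_ratio\<close>.\<close>

lemma consistent:
  assumes [measurable]: "B \<in> sets borel" and BW: "B \<subseteq> W"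
  shows "emeasure (chart_measure A1 U1 \<phi>1 (graph_density \<phi>1)) B = emeasure (chart_measure A2 U2 \<phi>2 (graph_density \<phi>2)) B"
proof -
  have W: "open W" unfolding W_def by (intro open_Int g1.open_cyl g2.open_cyl)
  have [measurable]: "W \<in> sets borel" using W by simp
  \<comment> \<open>Both measures are cut down to \<open>W\<close>, outside of which they need not
    agree.\<close>
  let ?N1 = "density (chart_measure A1 U1 \<phi>1 (\<lambda>_. 1)) (indicator W)"
  let ?N2 = "density (chart_measure A2 U2 \<phi>2 d2) (indicator W)"
  have e1: "emeasure ?N1 X = emeasure (chart_measure A1 U1 \<phi>1 (\<lambda>_. 1)) (X \<inter> W)" if "X \<in> sets borel" for X
    using that by (subst emeasure_density) (auto simp: indicator_inter_arith[symmetric] mult.commute Int_commute)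
  have e2: "emeasure ?N2 X = emeasure (chart_measure A2 U2 \<phi>2 d2) (X \<inter> W)" if "X \<in> sets borel" for X
    using that by (subst emeasure_density) (auto simp: indicator_inter_arith[symmetric] mult.commute Int_commute)
  have "?N1 = ?N2"
  proof (rule measure_eqI_generator_eq)
    let ?E = "{S. open S} :: (real^3) set set"
    show "Int_stable ?E" by (auto simp: Int_stable_def)
    show "?E \<subseteq> Pow UNIV" by simp
    show "sets ?N1 = sigma_sets UNIV ?E" "sets ?N2 = sigma_sets UNIV ?E" by (simp_all add: borel_def)
    show "emeasure ?N1 X = emeasure ?N2 X" if "X \<in> ?E" for X
    proof -
      have X: "open X" "X \<in> sets borel" using that by auto
      show ?thesis unfolding e1[OF X(2)] e2[OF X(2)] using X W by (intro emeasure_open_eq) auto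
    qed
    show "range (\<lambda>_::nat. UNIV) \<subseteq> ?E" "(\<Union>i::nat. UNIV) = (UNIV :: (real^3) set)" by auto
    show "emeasure ?N1 UNIV \<noteq> \<infinity>"
    proof -
      have "emeasure ?N1 UNIV = (\<integral>\<^sup>+y\<in>U1. indicator W (A1 (y, \<phi>1 y)) * ennreal 1 \<partial>lborel)"
        using e1[of UNIV] g1.emeasure_chart_measure[of "\<lambda>_. 1" W] by simp
      also have "\<dots> \<le> (\<integral>\<^sup>+y. indicator U1 y \<partial>lborel)"
        by (intro nn_integral_mono) (auto simp: indicator_def)
      also have "\<dots> = emeasure lborel U1" using g1.open_U by simp
      also have "\<dots> < \<infinity>" using emeasure_bounded_finite[OF g1.bounded_U[OF bounded_Omega]] .
      finally show ?thesis by simp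
    qed
  qed
  \<comment> \<open>The area density of the first chart, read as a Borel function on space so that
    it can be integrated against either measure.\<close>
  define D where "D x = indicator g1.cyl x *\<^sub>R graph_density \<phi>1 (fst (inv A1 x))" for x
  have [measurable]: "D \<in> borel_measurable borel" unfolding D_def[abs_def]
  proof (rule borel_measurable_continuous_on_indicator)
    show "continuous_on g1.cyl (\<lambda>x. graph_density \<phi>1 (fst (inv A1 x)))"
      by (intro continuous_on_compose2[OF g1.cont_density] continuous_intros g1.cont_inv_A)
        (auto simp: g1.cyl_def)
  qed (use g1.open_cyl in simp)
  let ?h = "\<lambda>x. indicator B x * ennreal (D x)"
  have "emeasure (chart_measure A1 U1 \<phi>1 (graph_density \<phi>1)) B = (\<integral>\<^sup>+x. indicator W x * ?h x \<partial>(chart_measure A1 U1 \<phi>1 (\<lambda>_. 1)))"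
    unfolding g1.emeasure_chart_measure[OF g1.cont_density assms(1)]
  proof (subst g1.nn_integral_chart_measure, simp, measurable, intro nn_integral_cong)
    fix y
    show "indicator B (A1 (y, \<phi>1 y)) * ennreal (graph_density \<phi>1 y) * indicator U1 y =
      indicator W (A1 (y, \<phi>1 y)) * (indicator B (A1 (y, \<phi>1 y)) * ennreal (D (A1 (y, \<phi>1 y)))) * ennreal 1 * indicator U1 y"
    proof (cases "A1 (y, \<phi>1 y) \<in> B")
      case True
      then have "A1 (y, \<phi>1 y) \<in> W" using BW by auto
      then show ?thesis by (simp add: D_def W_def)
    qed simp
  qed
  also have "\<dots> = nn_integral ?N1 ?h" by (subst nn_integral_density) simp_all
  also have "\<dots> = nn_integral ?N2 ?h" by (simp add: \<open>?N1 = ?N2\<close>)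
  also have "\<dots> = (\<integral>\<^sup>+x. indicator W x * ?h x \<partial>(chart_measure A2 U2 \<phi>2 d2))"
    by (subst nn_integral_density) simp_all
  also have "\<dots> = emeasure (chart_measure A2 U2 \<phi>2 (graph_density \<phi>2)) B"
    unfolding g2.emeasure_chart_measure[OF g2.cont_density assms(1)]
  proof (subst g2.nn_integral_chart_measure[OF cont_d2], simp, intro nn_integral_cong)
    fix y
    show "indicator W (A2 (y, \<phi>2 y)) * (indicator B (A2 (y, \<phi>2 y)) * ennreal (D (A2 (y, \<phi>2 y)))) * ennreal (d2 y) * indicator U2 y =
      indicator B (A2 (y, \<phi>2 y)) * ennreal (graph_density \<phi>2 y) * indicator U2 y"
    proof (cases "y \<in> U2 \<and> A2 (y, \<phi>2 y) \<in> B")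
      case True
      then have w: "A2 (y, \<phi>2 y) \<in> W" using BW by auto
      then have "A2 (y, \<phi>2 y) \<in> g1.cyl" by (simp add: W_def)
      then have "ennreal (D (A2 (y, \<phi>2 y))) * ennreal (d2 y) = ennreal (graph_density \<phi>2 y)"
        using density_ratio[of y] True w g1.graph_density_pos(1)[of "fst (inv A1 (A2 (y, \<phi>2 y)))"]
        by (simp add: D_def d2_def ennreal_mult[symmetric])
      then show ?thesis using True w by simp
    qed auto
  qed
  finally show ?thesis .
qed

end

section \<open>The surface measure and the divergence theorem\<close>

text \<open>The property under the definite description in \<open>surface_measure\<close>, isolated
  so that unique existence can be stated.\<close>

definition is_surface_measure :: "(real^3) set \<Rightarrow> (real^3) measure \<Rightarrow> bool" where
  "is_surface_measure \<Omega> M \<longleftrightarrow> sets M = sets borel \<and> emeasure M (- frontier \<Omega>) = 0 \<and>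
     (\<forall>A U a b \<phi>. local_graph \<Omega> A U a b \<phi> \<longrightarrow>
        (\<forall>B\<in>sets borel. B \<subseteq> A ` (U \<times> {a<..<b}) \<longrightarrow>
           emeasure M B =
             (\<integral>\<^sup>+y\<in>U. indicator B (A (y, \<phi> y)) * ennreal (graph_density \<phi> y) \<partial>lborel)))"

locale C2_domain =
  fixes \<Omega> :: "(real^3) set"
  assumes open_Omega: "open \<Omega>" and bounded_Omega: "bounded \<Omega>" and C2: "C2_boundary \<Omega>"
begin

lemma compact_frontier: "compact (frontier \<Omega>)"
  using bounded_Omega by (simp add: compact_frontier_bounded)

lemma chart_at:
  assumes "x \<in> frontier \<Omega>"
  obtains A U a b \<phi> where "graph_chart \<Omega> A U a b \<phi>" "x \<in> graph_chart.cyl A U a b"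
proof -
  obtain A U a b \<phi> where *: "local_graph \<Omega> A U a b \<phi>" "x \<in> A ` (U \<times> {a<..<b})"
    using C2 assms unfolding C2_boundary_def by blast
  then interpret graph_chart \<Omega> A U a b \<phi> by unfold_locales
  show ?thesis using that[OF graph_chart_axioms] * by (simp add: cyl_def)
qed

text \<open>Compactness of the frontier gives finitely many charts. They are numbered by naturals
  because the later splitting into disjoint pieces needs an order.\<close>

lemma chart_cover:
  obtains n :: nat and A U a b \<phi> where "\<And>i. i < n \<Longrightarrow> graph_chart \<Omega> (A i) (U i) (a i) (b i) (\<phi> i)"
    "frontier \<Omega> \<subseteq> (\<Union>i<n. graph_chart.cyl (A i) (U i) (a i) (b i))"
proof -
  define T where "T = {(A, U, a, b, \<phi>). graph_chart \<Omega> A U a b \<phi>}"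
  define c where "c = (\<lambda>(A, U, a, b, \<phi> :: real^2 \<Rightarrow> real). graph_chart.cyl A U a b)"
  have "frontier \<Omega> \<subseteq> (\<Union>t\<in>T. c t)"
  proof
    fix x assume "x \<in> frontier \<Omega>"
    then obtain A U a b \<phi> where "graph_chart \<Omega> A U a b \<phi>" "x \<in> graph_chart.cyl A U a b" by (rule chart_at)
    then show "x \<in> (\<Union>t\<in>T. c t)" by (intro UN_I[of "(A, U, a, b, \<phi>)"]) (auto simp: T_def c_def)
  qed
  moreover have "open (c t)" if "t \<in> T" for t
    using that by (auto simp: T_def c_def intro: graph_chart.open_cyl)
  ultimately obtain T' where T': "T' \<subseteq> T" "finite T'" "frontier \<Omega> \<subseteq> (\<Union>t\<in>T'. c t)"
    using compactE_image[OF compact_frontier, of T c] by metis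
  obtain h where h: "bij_betw h {0..<card T'} T'" using ex_bij_betw_nat_finite[OF T'(2)] by blast
  then have im: "T' = h ` {..<card T'}" by (simp add: bij_betw_def lessThan_atLeast0)
  show ?thesis
  proof (rule that)
    let ?A = "\<lambda>i. fst (h i)" and ?U = "\<lambda>i. fst (snd (h i))" and ?a = "\<lambda>i. fst (snd (snd (h i)))"
      and ?b = "\<lambda>i. fst (snd (snd (snd (h i))))" and ?\<phi> = "\<lambda>i. snd (snd (snd (snd (h i))))"
    show "graph_chart \<Omega> (?A i) (?U i) (?a i) (?b i) (?\<phi> i)" if "i < card T'" for i
    proof -
      have "h i \<in> T" using that im T'(1) by blast
      then show ?thesis by (auto simp: T_def split_beta)
    qed
    show "frontier \<Omega> \<subseteq> (\<Union>i<card T'. graph_chart.cyl (?A i) (?U i) (?a i) (?b i))"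
      using T'(3) by (subst (asm) im) (simp add: c_def split_beta)
  qed
qed

lemma consistent_charts:
  assumes "graph_chart \<Omega> A U a b \<phi>" "graph_chart \<Omega> A' U' a' b' \<phi>'"
    "B \<in> sets borel" "B \<subseteq> graph_chart.cyl A U a b" "B \<subseteq> graph_chart.cyl A' U' a' b'"
  shows "emeasure (chart_measure A U \<phi> (graph_density \<phi>)) B = emeasure (chart_measure A' U' \<phi>' (graph_density \<phi>')) B"
proof -
  interpret g1: graph_chart \<Omega> A U a b \<phi> by fact
  interpret g2: graph_chart \<Omega> A' U' a' b' \<phi>' by fact
  interpret two_charts \<Omega> A U a b \<phi> A' U' a' b' \<phi>'
    by unfold_locales (use open_Omega bounded_Omega in auto)
  show ?thesis using assms by (intro consistent) (auto simp: W_def)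
qed

lemma chart_measure_frontier:
  assumes "graph_chart \<Omega> A U a b \<phi>" "B \<in> sets borel" "B \<inter> frontier \<Omega> = {}"
  shows "emeasure (chart_measure A U \<phi> (graph_density \<phi>)) B = 0"
proof -
  interpret graph_chart \<Omega> A U a b \<phi> by fact
  have "(\<integral>\<^sup>+y\<in>U. indicator B (A (y, \<phi> y)) * ennreal (graph_density \<phi> y) \<partial>lborel) = (\<integral>\<^sup>+(y::real^2). 0 \<partial>lborel)"
    using frontier_graph(1)[OF open_Omega] assms(3) by (intro nn_integral_cong) (auto simp: indicator_def)
  then show ?thesis by (simp add: emeasure_chart_measure[OF cont_density assms(2)])
qed

lemma is_surface_measureD:
  assumes "is_surface_measure \<Omega> M" "graph_chart \<Omega> A U a b \<phi>" "B \<in> sets borel" "B \<subseteq> graph_chart.cyl A U a b"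
  shows "emeasure M B = emeasure (chart_measure A U \<phi> (graph_density \<phi>)) B"
proof -
  interpret graph_chart \<Omega> A U a b \<phi> by fact
  show ?thesis unfolding emeasure_chart_measure[OF cont_density assms(3)]
    using assms lg unfolding is_surface_measure_def cyl_def by blast
qed

text \<open>The measure is assembled from chart measures on disjoint pieces of finitely many
  cylinders. Consistency of charts gives the required formula in every other chart; conversely the
  formula fixes every solution on each piece, and the rest is null.\<close>

lemma ex1_surface_measure: "\<exists>!M. is_surface_measure \<Omega> M"
proof (rule chart_cover)
  fix n :: nat and A U a b \<phi>
  assume ch: "\<And>i. i < n \<Longrightarrow> graph_chart \<Omega> (A i) (U i) (a i) (b i) (\<phi> i)"
    and cov: "frontier \<Omega> \<subseteq> (\<Union>i<n. graph_chart.cyl (A i) (U i) (a i) (b i))"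
  define C where "C i = graph_chart.cyl (A i) (U i) (a i) (b i)" for i
  \<comment> \<open>Successive differences: disjoint, each inside one cylinder, with the same union
    as the cylinders.\<close>
  define P where "P i = C i - (\<Union>j<i. C j)" for i
  define cm where "cm i = chart_measure (A i) (U i) (\<phi> i) (graph_density (\<phi> i))" for i
  have Cb: "C i \<in> sets borel" if "i < n" for i
    using graph_chart.open_cyl[OF ch[OF that]] by (simp add: C_def)
  have Pb: "P i \<in> sets borel" if "i < n" for i
    unfolding P_def using that by (intro sets.Diff Cb sets.finite_UN) auto
  have scm: "sets (cm i) = sets borel" if "i < n" for i
    by (simp add: cm_def graph_chart.sets_chart_measure[OF ch[OF that]])
  have disj: "disjoint_family_on P {..<n}"
    unfolding disjoint_family_on_def P_def by (auto, metis lessThan_iff linorder_neqE_nat)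
  have UP: "(\<Union>i<m. P i) = (\<Union>i<m. C i)" for m
    by (induction m) (auto simp: lessThan_Suc P_def)
  define \<mu> where "\<mu> B = (\<Sum>i<n. emeasure (cm i) (B \<inter> P i))" for B
  define M where "M = measure_of (space borel) (sets (borel :: (real^3) measure)) \<mu>"
  have sM: "sets M = sets borel" unfolding M_def by (rule sets.sets_measure_of_eq)
  have eM: "emeasure M B = \<mu> B" if "B \<in> sets borel" for B
    unfolding M_def
  proof (rule emeasure_measure_of_sigma[OF _ _ _ that])
    show "sigma_algebra (space borel) (sets (borel :: (real^3) measure))" by (rule sets.sigma_algebra_axioms)
    show "positive (sets borel) \<mu>" by (simp add: positive_def \<mu>_def)
    show "countably_additive (sets borel) \<mu>"
    proof (rule countably_additiveI)
      fix X :: "nat \<Rightarrow> (real^3) set"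
      assume X: "range X \<subseteq> sets borel" "disjoint_family X" "\<Union> (range X) \<in> sets borel"
      have "(\<Sum>k. \<mu> (X k)) = (\<Sum>i<n. \<Sum>k. emeasure (cm i) (X k \<inter> P i))"
        unfolding \<mu>_def by (rule suminf_sum) simp
      also have "\<dots> = \<mu> (\<Union> (range X))" unfolding \<mu>_def
      proof (intro sum.cong refl)
        fix i assume "i \<in> {..<n}"
        then have i: "i < n" by simp
        have "(\<Sum>k. emeasure (cm i) (X k \<inter> P i)) = emeasure (cm i) (\<Union>k. X k \<inter> P i)"
        proof (rule suminf_emeasure)
          show "range (\<lambda>k. X k \<inter> P i) \<subseteq> sets (cm i)" using X(1) Pb[OF i] scm[OF i] by auto
          show "disjoint_family (\<lambda>k. X k \<inter> P i)" using X(2) by (auto simp: disjoint_family_on_def)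
        qed
        then show "(\<Sum>k. emeasure (cm i) (X k \<inter> P i)) = emeasure (cm i) (\<Union> (range X) \<inter> P i)"
          by (simp only: UN_simps)
      qed
      finally show "(\<Sum>k. \<mu> (X k)) = \<mu> (\<Union> (range X))" .
    qed
  qed
  \<comment> \<open>The last term lives off all cylinders, hence off the frontier, and is null for
    chart measures and for surface measures alike.\<close>
  have split: "emeasure N B = (\<Sum>i<n. emeasure N (B \<inter> P i)) + emeasure N (B - (\<Union>i<n. C i))"
    if N: "sets N = sets borel" and B: "B \<in> sets borel" for N B
  proof -
    have "emeasure N B = emeasure N (B \<inter> (\<Union>i<n. C i)) + emeasure N (B - (\<Union>i<n. C i))"
      using N B Cb by (subst plus_emeasure) (auto intro!: arg_cong[where f = "emeasure N"])
    also have "emeasure N (B \<inter> (\<Union>i<n. C i)) = (\<Sum>i<n. emeasure N (B \<inter> P i))"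
    proof (subst sum_emeasure)
      show "(\<lambda>i. B \<inter> P i) ` {..<n} \<subseteq> sets N" using N B Pb by auto
      show "disjoint_family_on (\<lambda>i. B \<inter> P i) {..<n}" using disj by (auto simp: disjoint_family_on_def)
    qed (simp_all add: UP[symmetric])
    finally show ?thesis .
  qed
  have fr: "X \<inter> frontier \<Omega> = {}" if "X \<subseteq> - (\<Union>i<n. C i)" for X using that cov unfolding C_def by blast
  have ism: "is_surface_measure \<Omega> M" unfolding is_surface_measure_def
  proof (intro conjI allI impI ballI)
    show "sets M = sets borel" by (rule sM)
    have cf: "- frontier \<Omega> \<in> sets borel" by simp
    have "emeasure (cm i) (- frontier \<Omega> \<inter> P i) = 0" if "i < n" for i
      unfolding cm_def using cf Pb[OF that] by (intro chart_measure_frontier[OF ch[OF that]]) auto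
    then show "emeasure M (- frontier \<Omega>) = 0" by (subst eM[OF cf]) (simp add: \<mu>_def)
  next
    fix A0 U0 a0 b0 \<phi>0 B
    assume lg: "local_graph \<Omega> A0 U0 a0 b0 \<phi>0" and B: "B \<in> sets borel" "B \<subseteq> A0 ` (U0 \<times> {a0<..<b0})"
    interpret g0: graph_chart \<Omega> A0 U0 a0 b0 \<phi>0 by unfold_locales fact
    let ?N = "chart_measure A0 U0 \<phi>0 (graph_density \<phi>0)"
    have "emeasure M B = (\<Sum>i<n. emeasure ?N (B \<inter> P i))" unfolding eM[OF B(1)] \<mu>_def
    proof (intro sum.cong refl)
      fix i assume "i \<in> {..<n}"
      then have i: "i < n" by simp
      show "emeasure (cm i) (B \<inter> P i) = emeasure ?N (B \<inter> P i)" unfolding cm_def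
        using B Pb[OF i] by (intro consistent_charts[OF ch[OF i] g0.graph_chart_axioms]) (auto simp: P_def C_def g0.cyl_def)
    qed
    also have "\<dots> = emeasure ?N B"
    proof -
      have "emeasure ?N (B - (\<Union>i<n. C i)) = 0"
        using B(1) Cb fr[of "B - (\<Union>i<n. C i)"]
        by (intro chart_measure_frontier[OF g0.graph_chart_axioms]) auto
      then show ?thesis using split[of ?N B] B(1) by simp
    qed
    finally show "emeasure M B = (\<integral>\<^sup>+y\<in>U0. indicator B (A0 (y, \<phi>0 y)) * ennreal (graph_density \<phi>0 y) \<partial>lborel)"
      by (simp add: g0.emeasure_chart_measure[OF g0.cont_density B(1)])
  qed
  show ?thesis
  proof (rule ex1I[where P = "is_surface_measure \<Omega>", OF ism])
    fix N assume N: "is_surface_measure \<Omega> N"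
    have sN: "sets N = sets borel" "emeasure N (- frontier \<Omega>) = 0" using N by (auto simp: is_surface_measure_def)
    show "N = M"
    proof (rule measure_eqI)
      show "sets N = sets M" using sN sM by simp
      fix B assume "B \<in> sets N"
      then have B: "B \<in> sets borel" using sN by simp
      have e: "emeasure K B = (\<Sum>i<n. emeasure (cm i) (B \<inter> P i))" if K: "is_surface_measure \<Omega> K" for K
      proof -
        have sK: "sets K = sets borel" "emeasure K (- frontier \<Omega>) = 0" using K by (auto simp: is_surface_measure_def)
        have "emeasure K (B - (\<Union>i<n. C i)) \<le> emeasure K (- frontier \<Omega>)"
          using fr[of "B - (\<Union>i<n. C i)"] sK by (intro emeasure_mono) auto
        then have "emeasure K B = (\<Sum>i<n. emeasure K (B \<inter> P i))" using split[OF sK(1) B] sK(2) by simp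
        also have "\<dots> = (\<Sum>i<n. emeasure (cm i) (B \<inter> P i))"
        proof (intro sum.cong refl)
          fix i assume "i \<in> {..<n}"
          then have i: "i < n" by simp
          show "emeasure K (B \<inter> P i) = emeasure (cm i) (B \<inter> P i)" unfolding cm_def
            using B Pb[OF i] by (intro is_surface_measureD[OF K ch[OF i]]) (auto simp: P_def C_def)
        qed
        finally show ?thesis .
      qed
      show "emeasure N B = emeasure M B" using e[OF N] e[OF ism] by simp
    qed
  qed
qed

section \<open>Finiteness of the surface measure and integration in a chart\<close>

abbreviation S :: "(real^3) measure" where "S \<equiv> surface_measure \<Omega>"

lemma is_surface_measure: "is_surface_measure \<Omega> S"
proof -
  have "S = (THE M. is_surface_measure \<Omega> M)" by (simp add: surface_measure_def is_surface_measure_def)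
  then show ?thesis using theI'[OF ex1_surface_measure] by simp
qed

lemma sets_S [measurable_cong, simp]: "sets S = sets borel"
  using is_surface_measure by (simp add: is_surface_measure_def)

lemma space_S [simp]: "space S = UNIV"
  using sets_eq_imp_space_eq[OF sets_S] by simp

lemma S_frontier: "emeasure S (- frontier \<Omega>) = 0"
  using is_surface_measure by (simp add: is_surface_measure_def)

text \<open>The area density may be unbounded near the edge of the open set \<open>U\<close>; on a
  closed ball inside \<open>U\<close> compactness bounds it.\<close>

lemma S_locally_finite:
  assumes "x \<in> frontier \<Omega>"
  obtains V where "open V" "x \<in> V" "emeasure S V < \<infinity>"
proof -
  obtain A U a b \<phi> where "graph_chart \<Omega> A U a b \<phi>" "x \<in> graph_chart.cyl A U a b" using chart_at[OF assms] .
  then interpret graph_chart \<Omega> A U a b \<phi> by simp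
  have xc: "x \<in> cyl" by fact
  obtain y where y: "y \<in> U" "x = A (y, \<phi> y)" using frontier_cyl[OF open_Omega assms xc] .
  obtain r where r: "r > 0" "cball y r \<subseteq> U" using open_contains_cball open_U y by blast
  define V where "V = inv A -` (ball y r \<times> {a<..<b})"
  have V: "open V" unfolding V_def using cont_inv_A[of UNIV] by (intro open_vimage open_Times) auto
  have xV: "x \<in> V" using y r bounds by (simp add: V_def)
  have Vc: "V \<subseteq> cyl"
  proof
    fix x assume "x \<in> V"
    then have "inv A x \<in> ball y r \<times> {a<..<b}" by (simp add: V_def)
    then have "inv A x \<in> U \<times> {a<..<b}" using subsetD[OF r(2), of "fst (inv A x)"] by (auto simp: mem_Times_iff)
    then show "x \<in> cyl" unfolding cyl_def by (metis image_eqI inv_A(2))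
  qed
  obtain m where m0: "\<forall>t\<in>graph_density \<phi> ` cball y r. norm t \<le> m"
    using compact_imp_bounded[OF compact_continuous_image[OF continuous_on_subset[OF cont_density r(2)] compact_cball]]
    unfolding bounded_iff by blast
  have m: "graph_density \<phi> y' \<le> m" if "y' \<in> cball y r" for y'
    using bspec[OF m0 imageI[OF that]] by simp
  have "emeasure S V = (\<integral>\<^sup>+y\<in>U. indicator V (A (y, \<phi> y)) * ennreal (graph_density \<phi> y) \<partial>lborel)"
    using is_surface_measureD[OF is_surface_measure graph_chart_axioms _ Vc] V emeasure_chart_measure[OF cont_density] by simp
  also have "\<dots> \<le> (\<integral>\<^sup>+y'. ennreal m * indicator (cball y r) y' \<partial>lborel)"
  proof (rule nn_integral_mono)
    fix y'
    show "indicator V (A (y', \<phi> y')) * ennreal (graph_density \<phi> y') * indicator U y' \<le> ennreal m * indicator (cball y r) y'"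
    proof (cases "A (y', \<phi> y') \<in> V")
      case True
      then have "y' \<in> cball y r" by (auto simp: V_def)
      then show ?thesis using m[of y'] by (auto simp: indicator_def intro: ennreal_leI)
    qed simp
  qed
  also have "\<dots> = ennreal m * emeasure lborel (cball y r)" by (rule nn_integral_cmult_indicator) simp
  also have "\<dots> < \<infinity>" using emeasure_compact_finite[OF compact_cball[of y r]] by (simp add: ennreal_mult_less_top)
  finally show ?thesis using that[OF V xV] by simp
qed

lemma finite_S: "finite_measure S"
proof (rule finite_measureI)
  have "\<forall>x\<in>frontier \<Omega>. \<exists>V. open V \<and> x \<in> V \<and> emeasure S V < \<infinity>" using S_locally_finite by metis
  then obtain V where V: "\<And>x. x \<in> frontier \<Omega> \<Longrightarrow> open (V x) \<and> x \<in> V x \<and> emeasure S (V x) < \<infinity>" by metis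
  then have "frontier \<Omega> \<subseteq> (\<Union>x\<in>frontier \<Omega>. V x)" by auto
  then obtain T where T: "T \<subseteq> frontier \<Omega>" "finite T" "frontier \<Omega> \<subseteq> (\<Union>x\<in>T. V x)"
    using compactE_image[OF compact_frontier, of "frontier \<Omega>" V] V by metis
  have Vb: "(\<Union>x\<in>T. V x) \<in> sets borel" using T V by (intro borel_open open_UN) auto
  have "emeasure S UNIV \<le> emeasure S (\<Union>x\<in>T. V x) + emeasure S (- frontier \<Omega>)"
  proof -
    have "emeasure S UNIV \<le> emeasure S ((\<Union>x\<in>T. V x) \<union> - frontier \<Omega>)"
      using T(3) Vb by (intro emeasure_mono) auto
    also have "\<dots> \<le> emeasure S (\<Union>x\<in>T. V x) + emeasure S (- frontier \<Omega>)"
      using Vb by (intro emeasure_subadditive) auto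
    finally show ?thesis .
  qed
  also have "\<dots> \<le> (\<Sum>x\<in>T. emeasure S (V x))"
    unfolding S_frontier add_0_right using T V by (intro emeasure_subadditive_finite) auto
  also have "\<dots> < \<infinity>" using T V by (auto simp: ennreal_sum_less_top)
  finally show "emeasure S (space S) \<noteq> \<infinity>" by simp
qed

text \<open>\<open>S\<close> and the chart measure agree on Borel subsets of the cylinder, so their
  restrictions to it are the same measure; the support condition on \<open>h\<close> makes the
  restriction harmless.\<close>

lemma integral_chart:
  fixes h :: "real^3 \<Rightarrow> 'b::euclidean_space"
  assumes "graph_chart \<Omega> A U a b \<phi>" and [measurable]: "h \<in> borel_measurable borel"
    and h0: "\<And>x. x \<notin> graph_chart.cyl A U a b \<Longrightarrow> h x = 0"
  shows "(LINT x|S. h x) = (LINT y|lborel. indicator U y *\<^sub>R (graph_density \<phi> y *\<^sub>R h (A (y, \<phi> y))))"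
proof -
  interpret graph_chart \<Omega> A U a b \<phi> by fact
  have [measurable]: "cyl \<in> sets borel" using open_cyl by simp
  have [measurable]: "(\<lambda>y. indicator U y * graph_density \<phi> y) \<in> borel_measurable borel"
    using borel_measurable_continuous_on_indicator[OF _ cont_density] open_U by simp
  let ?N = "chart_measure A U \<phi> (graph_density \<phi>)"
  have "density S (indicator cyl) = density ?N (indicator cyl)"
  proof (rule measure_eqI)
    fix B assume "B \<in> sets (density S (indicator cyl))"
    then have B: "B \<in> sets borel" by simp
    show "emeasure (density S (indicator cyl)) B = emeasure (density ?N (indicator cyl)) B"
      using B is_surface_measureD[OF is_surface_measure graph_chart_axioms, of "cyl \<inter> B"]
      by (simp add: emeasure_density indicator_inter_arith[symmetric])
  qed simp
  then have eq: "density S (\<lambda>x. ennreal (indicator cyl x)) = density ?N (\<lambda>x. ennreal (indicator cyl x))"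
    by (simp add: ennreal_indicator)
  have "(LINT x|S. h x) = (LINT x|S. indicator cyl x *\<^sub>R h x)"
    using h0 by (intro Bochner_Integration.integral_cong refl) (auto simp: indicator_def)
  also have "\<dots> = (LINT x|density S (\<lambda>x. ennreal (indicator cyl x)). h x)"
    by (subst integral_density) simp_all
  also have "\<dots> = (LINT x|?N. indicator cyl x *\<^sub>R h x)"
    unfolding eq by (subst integral_density) simp_all
  also have "\<dots> = (LINT x|?N. h x)"
    using h0 by (intro Bochner_Integration.integral_cong refl) (auto simp: indicator_def)
  also have "\<dots> = (LINT y|density lborel (\<lambda>y. ennreal (indicator U y * graph_density \<phi> y)). h (indicator U y *\<^sub>R A (y, \<phi> y)))"
    unfolding chart_measure_def by (subst integral_distr) simp_all
  also have "\<dots> = (LINT y|lborel. (indicator U y * graph_density \<phi> y) *\<^sub>R h (indicator U y *\<^sub>R A (y, \<phi> y)))"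
    using graph_density_pos(1) by (subst integral_density) (auto simp: less_imp_le)
  also have "\<dots> = (LINT y|lborel. indicator U y *\<^sub>R (graph_density \<phi> y *\<^sub>R h (A (y, \<phi> y))))"
    by (intro Bochner_Integration.integral_cong refl) (auto simp: indicator_def)
  finally show ?thesis .
qed

text \<open>Continuity is local, and near each frontier point the normal is given on the frontier by
  the continuous formula of one chart.\<close>

lemma continuous_outward_normal: "continuous_on (frontier \<Omega>) (outward_normal \<Omega>)"
  unfolding continuous_on_def
proof
  fix x assume x: "x \<in> frontier \<Omega>"
  obtain A U a b \<phi> where "graph_chart \<Omega> A U a b \<phi>" "x \<in> graph_chart.cyl A U a b" using chart_at[OF x] .
  then interpret graph_chart \<Omega> A U a b \<phi> by simp
  have xc: "x \<in> cyl" by fact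
  define n where "n x = (1 / graph_density \<phi> (fst (inv A x))) *\<^sub>R graph_normal A \<phi> (fst (inv A x))" for x
  have eq: "n z = outward_normal \<Omega> z" if z: "z \<in> frontier \<Omega>" "z \<in> cyl" for z
  proof -
    obtain y where y: "y \<in> U" "z = A (y, \<phi> y)" using frontier_cyl[OF open_Omega z] .
    then show ?thesis using outward_normal_eq[OF y(1)] by (simp add: n_def)
  qed
  have "continuous_on cyl n" unfolding n_def[abs_def] using graph_density_pos(1)
    by (intro continuous_intros continuous_on_compose2[OF cont_density] continuous_on_compose2[OF cont_graph_normal] cont_inv_A)
      (auto simp: cyl_def less_imp_neq[THEN not_sym])
  then have "(n \<longlongrightarrow> n x) (at x within frontier \<Omega>)"
    using xc open_cyl by (meson continuous_at continuous_on_eq_continuous_at tendsto_within_subset top_greatest)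
  moreover have "\<forall>\<^sub>F z in at x within frontier \<Omega>. n z = outward_normal \<Omega> z"
    unfolding eventually_at_topological using open_cyl xc eq by blast
  ultimately have "(outward_normal \<Omega> \<longlongrightarrow> n x) (at x within frontier \<Omega>)"
    by (rule Lim_transform_eventually)
  then show "(outward_normal \<Omega> \<longlongrightarrow> outward_normal \<Omega> x) (at x within frontier \<Omega>)"
    using eq[OF x xc] by simp
qed

lemma norm_outward_normal:
  assumes x: "x \<in> frontier \<Omega>"
  shows "norm (outward_normal \<Omega> x) = 1"
proof -
  obtain A U a b \<phi> where "graph_chart \<Omega> A U a b \<phi>" "x \<in> graph_chart.cyl A U a b" using chart_at[OF x] .
  then interpret graph_chart \<Omega> A U a b \<phi> by simp
  have xc: "x \<in> cyl" by fact
  obtain y where y: "y \<in> U" "x = A (y, \<phi> y)" using frontier_cyl[OF open_Omega x xc] .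
  show ?thesis using outward_normal_eq[OF y(1)] graph_density_pos(1)[of y] y(2) by (simp add: norm_graph_normal)
qed

text \<open>Off the frontier no chart determines \<open>outward_normal\<close>, hence the indicator;
  on the closed frontier the normal is continuous.\<close>

lemma meas_boundary:
  fixes f :: "real^3 \<Rightarrow> 'b::euclidean_space"
  assumes "continuous_on UNIV f"
  shows "(\<lambda>x. indicator (frontier \<Omega>) x *\<^sub>R ((e \<bullet> outward_normal \<Omega> x) *\<^sub>R f x)) \<in> borel_measurable borel"
  by (rule borel_measurable_continuous_on_indicator)
    (auto intro!: continuous_intros continuous_outward_normal continuous_on_subset[OF assms])

lemma integrable_S_bounded:
  fixes h :: "real^3 \<Rightarrow> 'b::euclidean_space"
  assumes "h \<in> borel_measurable borel" "\<And>x. norm (h x) \<le> B"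
  shows "integrable S h"
  using assms by (intro finite_measure.integrable_const_bound[OF finite_S, of _ B]) simp_all

lemma integrable_boundary:
  fixes f :: "real^3 \<Rightarrow> 'b::euclidean_space"
  assumes f: "continuous_on UNIV f"
  shows "integrable S (\<lambda>x. indicator (frontier \<Omega>) x *\<^sub>R ((e \<bullet> outward_normal \<Omega> x) *\<^sub>R f x))"
proof -
  obtain B where B: "\<And>x. x \<in> frontier \<Omega> \<Longrightarrow> norm (f x) \<le> B"
    using compact_imp_bounded[OF compact_continuous_image[OF continuous_on_subset[OF f] compact_frontier]]
    by (auto simp: bounded_iff)
  show ?thesis
  proof (rule integrable_S_bounded[OF meas_boundary[OF f], of _ "norm e * \<bar>B\<bar>"])
    fix x
    show "norm (indicator (frontier \<Omega>) x *\<^sub>R (e \<bullet> outward_normal \<Omega> x) *\<^sub>R f x) \<le> norm e * \<bar>B\<bar>"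
    proof (cases "x \<in> frontier \<Omega>")
      case True
      have "\<bar>e \<bullet> outward_normal \<Omega> x\<bar> \<le> norm e"
        using Cauchy_Schwarz_ineq2[of e "outward_normal \<Omega> x"] norm_outward_normal[OF True] by simp
      then have "\<bar>e \<bullet> outward_normal \<Omega> x\<bar> * norm (f x) \<le> norm e * \<bar>B\<bar>"
        using B[OF True] by (intro mult_mono) auto
      then show ?thesis using True by simp
    qed simp
  qed
qed

section \<open>Gauss's theorem, localised and glued\<close>

text \<open>Gauss's formula for the field \<open>f\<close> times the constant vector
  \<open>e\<close>; \<open>f\<close> may be vector-valued.\<close>

definition div_thm :: "real^3 \<Rightarrow> (real^3 \<Rightarrow> 'b::euclidean_space) \<Rightarrow> (real^3 \<Rightarrow> real^3 \<Rightarrow> 'b) \<Rightarrow> bool" where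
  "div_thm e f f' \<longleftrightarrow> (LINT x|lborel. indicator \<Omega> x *\<^sub>R f' x e) =
     (LINT x|S. indicator (frontier \<Omega>) x *\<^sub>R ((e \<bullet> outward_normal \<Omega> x) *\<^sub>R f x))"

text \<open>Around an interior point both sides are 0; around a frontier point a ball inside one
  cylinder reduces the claim to that chart. The radius does not depend on \<open>f\<close>, which
  allows a finite cover to be fixed before \<open>f\<close> is cut into pieces.\<close>

lemma div_thm_local:
  assumes "x \<in> closure \<Omega>"
  obtains r where "r > 0" "\<And>(f :: real^3 \<Rightarrow> 'b::euclidean_space) f'. C1_deriv f f' \<Longrightarrow> (\<And>z. z \<notin> cball x r \<Longrightarrow> f z = 0) \<Longrightarrow> div_thm e f f'"
proof (cases "x \<in> \<Omega>")
  case True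
  then obtain r where r: "r > 0" "cball x r \<subseteq> \<Omega>" using open_Omega open_contains_cball by blast
  show ?thesis
  proof (rule that[OF r(1)])
    fix f :: "real^3 \<Rightarrow> 'b" and f'
    assume f: "C1_deriv f f'" and f0: "\<And>z. z \<notin> cball x r \<Longrightarrow> f z = 0"
    have z: "f' y w = 0" if "y \<notin> cball x r" for y w
      using derivative_zero_outside[OF C1_derivD(1)[OF f] closed_cball f0 that] .
    have "(LINT x|lborel. indicator \<Omega> x *\<^sub>R f' x e) = (LINT x|lborel. f' x e)"
    proof (intro Bochner_Integration.integral_cong refl)
      fix y show "indicator \<Omega> y *\<^sub>R f' y e = f' y e"
        using z[of y e] subsetD[OF r(2), of y] by (cases "y \<in> \<Omega>") auto
    qed
    also have "\<dots> = 0"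
      by (rule integral_derivative_compact_support[OF C1_derivD(1)[OF f] C1_derivD(2)[OF f] compact_cball f0])
    also have "(0::'b) = (LINT x|S. 0)" by simp
    also have "\<dots> = (LINT x|S. indicator (frontier \<Omega>) x *\<^sub>R ((e \<bullet> outward_normal \<Omega> x) *\<^sub>R f x))"
    proof (intro Bochner_Integration.integral_cong refl)
      fix z
      have "z \<in> frontier \<Omega> \<Longrightarrow> z \<notin> cball x r" using r(2) open_Omega by (auto simp: frontier_def interior_open)
      then show "(0::'b) = indicator (frontier \<Omega>) z *\<^sub>R ((e \<bullet> outward_normal \<Omega> z) *\<^sub>R f z)"
        using f0 by (auto simp: indicator_def)
    qed
    finally show "div_thm e f f'" by (simp add: div_thm_def)
  qed
next
  case False
  then have x: "x \<in> frontier \<Omega>" using assms open_Omega by (simp add: frontier_def interior_open)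
  obtain A U a b \<phi> where "graph_chart \<Omega> A U a b \<phi>" "x \<in> graph_chart.cyl A U a b" using chart_at[OF x] .
  then interpret graph_chart \<Omega> A U a b \<phi> by simp
  have xc: "x \<in> cyl" by fact
  then obtain r where r: "r > 0" "cball x r \<subseteq> cyl" using open_cyl open_contains_cball by blast
  show ?thesis
  proof (rule that[OF r(1)])
    fix f :: "real^3 \<Rightarrow> 'b" and f'
    assume f: "C1_deriv f f'" and f0: "\<And>z. z \<notin> cball x r \<Longrightarrow> f z = 0"
    have "(LINT x|S. indicator (frontier \<Omega>) x *\<^sub>R ((e \<bullet> outward_normal \<Omega> x) *\<^sub>R f x)) =
      (LINT y|lborel. indicator U y *\<^sub>R (graph_density \<phi> y *\<^sub>R
        (indicator (frontier \<Omega>) (A (y, \<phi> y)) *\<^sub>R ((e \<bullet> outward_normal \<Omega> (A (y, \<phi> y))) *\<^sub>R f (A (y, \<phi> y))))))"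
      by (rule integral_chart[OF graph_chart_axioms meas_boundary[OF C1_derivD(3)[OF f]]])
        (use f0 subsetD[OF r(2)] in force)
    also have "\<dots> = (LINT y|lborel. indicator U y *\<^sub>R ((e \<bullet> graph_normal A \<phi> y) *\<^sub>R f (A (y, \<phi> y))))"
    proof (intro Bochner_Integration.integral_cong refl)
      fix y
      show "indicator U y *\<^sub>R (graph_density \<phi> y *\<^sub>R
        (indicator (frontier \<Omega>) (A (y, \<phi> y)) *\<^sub>R ((e \<bullet> outward_normal \<Omega> (A (y, \<phi> y))) *\<^sub>R f (A (y, \<phi> y))))) =
        indicator U y *\<^sub>R ((e \<bullet> graph_normal A \<phi> y) *\<^sub>R f (A (y, \<phi> y)))"
        using frontier_graph(1)[OF open_Omega, of y] outward_normal_eq[of y] graph_density_pos(1)[of y]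
        by (cases "y \<in> U") auto
    qed
    also have "\<dots> = (LINT x|lborel. indicator \<Omega> x *\<^sub>R f' x e)"
      by (rule chart_divergence[OF open_Omega f compact_cball r(2) f0, symmetric])
    finally show "div_thm e f f'" by (simp add: div_thm_def)
  qed
qed

theorem divergence_theorem:
  fixes f :: "real^3 \<Rightarrow> 'b::euclidean_space"
  assumes f: "C1_deriv f f'"
  shows "(LINT x|lborel. indicator \<Omega> x *\<^sub>R f' x e) =
     (LINT x|S. indicator (frontier \<Omega>) x *\<^sub>R ((e \<bullet> outward_normal \<Omega> x) *\<^sub>R f x))"
proof -
  have cc: "compact (closure \<Omega>)" using bounded_Omega by (simp add: compact_closure)
  have "\<forall>x\<in>closure \<Omega>. \<exists>r. r > 0 \<and> (\<forall>(f :: real^3 \<Rightarrow> 'b) f'. C1_deriv f f' \<longrightarrow> (\<forall>z. z \<notin> cball x r \<longrightarrow> f z = 0) \<longrightarrow> div_thm e f f')"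
    using div_thm_local[of _ e] by metis
  then obtain r where r: "\<And>x. x \<in> closure \<Omega> \<Longrightarrow> r x > 0"
    and loc: "\<And>x (f :: real^3 \<Rightarrow> 'b) f'. x \<in> closure \<Omega> \<Longrightarrow> C1_deriv f f' \<Longrightarrow> (\<And>z. z \<notin> cball x (r x) \<Longrightarrow> f z = 0) \<Longrightarrow> div_thm e f f'"
    by metis
  have "closure \<Omega> \<subseteq> (\<Union>x\<in>closure \<Omega>. ball x (r x))" using r by force
  then obtain X where X: "X \<subseteq> closure \<Omega>" "finite X" "closure \<Omega> \<subseteq> (\<Union>x\<in>X. ball x (r x))"
    using compactE_image[OF cc, of "closure \<Omega>" "\<lambda>x. ball x (r x)"] by auto
  define s where "s z = (\<Sum>x\<in>X. bump x (r x) z)" for z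
  define s' where "s' z h = (\<Sum>x\<in>X. bump_deriv x (r x) z h)" for z h
  have s: "C1_deriv s s'" unfolding C1_deriv_def s_def s'_def
    by (intro conjI allI continuous_intros derivative_intros C1_derivD(1,2)[OF bump_C1])
  have spos: "s z > 0" if z: "z \<in> closure \<Omega>" for z
  proof -
    obtain x where x: "x \<in> X" "z \<in> ball x (r x)" using X(3) z by auto
    then have "r x > 0" using X r by auto
    then have "bump x (r x) z > 0" using x bump_pos(2) by blast
    then show ?thesis unfolding s_def using x X by (intro sum_pos2[of _ x]) (auto simp: bump_pos)
  qed
  \<comment> \<open>Compactness gives a positive minimum of \<open>s\<close>; the value 1 serves the
    empty closure.\<close>
  obtain \<epsilon> where \<epsilon>: "\<epsilon> > 0" "\<And>z. z \<in> closure \<Omega> \<Longrightarrow> s z \<ge> \<epsilon>"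
  proof (cases "closure \<Omega> = {}")
    case True
    then show ?thesis using that[of 1] by auto
  next
    case False
    obtain z where "z \<in> closure \<Omega>" "\<And>y. y \<in> closure \<Omega> \<Longrightarrow> s z \<le> s y"
      using continuous_attains_inf[OF cc False C1_derivD(3)[OF s]] by blast
    then show ?thesis using that[of "s z"] spos by auto
  qed
  \<comment> \<open>\<open>\<zeta>\<close> is \<open>C\<^sup>1\<close> on the whole line and equals \<open>1 / t\<close> for \<open>t \<ge> \<epsilon>\<close>; hence the functions
    \<open>bump x (r x) y * \<zeta> (s y)\<close> form a partition of unity on \<open>closure \<Omega>\<close>.\<close>
  define \<zeta> where "\<zeta> t = t / (t\<^sup>2 + (max 0 (\<epsilon> - t))\<^sup>2)" for t
  define \<zeta>' where "\<zeta>' t = ((t\<^sup>2 + (max 0 (\<epsilon> - t))\<^sup>2) - t * (2 * t - 2 * max 0 (\<epsilon> - t))) / (t\<^sup>2 + (max 0 (\<epsilon> - t))\<^sup>2)\<^sup>2" for t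
  have den: "t\<^sup>2 + (max 0 (\<epsilon> - t))\<^sup>2 > 0" for t
    using \<epsilon>(1) by (cases "t = 0") (auto simp: add_pos_nonneg)
  have d\<zeta>: "(\<zeta> has_real_derivative \<zeta>' t) (at t)" for t
  proof -
    have "((\<lambda>t. (max 0 (\<epsilon> - t))\<^sup>2) has_real_derivative (2 * max 0 (\<epsilon> - t)) * (- 1)) (at t)"
      by (rule DERIV_chain2[OF DERIV_max_sq]) (auto intro!: derivative_eq_intros)
    then have "((\<lambda>t. t\<^sup>2 + (max 0 (\<epsilon> - t))\<^sup>2) has_real_derivative 2 * t - 2 * max 0 (\<epsilon> - t)) (at t)"
      using DERIV_add[OF DERIV_power[OF DERIV_ident, of 2]] by fastforce
    from DERIV_divide[OF DERIV_ident this less_imp_neq[OF den, THEN not_sym]] show ?thesis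
      unfolding \<zeta>_def[abs_def] \<zeta>'_def by (simp add: power2_eq_square)
  qed
  have c\<zeta>': "continuous_on T \<zeta>'" for T unfolding \<zeta>'_def[abs_def]
    by (intro continuous_intros ballI power_not_zero less_imp_neq[OF den, THEN not_sym])
  have z: "C1_deriv (\<lambda>x. \<zeta> (s x)) (\<lambda>x h. \<zeta>' (s x) * s' x h)"
    by (rule C1_deriv_real_compose[OF s d\<zeta> c\<zeta>'])
  have zs: "\<zeta> (s x) * s x = 1" if "x \<in> closure \<Omega>" for x
    using \<epsilon>(2)[OF that] \<epsilon>(1) by (simp add: \<zeta>_def power2_eq_square)
  define g where "g x y = bump x (r x) y *\<^sub>R (\<zeta> (s y) *\<^sub>R f y)" for x y
  define g' where "g' x y h = bump x (r x) y *\<^sub>R (\<zeta> (s y) *\<^sub>R f' y h + (\<zeta>' (s y) * s' y h) *\<^sub>R f y) +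
     bump_deriv x (r x) y h *\<^sub>R (\<zeta> (s y) *\<^sub>R f y)" for x y h
  have g: "C1_deriv (g x) (g' x)" for x unfolding g_def[abs_def] g'_def[abs_def]
    by (rule C1_deriv_scaleR[OF bump_C1 C1_deriv_scaleR[OF z f]])
  have g0: "g x z = 0" if "x \<in> X" "z \<notin> cball x (r x)" for x z
    using that bump_pos(3)[of "r x" z x] r X by (auto simp: g_def)
  have g'0: "g' x z h = 0" if "x \<in> X" "z \<notin> cball x (r x)" for x z h
    using derivative_zero_outside[OF C1_derivD(1)[OF g] closed_cball g0[OF that(1)] that(2)] .
  have sum_g: "(\<Sum>x\<in>X. g x y) = f y" if "y \<in> closure \<Omega>" for y
  proof -
    have "(\<Sum>x\<in>X. g x y) = (s y * \<zeta> (s y)) *\<^sub>R f y" by (simp add: g_def s_def scaleR_sum_left sum_distrib_right)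
    then show ?thesis using zs[OF that] by (simp add: mult.commute)
  qed
  \<comment> \<open>The pieces add up to \<open>f\<close> only on the closure of \<Omega>. As
    \<Omega> is open, this still determines the derivative at its points.\<close>
  have sum_g': "(\<Sum>x\<in>X. g' x y e) = f' y e" if y: "y \<in> \<Omega>" for y
  proof -
    have "((\<lambda>y. \<Sum>x\<in>X. g x y) has_derivative (\<lambda>h. \<Sum>x\<in>X. g' x y h)) (at y)"
      by (intro has_derivative_sum C1_derivD(1)[OF g])
    then have "(f has_derivative (\<lambda>h. \<Sum>x\<in>X. g' x y h)) (at y)"
      by (rule has_derivative_transform_within_open[OF _ open_Omega y]) (use sum_g closure_subset in blast)
    then show ?thesis using has_derivative_unique[OF C1_derivD(1)[OF f]] by (metis (no_types))
  qed
  have "(LINT x|lborel. indicator \<Omega> x *\<^sub>R f' x e) = (LINT y|lborel. (\<Sum>x\<in>X. indicator \<Omega> y *\<^sub>R g' x y e))"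
    by (intro Bochner_Integration.integral_cong refl) (auto simp add: scaleR_sum_right[symmetric] indicator_def sum_g')
  also have "\<dots> = (\<Sum>x\<in>X. (LINT y|lborel. indicator \<Omega> y *\<^sub>R g' x y e))"
  proof (rule Bochner_Integration.integral_sum)
    fix x assume "x \<in> X"
    then have "integrable lborel (\<lambda>y. g' x y e)"
      by (intro integrable_compact_support[OF C1_derivD(2)[OF g] compact_cball g'0])
    then show "integrable lborel (\<lambda>y. indicator \<Omega> y *\<^sub>R g' x y e)"
      using open_Omega by (intro integrable_mult_indicator) auto
  qed
  also have "\<dots> = (\<Sum>x\<in>X. (LINT y|S. indicator (frontier \<Omega>) y *\<^sub>R ((e \<bullet> outward_normal \<Omega> y) *\<^sub>R g x y)))"
  proof (intro sum.cong refl)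
    fix x assume x: "x \<in> X"
    then have "div_thm e (g x) (g' x)" using X(1) by (intro loc[OF _ g g0]) auto
    then show "(LINT y|lborel. indicator \<Omega> y *\<^sub>R g' x y e) =
      (LINT y|S. indicator (frontier \<Omega>) y *\<^sub>R ((e \<bullet> outward_normal \<Omega> y) *\<^sub>R g x y))" by (simp add: div_thm_def)
  qed
  also have "\<dots> = (LINT y|S. (\<Sum>x\<in>X. indicator (frontier \<Omega>) y *\<^sub>R ((e \<bullet> outward_normal \<Omega> y) *\<^sub>R g x y)))"
    by (rule Bochner_Integration.integral_sum[symmetric]) (rule integrable_boundary[OF C1_derivD(3)[OF g]])
  also have "\<dots> = (LINT x|S. indicator (frontier \<Omega>) x *\<^sub>R ((e \<bullet> outward_normal \<Omega> x) *\<^sub>R f x))"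
  proof (intro Bochner_Integration.integral_cong refl)
    fix y
    show "(\<Sum>x\<in>X. indicator (frontier \<Omega>) y *\<^sub>R ((e \<bullet> outward_normal \<Omega> y) *\<^sub>R g x y)) =
      indicator (frontier \<Omega>) y *\<^sub>R ((e \<bullet> outward_normal \<Omega> y) *\<^sub>R f y)"
      using sum_g[of y] by (cases "y \<in> frontier \<Omega>") (simp_all add: scaleR_sum_right[symmetric] frontier_def)
  qed
  finally show ?thesis .
qed

end

section \<open>The boundary form\<close>

text \<open>On a set of finite measure L^2 convergence implies L^1 convergence; here it is
  transferred to integrands \<open>b n\<close> that differ from \<open>a\<close> by at most
  \<open>C\<close> times an L^2 null sequence.\<close>

lemma set_integral_L2_limit:
  fixes a :: "'x \<Rightarrow> complex" and g :: "'x \<Rightarrow> 'b::euclidean_space"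
  assumes S: "S \<in> sets M" "emeasure M S < \<infinity>" and C: "C \<ge> 0"
    and meas: "\<And>n. set_borel_measurable M S (\<lambda>x. h n x - g x)"
    and i: "\<And>n. set_integrable M S (b n)" "set_integrable M S a"
    and bd: "\<And>n x. x \<in> S \<Longrightarrow> norm (b n x - a x) \<le> C * norm (h n x - g x)"
    and lim: "(\<lambda>n. \<integral>\<^sup>+x\<in>S. ennreal ((norm (h n x - g x))\<^sup>2) \<partial>M) \<longlonglongrightarrow> 0"
  shows "(\<lambda>n. LINT x:S|M. b n x) \<longlonglongrightarrow> (LINT x:S|M. a x)"
proof (rule LIMSEQ_I)
  fix \<delta> :: real assume \<delta>: "\<delta> > 0"
  define I where "I n = (\<integral>\<^sup>+x\<in>S. ennreal ((norm (h n x - g x))\<^sup>2) \<partial>M)" for n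
  define m where "m = measure M S"
  \<comment> \<open>Makes \<open>C * \<epsilon> * m\<close> at most half of \<delta>; the summand 1
    keeps the denominator positive.\<close>
  define \<epsilon> where "\<epsilon> = \<delta> / (2 * (C * m + 1))"
  have Cm: "C * m + 1 > 0" using C by (simp add: m_def add_nonneg_pos)
  have \<epsilon>: "\<epsilon> > 0" using \<delta> Cm by (simp add: \<epsilon>_def)
  \<comment> \<open>From \<open>t \<le> \<epsilon> + t\<^sup>2 / \<epsilon>\<close>.\<close>
  have key: "norm ((LINT x:S|M. b n x) - (LINT x:S|M. a x)) \<le> C * \<epsilon> * m + C / \<epsilon> * enn2real (I n)" if fin: "I n < \<infinity>" for n
  proof -
    define q where "q x = (norm (indicator S x *\<^sub>R (h n x - g x)))\<^sup>2" for x
    have qm: "q \<in> borel_measurable M" unfolding q_def[abs_def] using meas[of n] unfolding set_borel_measurable_def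
      by measurable
    have qI: "(\<integral>\<^sup>+x. ennreal (q x) \<partial>M) = I n"
      unfolding I_def q_def by (intro nn_integral_cong) (auto simp: indicator_def)
    have qi: "integrable M q"
      using fin qI qm by (intro integrableI_nonneg) (auto simp: q_def)
    have qL: "(LINT x|M. q x) = enn2real (I n)"
      unfolding qI[symmetric] by (rule integral_eq_nn_integral) (use qm in \<open>simp_all add: q_def[symmetric], simp_all add: q_def\<close>)
    have iS: "integrable M (indicator S :: 'x \<Rightarrow> real)" using S by simp
    have "(LINT x:S|M. b n x) - (LINT x:S|M. a x) = (LINT x:S|M. b n x - a x)"
      using i by (simp add: set_integral_diff)
    also have "norm \<dots> \<le> (LINT x|M. norm (indicator S x *\<^sub>R (b n x - a x)))"
      unfolding set_lebesgue_integral_def by (rule integral_norm_bound)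
    also have "\<dots> \<le> (LINT x|M. C * \<epsilon> * indicator S x + C / \<epsilon> * q x)"
    proof (rule integral_mono)
      show "integrable M (\<lambda>x. norm (indicator S x *\<^sub>R (b n x - a x)))"
        using set_integral_diff(1)[OF i(1) i(2)] unfolding set_integrable_def by (rule integrable_norm)
      show "integrable M (\<lambda>x. C * \<epsilon> * indicator S x + C / \<epsilon> * q x)"
        by (intro Bochner_Integration.integrable_add integrable_mult_right iS qi)
      fix x
      show "norm (indicator S x *\<^sub>R (b n x - a x)) \<le> C * \<epsilon> * indicator S x + C / \<epsilon> * q x"
      proof (cases "x \<in> S")
        case True
        let ?t = "norm (h n x - g x)"
        have "0 \<le> (?t - \<epsilon>)\<^sup>2" by simp
        then have "2 * (?t * \<epsilon>) \<le> ?t\<^sup>2 + \<epsilon>\<^sup>2" by (simp add: power2_diff algebra_simps)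
        moreover have "0 \<le> ?t * \<epsilon>" using \<epsilon> by simp
        ultimately have "?t * \<epsilon> \<le> \<epsilon> * \<epsilon> + ?t\<^sup>2" by (simp add: power2_eq_square[of \<epsilon>])
        then have "?t \<le> \<epsilon> + ?t\<^sup>2 / \<epsilon>" using \<epsilon> by (simp add: field_simps)
        then have "C * ?t \<le> C * (\<epsilon> + ?t\<^sup>2 / \<epsilon>)" using C by (rule mult_left_mono)
        then show ?thesis using bd[OF True, of n] True by (simp add: q_def distrib_left)
      qed (simp add: q_def)
    qed
    also have "\<dots> = C * \<epsilon> * m + C / \<epsilon> * enn2real (I n)"
      using iS qi S by (simp add: qL m_def)
    finally show ?thesis .
  qed
  have "(\<lambda>n. enn2real (I n)) \<longlonglongrightarrow> 0"
    using tendsto_enn2real[of I 0 sequentially] lim by (simp add: I_def[abs_def])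
  then have l2: "\<forall>\<^sub>F n in sequentially. enn2real (I n) < \<delta> * \<epsilon> / (2 * (C + 1))"
    by (rule order_tendstoD(2)) (use \<delta> \<epsilon> C in simp)
  \<comment> \<open>Finiteness has to be secured separately, because \<open>enn2real\<close> sends
    infinity to 0.\<close>
  have "\<forall>\<^sub>F n in sequentially. I n < 1" using order_tendstoD(2)[OF lim, of 1] by (simp add: I_def)
  then have fin: "\<forall>\<^sub>F n in sequentially. I n < \<infinity>"
    by eventually_elim (metis ennreal_one_less_top infinity_ennreal_def less_trans)
  have "\<forall>\<^sub>F n in sequentially. norm ((LINT x:S|M. b n x) - (LINT x:S|M. a x)) < \<delta>"
    using l2 fin
  proof eventually_elim
    case (elim n)
    have "C / \<epsilon> * enn2real (I n) \<le> C / \<epsilon> * (\<delta> * \<epsilon> / (2 * (C + 1)))"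
      using C \<epsilon> by (intro mult_left_mono less_imp_le[OF elim(1)]) simp
    also have "\<dots> = \<delta> / 2 * (C / (C + 1))" using \<epsilon> by (simp add: field_simps)
    also have "\<dots> < \<delta> / 2 * 1" using C \<delta> by (intro mult_strict_left_mono) auto
    finally have 1: "C / \<epsilon> * enn2real (I n) < \<delta> / 2" by simp
    have "C * \<epsilon> * m = \<delta> / 2 * ((C * m) / (C * m + 1))" by (simp add: \<epsilon>_def)
    also have "\<dots> \<le> \<delta> / 2 * 1" using C Cm \<delta> by (intro mult_left_mono) (auto simp: m_def)
    finally have "C * \<epsilon> * m \<le> \<delta> / 2" by simp
    then show ?case using key[OF elim(2)] 1 by linarith
  qed
  then show "\<exists>no. \<forall>n\<ge>no. norm ((LINT x:S|M. b n x) - (LINT x:S|M. a x)) < \<delta>"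
    by (simp add: eventually_sequentially)
qed

text \<open>From \<open>t \<le> 1 + t\<^sup>2\<close>, where the constant is integrable because
  \<open>S\<close> has finite measure.\<close>

lemma square_integrable_imp_integrable:
  fixes f :: "'x \<Rightarrow> 'b::euclidean_space"
  assumes S: "S \<in> sets M" "emeasure M S < \<infinity>" and f: "set_borel_measurable M S f"
    and i: "set_integrable M S (\<lambda>x. (norm (f x))\<^sup>2)"
  shows "set_integrable M S f"
  unfolding set_integrable_def
proof (rule Bochner_Integration.integrable_bound)
  show "integrable M (\<lambda>x. indicator S x + indicator S x *\<^sub>R (norm (f x))\<^sup>2)"
    using i S unfolding set_integrable_def by (intro Bochner_Integration.integrable_add) auto
  show "(\<lambda>x. indicator S x *\<^sub>R f x) \<in> borel_measurable M" using f by (simp add: set_borel_measurable_def)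
  have "t \<le> 1 + t\<^sup>2" if "t \<ge> 0" for t :: real
    using sum_squares_bound[of t 1] that by simp
  then show "AE x in M. norm (indicator S x *\<^sub>R f x) \<le> norm (indicator S x + indicator S x *\<^sub>R (norm (f x))\<^sup>2)"
    by (auto simp: indicator_def)
qed

lemma set_integrable_bounded_mult:
  fixes f h :: "'x \<Rightarrow> complex"
  assumes f: "set_integrable M S f" and h: "set_borel_measurable M S h" and B: "\<And>x. x \<in> S \<Longrightarrow> norm (h x) \<le> B"
  shows "set_integrable M S (\<lambda>x. h x * f x)"
  unfolding set_integrable_def
proof (rule Bochner_Integration.integrable_bound)
  show "integrable M (\<lambda>x. B *\<^sub>R (indicator S x *\<^sub>R f x))"
    using f unfolding set_integrable_def by (intro integrable_scaleR_right)
  have "(\<lambda>x. (indicator S x *\<^sub>R h x) * (indicator S x *\<^sub>R f x)) \<in> borel_measurable M"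
    using f h unfolding set_integrable_def set_borel_measurable_def by (intro borel_measurable_times) auto
  moreover have "(\<lambda>x. (indicator S x *\<^sub>R h x) * (indicator S x *\<^sub>R f x)) = (\<lambda>x. indicator S x *\<^sub>R (h x * f x))"
    by (auto simp: fun_eq_iff indicator_def)
  ultimately show "(\<lambda>x. indicator S x *\<^sub>R (h x * f x)) \<in> borel_measurable M" by simp
  show "AE x in M. norm (indicator S x *\<^sub>R (h x * f x)) \<le> norm (B *\<^sub>R (indicator S x *\<^sub>R f x))"
  proof (rule AE_I2)
    fix x
    show "norm (indicator S x *\<^sub>R (h x * f x)) \<le> norm (B *\<^sub>R (indicator S x *\<^sub>R f x))"
      using B[of x] by (cases "x \<in> S") (auto simp: norm_mult intro!: mult_right_mono)
  qed
qed

lemma continuous_set_borel_measurable_lebesgue: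
  fixes f :: "'a::euclidean_space \<Rightarrow> 'b::euclidean_space"
  assumes "continuous_on UNIV f" "S \<in> sets lebesgue"
  shows "set_borel_measurable lebesgue S f"
proof -
  have "f \<in> borel_measurable lebesgue"
    using measurable_completion[of f lborel borel] borel_measurable_continuous_onI[OF assms(1)] by simp
  then show ?thesis unfolding set_borel_measurable_def using assms(2) by measurable
qed

lemma bdot_axis_sum: "bdot (cvec n) z = (\<Sum>j\<in>UNIV. (axis j 1 \<bullet> n) *\<^sub>R z $ j)"
  by (simp add: bdot_def cvec_def inner_axis' scaleR_conv_of_real)

lemma norm_bdot_le: "cmod (bdot a b) \<le> norm a * (\<Sum>j\<in>UNIV. cmod (b $ j))"
proof -
  have "cmod (bdot a b) \<le> (\<Sum>j\<in>UNIV. cmod (a $ j * b $ j))" unfolding bdot_def by (rule norm_sum)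
  also have "\<dots> \<le> (\<Sum>j\<in>UNIV. norm a * cmod (b $ j))"
    by (intro sum_mono) (simp add: norm_mult mult_right_mono component_le_norm_cart Finite_Cartesian_Product.norm_nth_le)
  finally show ?thesis by (simp add: sum_distrib_left)
qed

context C2_domain begin

lemma Omega_lebesgue: "\<Omega> \<in> sets lebesgue" "emeasure lebesgue \<Omega> < \<infinity>"
  using open_Omega emeasure_bounded_finite[OF bounded_Omega] by auto

lemma set_integrable_continuous:
  fixes f :: "real^3 \<Rightarrow> 'b::euclidean_space"
  assumes f: "continuous_on UNIV f"
  shows "set_integrable lebesgue \<Omega> f"
proof -
  have "compact (closure \<Omega>)" using bounded_Omega by (simp add: compact_closure)
  from compact_imp_bounded[OF compact_continuous_image[OF continuous_on_subset[OF f] this]]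
  obtain B where B: "\<forall>t\<in>f ` closure \<Omega>. norm t \<le> B" unfolding bounded_iff by blast
  show ?thesis unfolding set_integrable_def
  proof (rule integrableI_bounded_set_indicator[OF Omega_lebesgue(1) _ Omega_lebesgue(2), of _ B])
    show "f \<in> borel_measurable lebesgue"
      using measurable_completion[of f lborel borel] borel_measurable_continuous_onI[OF f] by simp
    show "AE x in lebesgue. x \<in> \<Omega> \<longrightarrow> norm (f x) \<le> B"
      using B closure_subset by (intro AE_I2) auto
  qed
qed

section \<open>Green's formula for smooth functions and for H^1 functions\<close>

text \<open>Gauss's theorem in direction j is applied to \<open>w\<close> times the j-th partial
  derivative of \<open>v\<close>. The sum over j is \<open>bdot (grad w x) (grad v x)\<close> plus
  \<open>w\<close> times the Laplacian, and \<open>eq\<close> replaces the Laplacian by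
  \<open>c * v x\<close>.\<close>

lemma Green:
  fixes w v :: "real^3 \<Rightarrow> complex"
  assumes w: "Ck_on 1 w UNIV" and v: "\<And>j. C1_deriv (\<lambda>x. grad v x $ j) (p' j)"
    and eq: "\<And>x. (\<Sum>j\<in>UNIV. p' j x (axis j 1)) = c * v x" and cv: "continuous_on UNIV v"
  shows "(LINT x:\<Omega>|lebesgue. bdot (grad w x) (grad v x)) + (LINT x:\<Omega>|lebesgue. c * w x * v x) =
     (LINT x:frontier \<Omega>|S. bdot (cvec (outward_normal \<Omega> x)) (grad v x) * w x)"
proof -
  have w': "C1_deriv w (\<lambda>x. frechet_derivative w (at x))" using C1_deriv_Ck_on[of 0 w] w by simp
  define f where "f j x = w x * grad v x $ j" for j x
  define f' where "f' j x h = w x * p' j x h + frechet_derivative w (at x) h * grad v x $ j" for j x h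
  have f: "C1_deriv (f j) (f' j)" for j
    unfolding C1_deriv_def f_def f'_def
    by (intro conjI allI has_derivative_mult continuous_intros C1_derivD(1,2,3)[OF w'] C1_derivD(1,2,3)[OF v])
  have sm: "(\<Sum>j\<in>UNIV. f' j x (axis j 1)) = bdot (grad w x) (grad v x) + c * w x * v x" for x
  proof -
    have "(\<Sum>j\<in>UNIV. f' j x (axis j 1)) = w x * (\<Sum>j\<in>UNIV. p' j x (axis j 1)) + bdot (grad w x) (grad v x)"
      by (simp add: f'_def sum.distrib sum_distrib_left bdot_def grad_def)
    then show ?thesis by (simp add: eq)
  qed
  have cg: "continuous_on UNIV (\<lambda>x. grad w x $ j)" for j
    unfolding grad_def using C1_derivD(2)[OF w'] by simp
  have i1: "set_integrable lebesgue \<Omega> (\<lambda>x. bdot (grad w x) (grad v x))" unfolding bdot_def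
    by (intro set_integrable_continuous continuous_intros cg C1_derivD(3)[OF v])
  have i2: "set_integrable lebesgue \<Omega> (\<lambda>x. c * w x * v x)"
    by (intro set_integrable_continuous continuous_intros cv C1_derivD(3)[OF w'])
  have i3: "set_integrable lebesgue \<Omega> (\<lambda>x. f' j x (axis j 1))" for j
    by (intro set_integrable_continuous C1_derivD(2)[OF f])
  have "(LINT x:\<Omega>|lebesgue. bdot (grad w x) (grad v x)) + (LINT x:\<Omega>|lebesgue. c * w x * v x) =
     (LINT x:\<Omega>|lebesgue. (\<Sum>j\<in>UNIV. f' j x (axis j 1)))"
    by (simp add: sm set_integral_add i1 i2)
  also have "\<dots> = (\<Sum>j\<in>UNIV. (LINT x:\<Omega>|lebesgue. f' j x (axis j 1)))"
    using i3 unfolding set_lebesgue_integral_def set_integrable_def scaleR_sum_right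
    by (intro Bochner_Integration.integral_sum) auto
  also have "\<dots> = (\<Sum>j\<in>UNIV. (LINT x|S. indicator (frontier \<Omega>) x *\<^sub>R ((axis j 1 \<bullet> outward_normal \<Omega> x) *\<^sub>R f j x)))"
  proof (intro sum.cong refl)
    fix j :: 3
    have "(LINT x:\<Omega>|lebesgue. f' j x (axis j 1)) = (LINT x|lborel. indicator \<Omega> x *\<^sub>R f' j x (axis j 1))"
      unfolding set_lebesgue_integral_def
      using borel_measurable_continuous_onI[OF C1_derivD(2)[OF f, of UNIV j "axis j 1"]] open_Omega
      by (intro integral_completion) measurable
    then show "(LINT x:\<Omega>|lebesgue. f' j x (axis j 1)) =
       (LINT x|S. indicator (frontier \<Omega>) x *\<^sub>R ((axis j 1 \<bullet> outward_normal \<Omega> x) *\<^sub>R f j x))"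
      using divergence_theorem[OF f] by simp
  qed
  also have "\<dots> = (LINT x|S. (\<Sum>j\<in>UNIV. indicator (frontier \<Omega>) x *\<^sub>R ((axis j 1 \<bullet> outward_normal \<Omega> x) *\<^sub>R f j x)))"
    by (rule Bochner_Integration.integral_sum[symmetric]) (rule integrable_boundary[OF C1_derivD(3)[OF f]])
  also have "\<dots> = (LINT x:frontier \<Omega>|S. bdot (cvec (outward_normal \<Omega> x)) (grad v x) * w x)"
    unfolding set_lebesgue_integral_def
    by (intro Bochner_Integration.integral_cong refl)
      (simp add: bdot_axis_sum f_def scaleR_sum_right sum_distrib_left mult.commute[of _ "w _"])
  finally show ?thesis .
qed

lemma continuous_bounded_closure:
  fixes f :: "real^3 \<Rightarrow> 'b::real_normed_vector"
  assumes "continuous_on UNIV f"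
  obtains B where "B \<ge> 0" "\<And>x. x \<in> closure \<Omega> \<Longrightarrow> norm (f x) \<le> B"
proof -
  have "compact (closure \<Omega>)" using bounded_Omega by (simp add: compact_closure)
  from compact_imp_bounded[OF compact_continuous_image[OF continuous_on_subset[OF assms] this]]
  obtain B where B: "\<forall>t\<in>f ` closure \<Omega>. norm t \<le> B" unfolding bounded_iff by blast
  show ?thesis
  proof (rule that)
    show "norm (f x) \<le> max 0 B" if "x \<in> closure \<Omega>" for x using bspec[OF B imageI[OF that]] by simp
  qed simp
qed

text \<open>The C^1 functions that witness \<open>has_trace\<close> satisfy Green's formula. In the
  limit it holds for \<open>u\<close> and \<open>tu\<close>, so the boundary integral in
  \<open>boundary_form\<close> cancels the gradient and mass terms of the pairing and only the
  source term survives.\<close>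

theorem boundary_form_eq:
  fixes v :: "real^3 \<Rightarrow> complex"
  assumes u: "L2_on \<Omega> u" "L2_on \<Omega> Du" and tr: "has_trace \<Omega> u Du tu"
    and v: "\<And>j. C1_deriv (\<lambda>x. grad v x $ j) (p' j)"
    and eq: "\<And>x. (\<Sum>j\<in>UNIV. p' j x (axis j 1)) = - complex_of_real (k\<^sup>2) * v x" and cv: "continuous_on UNIV v"
    and F: "set_integrable lebesgue \<Omega> (\<lambda>x. F x * v x)"
  shows "boundary_form \<Omega> k F u Du tu v = (LINT x:\<Omega>|lebesgue. F x * v x)"
proof -
  define c where "c = - complex_of_real (k\<^sup>2)"
  have tm: "tu \<in> borel_measurable S" and ti: "integrable S (\<lambda>x. (cmod (tu x))\<^sup>2)"
    using tr by (auto simp: has_trace_def)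
  obtain w :: "nat \<Rightarrow> real^3 \<Rightarrow> complex" where w: "\<And>n. Ck_on 1 (w n) UNIV"
    and l1: "(\<lambda>n. \<integral>\<^sup>+x\<in>\<Omega>. ennreal ((cmod (w n x - u x))\<^sup>2) \<partial>lebesgue) \<longlonglongrightarrow> 0"
    and l2: "(\<lambda>n. \<integral>\<^sup>+x\<in>\<Omega>. ennreal ((norm (grad (w n) x - Du x))\<^sup>2) \<partial>lebesgue) \<longlonglongrightarrow> 0"
    and l3: "(\<lambda>n. \<integral>\<^sup>+x. ennreal ((cmod (w n x - tu x))\<^sup>2) \<partial>S) \<longlonglongrightarrow> 0"
    using tr by (auto simp: has_trace_def)
  have w': "C1_deriv (w n) (\<lambda>x. frechet_derivative (w n) (at x))" for n using C1_deriv_Ck_on[of 0 "w n"] w by simp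
  have cw: "continuous_on UNIV (w n)" for n by (rule C1_derivD(3)[OF w'])
  have cgw: "continuous_on UNIV (grad (w n))" for n
    unfolding grad_def using C1_derivD(2)[OF w'] by (intro continuous_on_vec_lambda)
  have cgwj: "continuous_on UNIV (\<lambda>x. grad (w n) x $ j)" for n j
    by (intro continuous_intros cgw)
  have cgv: "continuous_on UNIV (\<lambda>x. grad v x $ j)" for j by (rule C1_derivD(3)[OF v])
  have csum: "continuous_on UNIV (\<lambda>x. \<Sum>j\<in>UNIV. cmod (grad v x $ j))" by (intro continuous_intros cgv)
  obtain B1 where B1: "B1 \<ge> 0" "\<And>x. x \<in> closure \<Omega> \<Longrightarrow> norm (v x) \<le> B1" using continuous_bounded_closure[OF cv] by metis
  obtain B2 where B2: "B2 \<ge> 0" "\<And>x. x \<in> closure \<Omega> \<Longrightarrow> norm (\<Sum>j\<in>UNIV. cmod (grad v x $ j)) \<le> B2"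
    using continuous_bounded_closure[OF csum] by metis
  have sub: "\<Omega> \<subseteq> closure \<Omega>" "frontier \<Omega> \<subseteq> closure \<Omega>" unfolding frontier_def by (rule closure_subset) blast
  have iu: "set_integrable lebesgue \<Omega> u"
    by (rule square_integrable_imp_integrable[OF Omega_lebesgue]) (use u(1) in \<open>auto simp: L2_on_def\<close>)
  have iDu: "set_integrable lebesgue \<Omega> Du"
    by (rule square_integrable_imp_integrable[OF Omega_lebesgue]) (use u(2) in \<open>auto simp: L2_on_def\<close>)
  have iDuj: "set_integrable lebesgue \<Omega> (\<lambda>x. Du x $ j)" for j
    using integrable_bounded_linear[OF bounded_linear_vec_nth iDu[unfolded set_integrable_def], of j]
    unfolding set_integrable_def by simp
  have ib: "set_integrable lebesgue \<Omega> (\<lambda>x. bdot (Du x) (grad v x))"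
  proof -
    have "set_integrable lebesgue \<Omega> (\<lambda>x. grad v x $ j * Du x $ j)" for j
    proof (rule set_integrable_bounded_mult[OF iDuj])
      show "set_borel_measurable lebesgue \<Omega> (\<lambda>x. grad v x $ j)"
        by (rule continuous_set_borel_measurable_lebesgue[OF cgv Omega_lebesgue(1)])
      show "cmod (grad v x $ j) \<le> B2" if "x \<in> \<Omega>" for x
      proof -
        have "cmod (grad v x $ j) \<le> (\<Sum>j\<in>UNIV. cmod (grad v x $ j))" by (rule member_le_sum) auto
        then show ?thesis using B2(2)[of x] that sub by auto
      qed
    qed
    then have "set_integrable lebesgue \<Omega> (\<lambda>x. \<Sum>j\<in>UNIV. grad v x $ j * Du x $ j)"
      unfolding set_integrable_def scaleR_sum_right by (intro Bochner_Integration.integrable_sum) auto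
    then show ?thesis by (simp add: bdot_def mult.commute)
  qed
  have iuv: "set_integrable lebesgue \<Omega> (\<lambda>x. (c * v x) * u x)"
  proof (rule set_integrable_bounded_mult[OF iu])
    show "set_borel_measurable lebesgue \<Omega> (\<lambda>x. c * v x)"
      by (intro continuous_set_borel_measurable_lebesgue Omega_lebesgue continuous_intros cv)
    show "cmod (c * v x) \<le> cmod c * B1" if "x \<in> \<Omega>" for x
      using B1(2)[of x] that sub by (auto simp: norm_mult intro!: mult_left_mono)
  qed
  have L1: "(\<lambda>n. LINT x:\<Omega>|lebesgue. bdot (grad (w n) x) (grad v x)) \<longlonglongrightarrow> (LINT x:\<Omega>|lebesgue. bdot (Du x) (grad v x))"
  proof (rule set_integral_L2_limit[OF Omega_lebesgue B2(1) _ _ ib _ l2])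
    show "set_borel_measurable lebesgue \<Omega> (\<lambda>x. grad (w n) x - Du x)" for n
      using set_integral_diff(1)[OF set_integrable_continuous[OF cgw] iDu]
      unfolding set_integrable_def set_borel_measurable_def by (rule borel_measurable_integrable)
    show "set_integrable lebesgue \<Omega> (\<lambda>x. bdot (grad (w n) x) (grad v x))" for n
      unfolding bdot_def by (intro set_integrable_continuous continuous_intros cgwj cgv)
    fix n x assume x: "x \<in> \<Omega>"
    have "cmod (bdot (grad (w n) x) (grad v x) - bdot (Du x) (grad v x)) = cmod (bdot (grad (w n) x - Du x) (grad v x))"
      by (simp add: bdot_def sum_subtractf left_diff_distrib)
    also have "\<dots> \<le> norm (grad (w n) x - Du x) * (\<Sum>j\<in>UNIV. cmod (grad v x $ j))" by (rule norm_bdot_le)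
    also have "\<dots> \<le> norm (grad (w n) x - Du x) * B2"
      using B2(2)[of x] x sub by (intro mult_left_mono) auto
    finally show "cmod (bdot (grad (w n) x) (grad v x) - bdot (Du x) (grad v x)) \<le> B2 * norm (grad (w n) x - Du x)"
      by (simp add: mult.commute)
  qed
  have L2: "(\<lambda>n. LINT x:\<Omega>|lebesgue. c * w n x * v x) \<longlonglongrightarrow> (LINT x:\<Omega>|lebesgue. (c * v x) * u x)"
  proof (rule set_integral_L2_limit[OF Omega_lebesgue _ _ _ iuv _ l1, of "cmod c * B1"])
    show "0 \<le> cmod c * B1" using B1 by simp
    show "set_borel_measurable lebesgue \<Omega> (\<lambda>x. w n x - u x)" for n
      using set_integral_diff(1)[OF set_integrable_continuous[OF cw] iu]
      unfolding set_integrable_def set_borel_measurable_def by (rule borel_measurable_integrable)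
    show "set_integrable lebesgue \<Omega> (\<lambda>x. c * w n x * v x)" for n
      by (intro set_integrable_continuous continuous_intros cw cv)
    fix n x assume x: "x \<in> \<Omega>"
    have "cmod (c * w n x * v x - c * v x * u x) = cmod c * cmod (v x) * cmod (w n x - u x)"
      by (simp add: norm_mult[symmetric] algebra_simps)
    also have "\<dots> \<le> cmod c * B1 * cmod (w n x - u x)"
      using B1(2)[of x] x sub by (intro mult_right_mono mult_left_mono) auto
    finally show "cmod (c * w n x * v x - c * v x * u x) \<le> cmod c * B1 * cmod (w n x - u x)" .
  qed
  have fS: "emeasure S UNIV < \<infinity>" using finite_measure.emeasure_finite[OF finite_S, of UNIV] by (simp add: less_top)
  \<comment> \<open>The normal derivative of \<open>v\<close> cut off to the frontier: a bounded
    Borel function on the whole space, so that one L^2 limit over \<open>UNIV\<close> handles the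
    boundary term.\<close>
  let ?N = "\<lambda>x. indicator (frontier \<Omega>) x *\<^sub>R bdot (cvec (outward_normal \<Omega> x)) (grad v x)"
  have Nm: "?N \<in> borel_measurable S"
  proof -
    have "?N = (\<lambda>x. \<Sum>j\<in>UNIV. indicator (frontier \<Omega>) x *\<^sub>R ((axis j 1 \<bullet> outward_normal \<Omega> x) *\<^sub>R grad v x $ j))"
      by (simp add: bdot_axis_sum scaleR_sum_right)
    also have "\<dots> \<in> borel_measurable S"
      using meas_boundary[OF cgv] by (intro borel_measurable_sum) simp
    finally show ?thesis .
  qed
  have NB: "cmod (?N x) \<le> B2" for x
  proof (cases "x \<in> frontier \<Omega>")
    case True
    have "norm (cvec (outward_normal \<Omega> x)) = 1"
      using norm_outward_normal[OF True] by (simp add: cvec_def norm_vec_def L2_set_def)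
    then have "cmod (bdot (cvec (outward_normal \<Omega> x)) (grad v x)) \<le> (\<Sum>j\<in>UNIV. cmod (grad v x $ j))"
      using norm_bdot_le[of "cvec (outward_normal \<Omega> x)" "grad v x"] by simp
    then show ?thesis using B2(2)[of x] True sub by auto
  qed (simp add: B2)
  have itu: "set_integrable S UNIV tu"
    by (rule square_integrable_imp_integrable[OF _ fS])
      (use tm ti in \<open>auto simp: set_borel_measurable_def set_integrable_def\<close>)
  have iNtu: "set_integrable S UNIV (\<lambda>x. ?N x * tu x)"
    by (rule set_integrable_bounded_mult[OF itu _ NB]) (use Nm in \<open>simp add: set_borel_measurable_def\<close>)
  have iw: "set_integrable S UNIV (\<lambda>x. indicator (frontier \<Omega>) x *\<^sub>R w n x)" for n
  proof -
    obtain B where B: "B \<ge> 0" "\<And>x. x \<in> closure \<Omega> \<Longrightarrow> norm (w n x) \<le> B" using continuous_bounded_closure[OF cw] by metis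
    have "integrable S (\<lambda>x. indicator (frontier \<Omega>) x *\<^sub>R w n x)"
    proof (rule integrable_S_bounded)
      show "(\<lambda>x. indicator (frontier \<Omega>) x *\<^sub>R w n x) \<in> borel_measurable borel"
        using borel_measurable_continuous_onI[OF cw] by measurable
      show "norm (indicator (frontier \<Omega>) x *\<^sub>R w n x) \<le> B" for x
        using B sub by (cases "x \<in> frontier \<Omega>") auto
    qed
    then show ?thesis by (simp add: set_integrable_def)
  qed
  have L3: "(\<lambda>n. LINT x:UNIV|S. ?N x * (indicator (frontier \<Omega>) x *\<^sub>R w n x)) \<longlonglongrightarrow> (LINT x:UNIV|S. ?N x * tu x)"
  proof (rule set_integral_L2_limit[OF _ fS B2(1) _ _ iNtu _ , where h = w and g = tu])
    show "set_borel_measurable S UNIV (\<lambda>x. w n x - tu x)" for n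
    proof -
      have "w n \<in> borel_measurable S" using borel_measurable_continuous_onI[OF cw] by simp
      from borel_measurable_diff[OF this tm] show ?thesis by (simp add: set_borel_measurable_def)
    qed
    show "set_integrable S UNIV (\<lambda>x. ?N x * (indicator (frontier \<Omega>) x *\<^sub>R w n x))" for n
      by (rule set_integrable_bounded_mult[OF iw _ NB]) (use Nm in \<open>simp add: set_borel_measurable_def\<close>)
    show "(\<lambda>n. \<integral>\<^sup>+x\<in>UNIV. ennreal ((cmod (w n x - tu x))\<^sup>2) \<partial>S) \<longlonglongrightarrow> 0" using l3 by simp
    fix n x
    have "?N x * (indicator (frontier \<Omega>) x *\<^sub>R w n x) - ?N x * tu x = ?N x * (w n x - tu x)"
      by (cases "x \<in> frontier \<Omega>") (simp_all add: right_diff_distrib)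
    then show "cmod (?N x * (indicator (frontier \<Omega>) x *\<^sub>R w n x) - ?N x * tu x) \<le> B2 * cmod (w n x - tu x)"
      using NB[of x] by (simp only: norm_mult) (intro mult_right_mono, auto)
  qed simp
  have G: "(LINT x:\<Omega>|lebesgue. bdot (grad (w n) x) (grad v x)) + (LINT x:\<Omega>|lebesgue. c * w n x * v x) =
     (LINT x:UNIV|S. ?N x * (indicator (frontier \<Omega>) x *\<^sub>R w n x))" for n
  proof -
    have "(LINT x:frontier \<Omega>|S. bdot (cvec (outward_normal \<Omega> x)) (grad v x) * w n x) =
      (LINT x:UNIV|S. ?N x * (indicator (frontier \<Omega>) x *\<^sub>R w n x))"
      unfolding set_lebesgue_integral_def by (intro Bochner_Integration.integral_cong refl) (auto simp: indicator_def)
    then show ?thesis using Green[OF w v _ cv, of c] eq by (simp add: c_def)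
  qed
  \<comment> \<open>The volume and boundary sides of Green's formula for \<open>w n\<close> are the
    same sequence, so their limits agree.\<close>
  have "(LINT x:\<Omega>|lebesgue. bdot (Du x) (grad v x)) + (LINT x:\<Omega>|lebesgue. (c * v x) * u x) = (LINT x:UNIV|S. ?N x * tu x)"
    using tendsto_add[OF L1 L2] L3 unfolding G by (rule LIMSEQ_unique)
  also have "\<dots> = (LINT x:frontier \<Omega>|S. bdot (cvec (outward_normal \<Omega> x)) (grad v x) * tu x)"
    unfolding set_lebesgue_integral_def by (intro Bochner_Integration.integral_cong refl) (auto simp: indicator_def)
  finally have main: "(LINT x:\<Omega>|lebesgue. bdot (Du x) (grad v x)) + (LINT x:\<Omega>|lebesgue. (c * v x) * u x) =
    (LINT x:frontier \<Omega>|S. bdot (cvec (outward_normal \<Omega> x)) (grad v x) * tu x)" .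
  have "normal_deriv_pairing \<Omega> k F u Du v (grad v) =
      (LINT x:\<Omega>|lebesgue. (bdot (Du x) (grad v x) + (c * v x) * u x) + F x * v x)"
    unfolding normal_deriv_pairing_def by (simp add: c_def mult_ac)
  also have "\<dots> = ((LINT x:\<Omega>|lebesgue. bdot (Du x) (grad v x)) + (LINT x:\<Omega>|lebesgue. (c * v x) * u x)) + (LINT x:\<Omega>|lebesgue. F x * v x)"
    by (simp only: set_integral_add[OF set_integral_add(1)[OF ib iuv] F] set_integral_add(2)[OF ib iuv])
  finally show ?thesis unfolding boundary_form_def main by simp
qed

end

section \<open>Integration over the infinite cone\<close>

text \<open>Euler's integral for the factorial after the substitution \<open>x = \<tau> r\<close>;
  the half line is open here and closed there, which costs only a null set.\<close>

lemma power_exp_moment: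
  fixes \<tau> :: real
  assumes "\<tau> > 0"
  shows "has_bochner_integral lborel (\<lambda>r. indicator {0<..} r * (r ^ n * exp (- \<tau> * r))) (fact n / \<tau> ^ Suc n)"
proof (rule has_bochner_integral_nn_integral)
  let ?f = "\<lambda>r::real. indicator {0<..} r * (r ^ n * exp (- \<tau> * r))"
  have "(\<integral>\<^sup>+x. ennreal (x^n * exp (-x)) * indicator {0 ..} x \<partial>lborel) =
      ennreal \<bar>\<tau>\<bar> * (\<integral>\<^sup>+x. ennreal ((0 + \<tau> * x)^n * exp (-(0 + \<tau> * x))) * indicator {0 ..} (0 + \<tau> * x) \<partial>lborel)"
    using assms by (intro nn_integral_real_affine) auto
  also have "(\<integral>\<^sup>+x. ennreal ((0 + \<tau> * x)^n * exp (-(0 + \<tau> * x))) * indicator {0 ..} (0 + \<tau> * x) \<partial>lborel) =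
     (\<integral>\<^sup>+x. ennreal (\<tau> ^ n) * ennreal (?f x) \<partial>lborel)"
  proof (rule nn_integral_cong_AE)
    show "AE x in lborel. ennreal ((0 + \<tau> * x)^n * exp (-(0 + \<tau> * x))) * indicator {0 ..} (0 + \<tau> * x) = ennreal (\<tau> ^ n) * ennreal (?f x)"
      using AE_lborel_singleton[of 0]
    proof eventually_elim
      case (elim x)
      then show ?case using assms
        by (cases "x > 0") (auto simp: indicator_def zero_le_mult_iff power_mult_distrib ennreal_mult[symmetric] mult_ac)
    qed
  qed
  also have "\<dots> = ennreal (\<tau> ^ n) * (\<integral>\<^sup>+x. ennreal (?f x) \<partial>lborel)"
    by (rule nn_integral_cmult) simp
  finally have "ennreal (fact n) = ennreal (\<tau> ^ Suc n) * (\<integral>\<^sup>+x. ennreal (?f x) \<partial>lborel)"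
    using assms by (simp add: nn_intergal_power_times_exp_Ici ennreal_mult mult.assoc ennreal_of_nat_eq_real_of_nat)
  then have "ennreal (1 / \<tau> ^ Suc n) * ennreal (fact n) = (ennreal (1 / \<tau> ^ Suc n) * ennreal (\<tau> ^ Suc n)) * (\<integral>\<^sup>+x. ennreal (?f x) \<partial>lborel)"
    by (simp add: mult.assoc)
  also have "ennreal (1 / \<tau> ^ Suc n) * ennreal (\<tau> ^ Suc n) = 1"
    using assms by (simp add: ennreal_mult[symmetric] del: power_Suc)
  finally show "(\<integral>\<^sup>+x. ennreal (?f x) \<partial>lborel) = ennreal (fact n / \<tau> ^ Suc n)"
    using assms by (simp add: ennreal_mult[symmetric] del: power_Suc)
qed (use assms in \<open>auto simp: indicator_def\<close>)

text \<open>For complex \<open>z\<close> a real substitution no longer reduces to Euler's integral.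
  An explicit antiderivative, decaying because \<open>Re z > 0\<close>, does.\<close>

lemma laplace_square:
  fixes z :: complex
  assumes "Re z > 0"
  shows "integrable lborel (\<lambda>r. indicator {0<..} r *\<^sub>R (complex_of_real (r\<^sup>2) * exp (- z * complex_of_real r)))"
    and "(LINT r|lborel. indicator {0<..} r *\<^sub>R (complex_of_real (r\<^sup>2) * exp (- z * complex_of_real r))) = 2 / z ^ 3"
proof -
  let ?f = "\<lambda>r. complex_of_real (r\<^sup>2) * exp (- z * complex_of_real r)"
  have z0: "z \<noteq> 0" using assms by auto
  show i: "integrable lborel (\<lambda>r. indicator {0<..} r *\<^sub>R ?f r)"
  proof (rule Bochner_Integration.integrable_bound)
    show "integrable lborel (\<lambda>r. indicator {0<..} r * (r ^ 2 * exp (- Re z * r)))"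
      using power_exp_moment[OF assms, of 2] by (simp add: has_bochner_integral_iff)
    have "continuous_on UNIV ?f" by (intro continuous_intros)
    then have "?f \<in> borel_measurable borel" by (rule borel_measurable_continuous_onI)
    then show "(\<lambda>r. indicator {0<..} r *\<^sub>R ?f r) \<in> borel_measurable lborel" by measurable
  qed (auto simp: norm_mult norm_power indicator_def)
  \<comment> \<open>Obtained by integrating by parts twice; \<open>F 0\<close> equals
    \<open>- 2 / z ^ 3\<close>.\<close>
  define F where "F r = - exp (- z * complex_of_real r) * (complex_of_real r ^ 2 / z + 2 * complex_of_real r / z\<^sup>2 + 2 / z ^ 3)" for r
  have "(LBINT r=0..\<infinity>. ?f r) = 0 - F 0"
  proof (rule interval_integral_FTC_integrable)
    show "(F has_vector_derivative ?f r) (at r)" for r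
    proof -
      have "((\<lambda>w. - exp (- z * w) * (w ^ 2 / z + 2 * w / z\<^sup>2 + 2 / z ^ 3)) has_field_derivative ?f r) (at (complex_of_real r))"
        using z0 by (auto intro!: derivative_eq_intros) (simp add: field_simps power2_eq_square power3_eq_cube power4_eq_xxxx)
      from has_vector_derivative_real_field[OF this] show ?thesis by (simp add: F_def[abs_def])
    qed
    then have cF: "continuous (at r) F" for r by (rule has_vector_derivative_continuous)
    show "isCont ?f r" for r by (intro continuous_intros)
    show "set_integrable lborel (einterval 0 \<infinity>) ?f"
      using i by (simp add: set_integrable_def zero_ereal_def)
    have "(F \<longlongrightarrow> F 0) (at_right 0)" using cF[of 0] by (auto simp: continuous_at intro: tendsto_within_subset)
    then show "((F \<circ> real_of_ereal) \<longlongrightarrow> F 0) (at_right 0)"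
      by (simp add: zero_ereal_def ereal_tendsto_simps)
    have "(F \<longlongrightarrow> 0) at_top"
    proof (rule Lim_null_comparison)
      show "\<forall>\<^sub>F r in at_top. norm (F r) \<le> exp (- Re z * r) * (r ^ 2 / cmod z + 2 * r / (cmod z)\<^sup>2 + 2 / cmod z ^ 3)"
        using eventually_ge_at_top[of 0]
      proof eventually_elim
        case (elim r)
        have "norm (F r) = exp (- Re z * r) * cmod (complex_of_real r ^ 2 / z + 2 * complex_of_real r / z\<^sup>2 + 2 / z ^ 3)"
          by (simp add: F_def norm_mult)
        also have "cmod (complex_of_real r ^ 2 / z + 2 * complex_of_real r / z\<^sup>2 + 2 / z ^ 3) \<le>
            cmod (complex_of_real r ^ 2 / z) + cmod (2 * complex_of_real r / z\<^sup>2) + cmod (2 / z ^ 3)"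
          by (intro order_trans[OF norm_triangle_ineq] add_mono norm_triangle_ineq order_refl)
        also have "\<dots> = r ^ 2 / cmod z + 2 * r / (cmod z)\<^sup>2 + 2 / cmod z ^ 3"
          using elim by (simp add: norm_divide norm_mult norm_power)
        finally show ?case by simp
      qed
      have "cmod z > 0" using z0 by simp
      then show "((\<lambda>r. exp (- Re z * r) * (r ^ 2 / cmod z + 2 * r / (cmod z)\<^sup>2 + 2 / cmod z ^ 3)) \<longlongrightarrow> 0) at_top"
        using assms by real_asymp
    qed
    then show "((F \<circ> real_of_ereal) \<longlongrightarrow> 0) (at_left \<infinity>)" by (simp add: ereal_tendsto_simps)
  qed simp
  then show "(LINT r|lborel. indicator {0<..} r *\<^sub>R ?f r) = 2 / z ^ 3"
    by (simp add: interval_lebesgue_integral_def set_lebesgue_integral_def zero_ereal_def F_def)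
qed

section \<open>Plane slices and polar coordinates of the cone\<close>

text \<open>Shows that the choice made in \<open>plane_measure\<close> is satisfiable: the
  hyperplane orthogonal to \<omega> has dimension 2, hence is isometric to the plane, and is then
  shifted by \<open>c *\<^sub>R \<omega>\<close>.\<close>

lemma plane_isometry:
  fixes \<omega> :: "real^3"
  assumes "norm \<omega> = 1"
  shows "\<exists>E :: real^2 \<Rightarrow> real^3. (\<forall>y z. dist (E y) (E z) = dist y z) \<and> range E = {x. x \<bullet> \<omega> = c}"
proof -
  have w0: "\<omega> \<noteq> 0" and ww: "\<omega> \<bullet> \<omega> = 1" using assms by (auto simp: norm_eq_1)
  have "dim (UNIV :: (real^2) set) = dim {x. \<omega> \<bullet> x = 0}" using dim_hyperplane[OF w0] by simp
  from isometries_subspaces[OF subspace_UNIV subspace_hyperplane this]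
  obtain f :: "real^2 \<Rightarrow> real^3" where f: "linear f" "range f = {x. \<omega> \<bullet> x = 0}" "\<And>x. norm (f x) = norm x" by (metis UNIV_I)
  have "dist (c *\<^sub>R \<omega> + f y) (c *\<^sub>R \<omega> + f z) = dist y z" for y z
    using f(3)[of "y - z"] linear_diff[OF f(1), of y z] by (simp add: dist_norm)
  moreover have "range (\<lambda>y. c *\<^sub>R \<omega> + f y) = {x. x \<bullet> \<omega> = c}"
  proof (intro equalityI subsetI)
    fix x assume "x \<in> range (\<lambda>y. c *\<^sub>R \<omega> + f y)"
    then obtain y where x: "x = c *\<^sub>R \<omega> + f y" by auto
    have "f y \<in> {x. \<omega> \<bullet> x = 0}" using f(2) by blast
    then show "x \<in> {x. x \<bullet> \<omega> = c}" by (simp add: x inner_add_left ww inner_commute[of "f y"])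
  next
    fix x assume "x \<in> {x. x \<bullet> \<omega> = c}"
    then have "x - c *\<^sub>R \<omega> \<in> {x. \<omega> \<bullet> x = 0}" by (simp add: inner_diff_right ww inner_commute)
    then obtain y where "x - c *\<^sub>R \<omega> = f y" using f(2) by blast
    then have "x = c *\<^sub>R \<omega> + f y" by (simp add: algebra_simps)
    then show "x \<in> range (\<lambda>y. c *\<^sub>R \<omega> + f y)" by blast
  qed
  ultimately show ?thesis by (intro exI[of _ "\<lambda>y. c *\<^sub>R \<omega> + f y"]) simp
qed

lemma nn_integral_lborel_scale:
  fixes f :: "'a::euclidean_space \<Rightarrow> ennreal"
  assumes [measurable]: "f \<in> borel_measurable borel" and c: "c > 0"
  shows "(\<integral>\<^sup>+x. f x \<partial>lborel) = ennreal (c ^ DIM('a)) * (\<integral>\<^sup>+x. f (c *\<^sub>R x) \<partial>lborel)"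
proof -
  have "(\<integral>\<^sup>+x. f x \<partial>lborel) = (\<integral>\<^sup>+x. f x \<partial>(density (distr lborel borel (\<lambda>x. 0 + c *\<^sub>R x)) (\<lambda>_. \<bar>c\<bar>^DIM('a))))"
    using lborel_affine[of c "0::'a"] c by simp
  also have "\<dots> = ennreal (c ^ DIM('a)) * (\<integral>\<^sup>+x. f (c *\<^sub>R x) \<partial>lborel)"
    using c by (simp add: nn_integral_density nn_integral_distr nn_integral_cmult)
  finally show ?thesis .
qed

locale truncated_cone =
  fixes p \<omega> :: "real^3" and \<delta> s :: real and Q :: "(real^3) set"
  assumes \<omega>: "norm \<omega> = 1" and s: "0 < s" "s < \<delta>" and base: "cone_base p \<omega> \<delta> Q"
    and open_cone: "open (cone_set p \<omega> \<delta> Q)"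
begin

definition depth :: "real^3 \<Rightarrow> real" where "depth x = (p - x) \<bullet> \<omega>"

text \<open>The point \<open>x\<close> is projected from the vertex onto the base plane at depth
  \<delta>, and its image has to lie in \<open>Q\<close>.\<close>

definition infinite_cone :: "(real^3) set" where
  "infinite_cone = {x. depth x > 0 \<and> p + (\<delta> / depth x) *\<^sub>R (x - p) \<in> Q}"

lemma ww: "\<omega> \<bullet> \<omega> = 1" using \<omega> by (simp add: norm_eq_1)

lemma \<delta>: "\<delta> > 0" using s by simp

lemma depth_scale: "depth (p + t *\<^sub>R (x - p)) = t * depth x"
  by (simp add: depth_def inner_diff_left algebra_simps)

lemma Q_depth: "z \<in> Q \<Longrightarrow> depth z = \<delta>"
proof -
  assume "z \<in> Q"
  moreover have "Q \<subseteq> {x. x \<bullet> \<omega> = p \<bullet> \<omega> - \<delta>}" using base openin_imp_subset by (auto simp: cone_base_def)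
  ultimately show ?thesis by (auto simp: depth_def inner_diff_left)
qed

lemma cone_set_eq: "cone_set p \<omega> \<delta> Q = infinite_cone \<inter> {x. depth x < \<delta>}"
proof (intro equalityI subsetI)
  fix x assume "x \<in> cone_set p \<omega> \<delta> Q"
  then obtain t z where t: "0 < t" "t < \<delta>" and z: "z \<in> Q" and x: "x = p + (t / \<delta>) *\<^sub>R (z - p)"
    by (auto simp: cone_set_def)
  have d: "depth x = t" using \<delta> by (simp add: x depth_scale Q_depth[OF z])
  have "p + (\<delta> / t) *\<^sub>R (x - p) = z" using t \<delta> by (simp add: x)
  then show "x \<in> infinite_cone \<inter> {x. depth x < \<delta>}" using t z d by (simp add: infinite_cone_def)
next
  fix x assume x: "x \<in> infinite_cone \<inter> {x. depth x < \<delta>}"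
  then have d: "0 < depth x" "depth x < \<delta>" and q: "p + (\<delta> / depth x) *\<^sub>R (x - p) \<in> Q" by (auto simp: infinite_cone_def)
  have "x = p + (depth x / \<delta>) *\<^sub>R ((p + (\<delta> / depth x) *\<^sub>R (x - p)) - p)" using d \<delta> by simp
  from image_eqI[where f = "\<lambda>z. p + (depth x / \<delta>) *\<^sub>R (z - p)", OF this q] show "x \<in> cone_set p \<omega> \<delta> Q"
    unfolding cone_set_def using d by (intro UN_I[of "depth x"]) auto
qed

lemma infinite_cone_scale:
  assumes "t > 0"
  shows "p + t *\<^sub>R (x - p) \<in> infinite_cone \<longleftrightarrow> x \<in> infinite_cone"
proof -
  have "(\<delta> / (t * depth x)) *\<^sub>R (p + t *\<^sub>R (x - p) - p) = (\<delta> / depth x) *\<^sub>R (x - p)"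
    using assms by simp
  moreover have "0 < t * depth x \<longleftrightarrow> 0 < depth x" using assms by (simp add: zero_less_mult_iff)
  ultimately show ?thesis unfolding infinite_cone_def mem_Collect_eq depth_scale by (simp only:)
qed

text \<open>Rescaling to depth \<open>s < \<delta>\<close> moves the test into the finite cone,
  whose openness thereby passes to the infinite one.\<close>

lemma infinite_cone_iff: "x \<in> infinite_cone \<longleftrightarrow> depth x > 0 \<and> p + (s / depth x) *\<^sub>R (x - p) \<in> cone_set p \<omega> \<delta> Q"
  using infinite_cone_scale[of "s / depth x" x] s by (auto simp: cone_set_eq depth_scale infinite_cone_def)

lemma continuous_depth: "continuous_on S depth"
  unfolding depth_def by (intro continuous_intros)

lemma open_infinite_cone: "open infinite_cone"
proof -
  have "open ({x. depth x > 0} \<inter> (\<lambda>x. p + (s / depth x) *\<^sub>R (x - p)) -` cone_set p \<omega> \<delta> Q)"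
  proof (rule continuous_open_preimage)
    show "open {x. depth x > 0}" by (intro open_Collect_less continuous_on_const continuous_depth)
    show "continuous_on {x. 0 < depth x} (\<lambda>x. p + (s / depth x) *\<^sub>R (x - p))"
      by (intro continuous_intros continuous_depth) auto
  qed (rule open_cone)
  also have "{x. depth x > 0} \<inter> (\<lambda>x. p + (s / depth x) *\<^sub>R (x - p)) -` cone_set p \<omega> \<delta> Q = infinite_cone"
    using infinite_cone_iff by blast
  finally show ?thesis .
qed

text \<open>Boundedness of \<open>Q\<close> in scale-invariant form. It converts distances to the
  vertex into depths, both in the Hoelder estimate and in the comparison of phases.\<close>

lemma infinite_cone_bound: obtains m where "m \<ge> 0" "\<And>x. x \<in> infinite_cone \<Longrightarrow> norm (x - p) \<le> m * depth x"
proof -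
  have "bounded ((\<lambda>z. z - p) ` Q)"
    using base bounded_translation[of Q "- p"] by (simp add: cone_base_def)
  then obtain R where R: "\<And>z. z \<in> Q \<Longrightarrow> norm (z - p) \<le> R" by (auto simp: bounded_iff)
  show ?thesis
  proof (rule that[of "\<bar>R\<bar> / \<delta>"])
    show "0 \<le> \<bar>R\<bar> / \<delta>" using \<delta> by simp
    fix x assume "x \<in> infinite_cone"
    then have d: "depth x > 0" and "p + (\<delta> / depth x) *\<^sub>R (x - p) \<in> Q" by (auto simp: infinite_cone_def)
    from R[OF this(2)] d \<delta> have "\<delta> / depth x * norm (x - p) \<le> R" by simp
    then have "\<delta> * norm (x - p) \<le> R * depth x" using d by (simp add: field_simps)
    also have "\<dots> \<le> \<bar>R\<bar> * depth x" using d by (intro mult_right_mono) auto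
    finally show "norm (x - p) \<le> \<bar>R\<bar> / \<delta> * depth x" using \<delta> by (simp add: field_simps)
  qed
qed

text \<open>The isometry chosen in \<open>plane_measure\<close> is unknown; moving its origin to the
  preimage of \<open>p - s *\<^sub>R \<omega>\<close> makes it affine with that base point, and
  translation invariance leaves the integral unchanged.\<close>

lemma plane_param:
  obtains L :: "real^2 \<Rightarrow> real^3" where "linear L" "\<And>y z. L y \<bullet> L z = y \<bullet> z" "\<And>y. L y \<bullet> \<omega> = 0"
    "\<And>f :: real^3 \<Rightarrow> complex. f \<in> borel_measurable borel \<Longrightarrow>
      (LINT x|plane_measure \<omega> (p \<bullet> \<omega> - s). f x) = (LINT y|lborel. f (p - s *\<^sub>R \<omega> + L y))"
proof -
  define E where "E = (SOME E :: real^2 \<Rightarrow> real^3. (\<forall>y z. dist (E y) (E z) = dist y z) \<and> range E = {x. x \<bullet> \<omega> = p \<bullet> \<omega> - s})"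
  have E: "\<And>y z. dist (E y) (E z) = dist y z" and rE: "range E = {x. x \<bullet> \<omega> = p \<bullet> \<omega> - s}"
    using someI_ex[OF plane_isometry[OF \<omega>, of "p \<bullet> \<omega> - s"]] unfolding E_def by blast+
  have "p - s *\<^sub>R \<omega> \<in> range E" by (simp add: rE inner_diff_left ww)
  then obtain q where q: "E q = p - s *\<^sub>R \<omega>" by (metis rangeE)
  define G where "G y = E (q + y)" for y
  have G: "dist (G y) (G z) = dist y z" for y z by (simp add: G_def E)
  have [measurable]: "E \<in> borel_measurable borel"
    by (rule borel_measurable_continuous_onI[OF isometry_continuous[OF E]])
  show ?thesis
  proof (rule that[of "\<lambda>y. G y - G 0"])
    show "linear (\<lambda>y. G y - G 0)" "\<And>y z. (G y - G 0) \<bullet> (G z - G 0) = y \<bullet> z" by (rule isometry_imp_linear[OF G])+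
    show "(G y - G 0) \<bullet> \<omega> = 0" for y
    proof -
      have "G y \<in> range E" "G 0 \<in> range E" by (auto simp: G_def)
      then show ?thesis by (simp add: rE inner_diff_left)
    qed
    fix f :: "real^3 \<Rightarrow> complex" assume [measurable]: "f \<in> borel_measurable borel"
    have "(LINT x|plane_measure \<omega> (p \<bullet> \<omega> - s). f x) = (LINT y|lborel. f (E y))"
      unfolding plane_measure_def E_def[symmetric] by (subst integral_distr) simp_all
    also have "\<dots> = (LINT y|distr lborel borel ((+) q). f (E y))" by (simp add: lborel_distr_plus)
    also have "\<dots> = (LINT y|lborel. f (E (q + y)))" by (subst integral_distr) simp_all
    also have "\<dots> = (LINT y|lborel. f (p - s *\<^sub>R \<omega> + (G y - G 0)))" by (simp add: G_def q)
    finally show "(LINT x|plane_measure \<omega> (p \<bullet> \<omega> - s). f x) = (LINT y|lborel. f (p - s *\<^sub>R \<omega> + (G y - G 0)))" .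
  qed
qed

definition cross_section :: "(real^2 \<Rightarrow> real^3) \<Rightarrow> (real^2) set" where
  "cross_section L = {y. p - s *\<^sub>R \<omega> + L y \<in> infinite_cone}"

text \<open>The point at depth \<open>r\<close> on the ray from the vertex through the point \<open>p - s \<omega> + L y\<close> of the slice at
  depth \<open>s\<close>. The Jacobian is \<open>(r / s)\<^sup>2\<close>.\<close>

definition polar :: "(real^2 \<Rightarrow> real^3) \<Rightarrow> (real^2) \<times> real \<Rightarrow> real^3" where
  "polar L z = p + (snd z / s) *\<^sub>R (L (fst z) - s *\<^sub>R \<omega>)"

context
  fixes L :: "real^2 \<Rightarrow> real^3"
  assumes L: "linear L" "\<And>y z. L y \<bullet> L z = y \<bullet> z" "\<And>y. L y \<bullet> \<omega> = 0"
begin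

lemma cont_L: "continuous_on S L"
  using L(1) by (intro linear_continuous_on) (simp add: linear_conv_bounded_linear)

lemma depth_polar: "depth (polar L z) = snd z"
  using s by (simp add: depth_def polar_def inner_diff_left L ww)

lemma polar_cone: "snd z > 0 \<Longrightarrow> polar L z \<in> infinite_cone \<longleftrightarrow> fst z \<in> cross_section L"
  using infinite_cone_scale[of "snd z / s" "p - s *\<^sub>R \<omega> + L (fst z)"] s
  by (simp add: cross_section_def polar_def)

lemma open_section: "open (cross_section L)"
proof -
  have "cross_section L = (\<lambda>y. p - s *\<^sub>R \<omega> + L y) -` infinite_cone" by (auto simp: cross_section_def)
  then show ?thesis by (simp add: open_vimage open_infinite_cone continuous_intros cont_L)
qed

lemma finite_section: "emeasure lborel (cross_section L) < \<infinity>"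
proof (rule emeasure_bounded_finite)
  obtain m where m: "\<And>x. x \<in> infinite_cone \<Longrightarrow> norm (x - p) \<le> m * depth x" using infinite_cone_bound by metis
  have "norm y \<le> m * s + s" if "y \<in> cross_section L" for y
  proof -
    have d: "depth (p - s *\<^sub>R \<omega> + L y) = s" by (simp add: depth_def inner_diff_left inner_add_left L ww)
    have "norm (- s *\<^sub>R \<omega> + L y) \<le> m * s" using m[of "p - s *\<^sub>R \<omega> + L y"] that by (simp add: cross_section_def d)
    moreover have "norm (L y) = norm y" by (simp add: norm_eq_sqrt_inner L)
    moreover have "norm (L y) \<le> norm (- s *\<^sub>R \<omega> + L y) + norm (s *\<^sub>R \<omega>)"
      using norm_triangle_ineq[of "- s *\<^sub>R \<omega> + L y" "s *\<^sub>R \<omega>"] by simp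
    ultimately show ?thesis using \<omega> s by simp
  qed
  then show "bounded (cross_section L)" by (auto simp: bounded_iff)
qed

definition polar_weight :: "(real^2) \<times> real \<Rightarrow> real" where
  "polar_weight z = indicator (cross_section L) (fst z) * (indicator {0<..} (snd z) * (snd z / s)\<^sup>2)"

lemma meas_polar [measurable]: "polar L \<in> borel_measurable borel"
  unfolding polar_def[abs_def]
  by (intro borel_measurable_continuous_onI continuous_intros continuous_on_compose2[OF cont_L[of UNIV]]) (use s in auto)

lemma meas_polar_weight [measurable]: "polar_weight \<in> borel_measurable borel"
proof -
  have [measurable]: "cross_section L \<in> sets borel" using open_section by simp
  show ?thesis unfolding polar_weight_def[abs_def] by (simp add: borel_prod[symmetric])
qed

text \<open>At each depth \<open>r\<close> the slice of the cone is the slice at depth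
  \<open>s\<close> dilated by \<open>r / s\<close>, which in two dimensions multiplies areas by the
  square of that factor; Tonelli over \<open>r\<close> does the rest.\<close>

lemma distr_polar:
  "distr (density lborel (\<lambda>z. ennreal (polar_weight z))) borel (polar L) = density lborel (indicator infinite_cone)" (is "?M = ?N")
proof (rule measure_eqI)
  fix B assume "B \<in> sets ?M"
  then have B [measurable]: "B \<in> sets borel" by simp
  have [measurable]: "infinite_cone \<in> sets borel" "cross_section L \<in> sets borel"
    using open_infinite_cone open_section by auto
  \<comment> \<open>Orthonormal coordinates with the depth as last one; \<open>A\<close> is an
    isometry and thus preserves volume.\<close>
  define A where "A z = p - snd z *\<^sub>R \<omega> + L (fst z)" for z :: "(real^2) \<times> real"
  have A: "dist (A z) (A w) = dist z w" for z w
  proof -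
    have e: "A z - A w = L (fst z - fst w) - (snd z - snd w) *\<^sub>R \<omega>"
      by (simp add: A_def linear_diff[OF L(1), of "fst z" "fst w"] scaleR_diff_left)
    have "(A z - A w) \<bullet> (A z - A w) = (z - w) \<bullet> (z - w)"
      unfolding e using L(3)[of "fst z - fst w"]
      by (simp add: inner_diff_left[of "L _"] inner_diff_right[of _ "L _"] L(2) ww inner_commute[of \<omega> "L _"] inner_prod_def algebra_simps)
    then show ?thesis by (simp add: dist_norm norm_eq_sqrt_inner)
  qed
  have [measurable]: "A \<in> borel_measurable borel"
    by (rule borel_measurable_continuous_onI[OF isometry_continuous[OF A]])
  let ?h = "\<lambda>x. indicator infinite_cone x * indicator B x :: ennreal"
  have [measurable]: "?h \<in> borel_measurable borel" by measurable
  have hA [measurable]: "(\<lambda>z. ?h (A z)) \<in> borel_measurable (lborel \<Otimes>\<^sub>M lborel)"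
    by (simp add: lborel_prod)
  have hP [measurable]: "(\<lambda>z. ennreal (polar_weight z) * indicator B (polar L z)) \<in> borel_measurable (lborel \<Otimes>\<^sub>M lborel)"
    by (simp add: lborel_prod)
  have slice: "(\<integral>\<^sup>+y. ?h (A (y, r)) \<partial>lborel) = (\<integral>\<^sup>+y. ennreal (polar_weight (y, r)) * indicator B (polar L (y, r)) \<partial>lborel)" for r
  proof (cases "r > 0")
    case False
    have "depth (A (y, r)) = r" for y by (simp add: A_def depth_def inner_diff_left inner_add_left L ww)
    then have "A (y, r) \<notin> infinite_cone" for y using False by (simp add: infinite_cone_def)
    then show ?thesis using False by (simp add: polar_weight_def)
  next
    case True
    have Ap: "A ((r / s) *\<^sub>R y, r) = polar L (y, r)" for y
      using s by (simp add: A_def polar_def linear_scale[OF L(1)] scaleR_diff_right)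
    have "(\<integral>\<^sup>+y. ?h (A (y, r)) \<partial>lborel) = ennreal ((r / s) ^ DIM(real^2)) * (\<integral>\<^sup>+y. ?h (A ((r / s) *\<^sub>R y, r)) \<partial>lborel)"
    proof (rule nn_integral_lborel_scale)
      have "(\<lambda>y. (y, r)) \<in> borel_measurable borel" by (intro borel_measurable_continuous_onI continuous_intros)
      then show "(\<lambda>y. ?h (A (y, r))) \<in> borel_measurable borel" by measurable
    qed (use True s in simp)
    also have "\<dots> = (\<integral>\<^sup>+y. ennreal ((r / s)\<^sup>2) * ?h (polar L (y, r)) \<partial>lborel)"
    proof (subst nn_integral_cmult)
      have "(\<lambda>y. (y, r)) \<in> borel_measurable borel" by (intro borel_measurable_continuous_onI continuous_intros)
      then show "(\<lambda>y. ?h (polar L (y, r))) \<in> borel_measurable lborel" by measurable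
    qed (simp add: Ap)
    also have "\<dots> = (\<integral>\<^sup>+y. ennreal (polar_weight (y, r)) * indicator B (polar L (y, r)) \<partial>lborel)"
      using True polar_cone[of "(_, r)"] by (intro nn_integral_cong) (auto simp: polar_weight_def indicator_def)
    finally show ?thesis .
  qed
  have "emeasure ?N B = (\<integral>\<^sup>+x. ?h x \<partial>lborel)" by (simp add: emeasure_density)
  also have "\<dots> = (\<integral>\<^sup>+x. ?h x \<partial>distr lborel borel A)"
    using lborel_distr_isometry(1)[of A, OF A] by simp
  also have "\<dots> = (\<integral>\<^sup>+z. ?h (A z) \<partial>(lborel \<Otimes>\<^sub>M lborel))" by (simp add: nn_integral_distr lborel_prod)
  also have "\<dots> = (\<integral>\<^sup>+r. \<integral>\<^sup>+y. ?h (A (y, r)) \<partial>lborel \<partial>lborel)"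
    by (rule lborel_pair.nn_integral_snd[OF hA, symmetric])
  also have "\<dots> = (\<integral>\<^sup>+r. \<integral>\<^sup>+y. ennreal (polar_weight (y, r)) * indicator B (polar L (y, r)) \<partial>lborel \<partial>lborel)"
    by (simp only: slice)
  also have "\<dots> = (\<integral>\<^sup>+z. ennreal (polar_weight z) * indicator B (polar L z) \<partial>(lborel \<Otimes>\<^sub>M lborel))"
    by (rule lborel_pair.nn_integral_snd[OF hP])
  also have "\<dots> = emeasure ?M B"
  proof -
    have "emeasure ?M B = (\<integral>\<^sup>+x. indicator B x \<partial>?M)" by simp
    also have "\<dots> = (\<integral>\<^sup>+z. indicator B (polar L z) \<partial>(density lborel (\<lambda>z. ennreal (polar_weight z))))"
      by (rule nn_integral_distr) simp_all
    also have "\<dots> = (\<integral>\<^sup>+z. ennreal (polar_weight z) * indicator B (polar L z) \<partial>lborel)"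
      by (rule nn_integral_density) simp_all
    finally show ?thesis by (simp add: lborel_prod)
  qed
  finally show "emeasure ?M B = emeasure ?N B" by simp
qed simp

lemma polar_weight_nonneg: "0 \<le> polar_weight z"
  by (simp add: polar_weight_def)

text \<open>The change of variables for signed and complex integrands; the equivalence moves
  integrability and value together, in either direction.\<close>

lemma has_bochner_cone:
  fixes f :: "real^3 \<Rightarrow> 'b::euclidean_space"
  assumes [measurable]: "f \<in> borel_measurable borel"
  shows "has_bochner_integral lborel (\<lambda>x. indicator infinite_cone x *\<^sub>R f x) I \<longleftrightarrow>
    has_bochner_integral lborel (\<lambda>z. polar_weight z *\<^sub>R f (polar L z)) I"
proof -
  have [measurable]: "infinite_cone \<in> sets borel" using open_infinite_cone by simp
  have "has_bochner_integral lborel (\<lambda>x. indicator infinite_cone x *\<^sub>R f x) I \<longleftrightarrow>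
      has_bochner_integral (density lborel (\<lambda>x. ennreal (indicator infinite_cone x))) f I"
    by (simp add: has_bochner_integral_iff integrable_density integral_density)
  also have "density lborel (\<lambda>x. ennreal (indicator infinite_cone x)) =
      distr (density lborel (\<lambda>z. ennreal (polar_weight z))) borel (polar L)"
    by (simp add: distr_polar ennreal_indicator)
  also have "has_bochner_integral (distr (density lborel (\<lambda>z. ennreal (polar_weight z))) borel (polar L)) f I \<longleftrightarrow>
      has_bochner_integral lborel (\<lambda>z. polar_weight z *\<^sub>R f (polar L z)) I"
    by (simp add: has_bochner_integral_iff integrable_distr_eq integral_distr integrable_density integral_density polar_weight_nonneg)
  finally show ?thesis .
qed

end

end

section \<open>Expansion at the vertex\<close>

lemma has_bochner_integral_product_nonneg:
  fixes f :: "'a::euclidean_space \<Rightarrow> real" and g :: "'b::euclidean_space \<Rightarrow> real"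
  assumes f: "has_bochner_integral lborel f a" "\<And>x. 0 \<le> f x" and g: "has_bochner_integral lborel g b" "\<And>x. 0 \<le> g x"
  shows "has_bochner_integral lborel (\<lambda>z. f (fst z) * g (snd z)) (a * b)"
proof (rule has_bochner_integral_nn_integral)
  have [measurable]: "f \<in> borel_measurable lborel" "g \<in> borel_measurable lborel"
    using f(1) g(1) by (auto simp: has_bochner_integral_iff)
  have a: "(\<integral>\<^sup>+x. f x \<partial>lborel) = ennreal a" "a \<ge> 0"
    using f nn_integral_eq_integral[of lborel f] by (auto simp: has_bochner_integral_iff)
  have b: "(\<integral>\<^sup>+x. g x \<partial>lborel) = ennreal b" "b \<ge> 0"
    using g nn_integral_eq_integral[of lborel g] by (auto simp: has_bochner_integral_iff)
  have m: "(\<lambda>z. f (fst z) * g (snd z)) \<in> borel_measurable (lborel \<Otimes>\<^sub>M lborel)" by measurable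
  then show "(\<lambda>z. f (fst z) * g (snd z)) \<in> borel_measurable lborel" by (simp add: lborel_prod)
  show "0 \<le> a * b" using a b by simp
  have "(\<integral>\<^sup>+z. ennreal (f (fst z) * g (snd z)) \<partial>lborel) = (\<integral>\<^sup>+y. \<integral>\<^sup>+x. ennreal (f (fst (x, y)) * g (snd (x, y))) \<partial>lborel \<partial>lborel)"
    using lborel_pair.nn_integral_snd[of "\<lambda>z. ennreal (f (fst z) * g (snd z))"] m by (simp add: lborel_prod)
  also have "\<dots> = (\<integral>\<^sup>+y. \<integral>\<^sup>+x. ennreal (g y) * ennreal (f x) \<partial>lborel \<partial>lborel)"
    using f(2) g(2) by (simp add: ennreal_mult mult.commute)
  also have "\<dots> = (\<integral>\<^sup>+y. ennreal a * ennreal (g y) \<partial>lborel)"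
    by (intro nn_integral_cong, subst nn_integral_cmult) (simp_all add: a mult.commute)
  also have "\<dots> = ennreal (a * b)" using a(2) by (simp add: nn_integral_cmult b ennreal_mult)
  finally show "(\<integral>\<^sup>+z. ennreal (f (fst z) * g (snd z)) \<partial>lborel) = ennreal (a * b)" .
qed (use f g in auto)

lemma has_bochner_integral_lebesgue:
  fixes f :: "'a::euclidean_space \<Rightarrow> 'b::{banach, second_countable_topology}"
  assumes "has_bochner_integral lborel f I"
  shows "has_bochner_integral lebesgue f I"
  using assms borel_measurable_has_bochner_integral[OF assms]
  by (simp add: has_bochner_integral_iff integrable_completion integral_completion)

lemma norm_exp_i_diff: "cmod (exp (\<i> * complex_of_real x) - exp (\<i> * complex_of_real y)) \<le> \<bar>x - y\<bar>"
proof -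
  have "exp (\<i> * complex_of_real x) - exp (\<i> * complex_of_real y) =
      exp (\<i> * complex_of_real y) * (exp (\<i> * complex_of_real (x - y)) - 1)"
    by (simp add: exp_diff right_diff_distrib)
  then have "cmod (exp (\<i> * complex_of_real x) - exp (\<i> * complex_of_real y)) = cmod (exp (\<i> * complex_of_real (x - y)) - 1)"
    by (simp add: norm_mult)
  also have "\<dots> = 2 * \<bar>sin ((x - y) / 2)\<bar>" by (rule dist_exp_i_1)
  also have "\<dots> \<le> \<bar>x - y\<bar>" using abs_sin_x_le_abs_x[of "(x - y) / 2"] by simp
  finally show ?thesis .
qed

text \<open>Fourth power of \<open>t \<le> exp t\<close> at \<open>t = \<tau> * d / 4\<close>; 256
  is 4^4. Using one power more than the cube leaves the factor \<open>1 / \<tau>\<close>.\<close>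

lemma cube_exp_bound:
  fixes \<tau> d :: real
  assumes "\<tau> > 0" "d > 0"
  shows "\<tau> ^ 3 * exp (- \<tau> * d) \<le> 256 / d ^ 4 / \<tau>"
proof -
  have "\<tau> * d / 4 \<le> exp (\<tau> * d / 4)" using exp_ge_add_one_self[of "\<tau> * d / 4"] by linarith
  then have "(\<tau> * d / 4) ^ 4 \<le> exp (\<tau> * d / 4) ^ 4" using assms by (intro power_mono) auto
  also have "\<dots> = exp (\<tau> * d)" using exp_of_nat_mult[of 4 "\<tau> * d / 4"] by simp
  finally have "(\<tau> * d) ^ 4 \<le> 256 * exp (\<tau> * d)" by (simp add: power_divide)
  then have "(\<tau> * d) ^ 4 * exp (- \<tau> * d) \<le> 256" by (simp add: exp_minus field_simps)
  then show ?thesis using assms by (simp add: field_simps power_mult_distrib power4_eq_xxxx power3_eq_cube)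
qed

text \<open>With \<open>t = \<tau> * r\<close> this is \<open>t powr \<alpha> \<le> 1 + t\<close>.
  It trades a fractional power for moments of order 0 and 1, which are known exactly.\<close>

lemma powr_le_scaled:
  fixes r \<tau> \<alpha> :: real
  assumes "r \<ge> 0" "\<tau> > 0" "0 < \<alpha>" "\<alpha> \<le> 1"
  shows "r powr \<alpha> \<le> \<tau> powr (- \<alpha>) * (1 + \<tau> * r)"
proof -
  have "(\<tau> * r) powr \<alpha> \<le> 1 + \<tau> * r"
  proof (cases "\<tau> * r \<le> 1")
    case True
    then have "(\<tau> * r) powr \<alpha> \<le> 1" using assms by (intro powr_le1) auto
    moreover have "0 \<le> \<tau> * r" using assms by simp
    ultimately show ?thesis by linarith
  next
    case False
    then have "(\<tau> * r) powr \<alpha> \<le> (\<tau> * r) powr 1" using assms by (intro powr_mono) auto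
    then show ?thesis using False by simp
  qed
  then have "\<tau> powr (- \<alpha>) * (\<tau> powr \<alpha> * r powr \<alpha>) \<le> \<tau> powr (- \<alpha>) * (1 + \<tau> * r)"
    using assms by (intro mult_left_mono) (auto simp: powr_mult)
  moreover have "\<tau> powr (- \<alpha>) * (\<tau> powr \<alpha> * r powr \<alpha>) = r powr \<alpha>"
    using assms by (simp add: mult.assoc[symmetric] powr_add[symmetric])
  ultimately show ?thesis by simp
qed

text \<open>The difference times the sum of the root and \<tau> is \<open>k\<^sup>2\<close>, and the
  sum is at least 1.\<close>

lemma sqrt_sum_squares_diff:
  fixes \<tau> k :: real
  assumes "\<tau> \<ge> 1"
  shows "sqrt (\<tau>\<^sup>2 + k\<^sup>2) \<ge> \<tau>" "sqrt (\<tau>\<^sup>2 + k\<^sup>2) - \<tau> \<le> k\<^sup>2"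
proof -
  let ?\<sigma> = "sqrt (\<tau>\<^sup>2 + k\<^sup>2)"
  show ge: "?\<sigma> \<ge> \<tau>" using assms by (intro real_le_rsqrt) simp
  have "(?\<sigma> - \<tau>) * 1 \<le> (?\<sigma> - \<tau>) * (?\<sigma> + \<tau>)" using ge assms by (intro mult_left_mono; linarith)
  also have "\<dots> = ?\<sigma>\<^sup>2 - \<tau>\<^sup>2" by (simp add: power2_eq_square algebra_simps)
  also have "\<dots> = k\<^sup>2" by simp
  finally show "?\<sigma> - \<tau> \<le> k\<^sup>2" by simp
qed

section \<open>Moments and phase integral of the cone\<close>

context truncated_cone begin

text \<open>The exponential solution divided by its value at the vertex. The frequency
  \<open>t\<close> is kept separate from \<tau> so that
  \<open>sqrt (\<tau>\<^sup>2 + k\<^sup>2)\<close> and \<tau> itself can both be inserted.\<close>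

definition phase :: "real \<Rightarrow> real \<Rightarrow> real^3 \<Rightarrow> real^3 \<Rightarrow> complex" where
  "phase \<tau> t \<theta> x = exp (complex_of_real (- \<tau> * depth x) + \<i> * complex_of_real (t * ((x - p) \<bullet> \<theta>)))"

lemma norm_phase: "cmod (phase \<tau> t \<theta> x) = exp (- \<tau> * depth x)"
  by (simp add: phase_def)

lemma continuous_phase: "continuous_on S (phase \<tau> t \<theta>)"
  unfolding phase_def by (intro continuous_intros continuous_depth)

text \<open>In polar coordinates the integrand splits into the indicator of the cross section and
  \<open>r ^ (n + 2) * exp (- \<tau> * r)\<close>. The constant is the area of the section over
  \<open>s\<^sup>2\<close>, the same for all \<tau> and \<open>n\<close>.\<close>

lemma cone_moment:
  "\<exists>A\<ge>0. \<forall>\<tau> n. \<tau> > 0 \<longrightarrow> has_bochner_integral lborel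
    (\<lambda>x. indicator infinite_cone x * (depth x ^ n * exp (- \<tau> * depth x))) (A * (fact (n + 2) / \<tau> ^ (n + 3)))"
proof -
  obtain L :: "real^2 \<Rightarrow> real^3" where L: "linear L" "\<And>y z. L y \<bullet> L z = y \<bullet> z" "\<And>y. L y \<bullet> \<omega> = 0"
    using plane_param by metis
  let ?P = "cross_section L"
  define A where "A = measure lborel ?P / s\<^sup>2"
  show ?thesis
  proof (intro exI conjI allI impI)
    show "A \<ge> 0" by (simp add: A_def)
    fix \<tau> :: real and n :: nat assume \<tau>: "\<tau> > 0"
    have [measurable]: "?P \<in> sets borel" using open_section[OF L] by simp
    have P: "has_bochner_integral lborel (\<lambda>y. indicator ?P y * (1 / s\<^sup>2)) (measure lborel ?P * (1 / s\<^sup>2))"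
      using finite_section[OF L] by (intro has_bochner_integral_mult_left has_bochner_integral_real_indicator) auto
    have "has_bochner_integral lborel (\<lambda>z. (indicator ?P (fst z) * (1 / s\<^sup>2)) *
        (indicator {0<..} (snd z) * (snd z ^ (n + 2) * exp (- \<tau> * snd z)))) (measure lborel ?P * (1 / s\<^sup>2) * (fact (n + 2) / \<tau> ^ Suc (n + 2)))"
      by (rule has_bochner_integral_product_nonneg[OF P _ power_exp_moment[OF \<tau>]]) (auto simp: indicator_def)
    then have "has_bochner_integral lborel (\<lambda>z. polar_weight L z *\<^sub>R (depth (polar L z) ^ n * exp (- \<tau> * depth (polar L z))))
        (A * (fact (n + 2) / \<tau> ^ (n + 3)))"
    proof (rule has_bochner_integral_cong[THEN iffD1, rotated -1])
      show "(indicator ?P (fst z) * (1 / s\<^sup>2)) * (indicator {0<..} (snd z) * (snd z ^ (n + 2) * exp (- \<tau> * snd z))) =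
        polar_weight L z *\<^sub>R (depth (polar L z) ^ n * exp (- \<tau> * depth (polar L z)))" for z
        by (simp add: polar_weight_def[OF L] depth_polar[OF L] power_add power_divide power2_eq_square)
    qed (simp_all add: A_def numeral_3_eq_3)
    then have "has_bochner_integral lborel (\<lambda>x. indicator infinite_cone x *\<^sub>R (depth x ^ n * exp (- \<tau> * depth x))) (A * (fact (n + 2) / \<tau> ^ (n + 3)))"
      by (subst has_bochner_cone[OF L]) (auto intro!: borel_measurable_continuous_onI continuous_intros continuous_depth)
    then show "has_bochner_integral lborel (\<lambda>x. indicator infinite_cone x * (depth x ^ n * exp (- \<tau> * depth x))) (A * (fact (n + 2) / \<tau> ^ (n + 3)))"
      by simp
  qed
qed

text \<open>On the ray through \<open>y\<close> the exponent is \<open>- z r\<close> with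
  \<open>z = \<tau> (1 - i b)\<close> and \<open>b = (L y \<bullet> \<theta>) / s\<close>, so
  \<open>laplace_square\<close> applies. The left side does not mention \<open>s\<close>; hence
  \<open>cone_const\<close> has the same value at all heights between 0 and \<delta>.\<close>

lemma cone_phase:
  assumes \<tau>: "\<tau> > 0" and \<theta>: "\<omega> \<bullet> \<theta> = 0"
  shows "has_bochner_integral lborel (\<lambda>x. indicator infinite_cone x *\<^sub>R phase \<tau> \<tau> \<theta> x)
    (cone_const p \<omega> \<delta> Q \<theta> s / complex_of_real (\<tau> ^ 3))"
proof -
  obtain L :: "real^2 \<Rightarrow> real^3" where L: "linear L" "\<And>y z. L y \<bullet> L z = y \<bullet> z" "\<And>y. L y \<bullet> \<omega> = 0"
    and plane: "\<And>f :: real^3 \<Rightarrow> complex. f \<in> borel_measurable borel \<Longrightarrow>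
      (LINT x|plane_measure \<omega> (p \<bullet> \<omega> - s). f x) = (LINT y|lborel. f (p - s *\<^sub>R \<omega> + L y))"
    using plane_param by metis
  let ?P = "cross_section L"
  have [measurable]: "infinite_cone \<in> sets borel" using open_infinite_cone by simp
  have pm [measurable]: "phase \<tau> \<tau> \<theta> \<in> borel_measurable borel"
    by (rule borel_measurable_continuous_onI[OF continuous_phase])
  obtain A where A: "has_bochner_integral lborel
    (\<lambda>x. indicator infinite_cone x * (depth x ^ 0 * exp (- \<tau> * depth x))) A"
    using cone_moment \<tau> by blast
  have i: "integrable lborel (\<lambda>x. indicator infinite_cone x *\<^sub>R phase \<tau> \<tau> \<theta> x)"
  proof (rule Bochner_Integration.integrable_bound)
    show "integrable lborel (\<lambda>x. indicator infinite_cone x * (depth x ^ 0 * exp (- \<tau> * depth x)))"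
      using A by (simp add: has_bochner_integral_iff)
    show "AE x in lborel. norm (indicator infinite_cone x *\<^sub>R phase \<tau> \<tau> \<theta> x)
        \<le> norm (indicator infinite_cone x * (depth x ^ 0 * exp (- \<tau> * depth x)))"
      by (simp add: norm_phase)
  qed simp
  define I where "I = (LINT z|lborel. polar_weight L z *\<^sub>R phase \<tau> \<tau> \<theta> (polar L z))"
  have hb0: "has_bochner_integral lborel (\<lambda>z. polar_weight L z *\<^sub>R phase \<tau> \<tau> \<theta> (polar L z))
      (LINT x|lborel. indicator infinite_cone x *\<^sub>R phase \<tau> \<tau> \<theta> x)"
    by (rule has_bochner_cone[OF L pm, THEN iffD1]) (rule has_bochner_integral_integrable[OF i])
  have iw: "integrable lborel (\<lambda>z. polar_weight L z *\<^sub>R phase \<tau> \<tau> \<theta> (polar L z))"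
    by (rule integrable.intros[OF hb0])
  have hb: "has_bochner_integral lborel (\<lambda>x. indicator infinite_cone x *\<^sub>R phase \<tau> \<tau> \<theta> x) I"
    unfolding I_def by (rule has_bochner_cone[OF L pm, THEN iffD2]) (rule has_bochner_integral_integrable[OF iw])
  define b where "b y = (L y \<bullet> \<theta>) / s" for y
  have ph: "phase \<tau> \<tau> \<theta> (polar L (y, r)) = exp (- (complex_of_real \<tau> * (1 - \<i> * complex_of_real (b y))) * complex_of_real r)" for y r
  proof -
    have "(polar L (y, r) - p) \<bullet> \<theta> = r * b y" using s \<theta> by (simp add: polar_def b_def inner_diff_left)
    then show ?thesis by (simp add: phase_def depth_polar[OF L] algebra_simps)
  qed
  have inner: "(LINT r|lborel. polar_weight L (y, r) *\<^sub>R phase \<tau> \<tau> \<theta> (polar L (y, r))) =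
      (2 * complex_of_real s / complex_of_real (\<tau> ^ 3)) * (indicator ?P y *\<^sub>R (1 / (complex_of_real s - \<i> * complex_of_real (L y \<bullet> \<theta>)) ^ 3))" for y
  proof -
    let ?z = "complex_of_real \<tau> * (1 - \<i> * complex_of_real (b y))"
    have "Re ?z > 0" using \<tau> by simp
    note lap = laplace_square[OF this]
    have "(LINT r|lborel. polar_weight L (y, r) *\<^sub>R phase \<tau> \<tau> \<theta> (polar L (y, r))) =
        (LINT r|lborel. (indicator ?P y / s\<^sup>2) *\<^sub>R (indicator {0<..} r *\<^sub>R (complex_of_real (r\<^sup>2) * exp (- ?z * complex_of_real r))))"
      by (intro Bochner_Integration.integral_cong refl)
        (simp add: ph polar_weight_def[OF L] power_divide scaleR_conv_of_real)
    also have "\<dots> = (indicator ?P y / s\<^sup>2) *\<^sub>R (2 / ?z ^ 3)"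
      unfolding lap(2)[symmetric] by (rule integral_scaleR_right)
    \<comment> \<open>Extracting \<open>s\<close> from \<open>1 - i b\<close> gives
      \<open>s ^ 3\<close>: two powers cancel the \<open>s\<^sup>2\<close> of the weight, and the
      third is the prefactor of \<open>cone_const\<close>.\<close>
    also have "2 / ?z ^ 3 = (2 * complex_of_real s / complex_of_real (\<tau> ^ 3)) * (complex_of_real (s\<^sup>2) / (complex_of_real s - \<i> * complex_of_real (L y \<bullet> \<theta>)) ^ 3)"
    proof -
      have "complex_of_real s - \<i> * complex_of_real (L y \<bullet> \<theta>) = complex_of_real s * (1 - \<i> * complex_of_real (b y))"
        using s by (simp add: b_def algebra_simps)
      then show ?thesis using s by (simp add: power_mult_distrib power2_eq_square power3_eq_cube)
    qed
    finally show ?thesis using s by (simp add: scaleR_conv_of_real indicator_def)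
  qed
  have "I = (LINT y|lborel. (2 * complex_of_real s / complex_of_real (\<tau> ^ 3)) * (indicator ?P y *\<^sub>R (1 / (complex_of_real s - \<i> * complex_of_real (L y \<bullet> \<theta>)) ^ 3)))"
    unfolding I_def integral_fst_lborel(1)[OF iw] inner ..
  also have "\<dots> = (2 * complex_of_real s / complex_of_real (\<tau> ^ 3)) * (LINT y|lborel. indicator ?P y *\<^sub>R (1 / (complex_of_real s - \<i> * complex_of_real (L y \<bullet> \<theta>)) ^ 3))"
    by (rule integral_mult_right_zero)
  also have "(LINT y|lborel. indicator ?P y *\<^sub>R (1 / (complex_of_real s - \<i> * complex_of_real (L y \<bullet> \<theta>)) ^ 3)) =
    (LINT x|plane_measure \<omega> (p \<bullet> \<omega> - s). indicator (cone_set p \<omega> \<delta> Q \<inter> {x. x \<bullet> \<omega> = p \<bullet> \<omega> - s}) x *\<^sub>R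
        (1 / (complex_of_real s - \<i> * complex_of_real ((x - p) \<bullet> \<theta>)) ^ 3))"
  proof (subst plane)
    let ?C = "cone_set p \<omega> \<delta> Q \<inter> {x. x \<bullet> \<omega> = p \<bullet> \<omega> - s}"
    have "closed {x. x \<bullet> \<omega> = p \<bullet> \<omega> - s}" by (intro closed_Collect_eq continuous_intros)
    then have [measurable]: "?C \<in> sets borel" using open_cone by auto
    have "complex_of_real s - \<i> * complex_of_real t \<noteq> 0" for t using s by (auto simp: complex_eq_iff)
    then have "continuous_on UNIV (\<lambda>x. 1 / (complex_of_real s - \<i> * complex_of_real ((x - p) \<bullet> \<theta>)) ^ 3)"
      by (intro continuous_intros) auto
    then have "(\<lambda>x. 1 / (complex_of_real s - \<i> * complex_of_real ((x - p) \<bullet> \<theta>)) ^ 3) \<in> borel_measurable borel"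
      by (rule borel_measurable_continuous_onI)
    then show "(\<lambda>x. indicator ?C x *\<^sub>R (1 / (complex_of_real s - \<i> * complex_of_real ((x - p) \<bullet> \<theta>)) ^ 3)) \<in> borel_measurable borel"
      by measurable
    show "(LINT y|lborel. indicator ?P y *\<^sub>R (1 / (complex_of_real s - \<i> * complex_of_real (L y \<bullet> \<theta>)) ^ 3)) =
      (LINT y|lborel. indicator ?C (p - s *\<^sub>R \<omega> + L y) *\<^sub>R (1 / (complex_of_real s - \<i> * complex_of_real ((p - s *\<^sub>R \<omega> + L y - p) \<bullet> \<theta>)) ^ 3))"
    proof (intro Bochner_Integration.integral_cong refl)
      fix y
      have d: "depth (p - s *\<^sub>R \<omega> + L y) = s" by (simp add: depth_def inner_diff_left inner_add_left L ww)
      have 1: "p - s *\<^sub>R \<omega> + L y \<in> ?C \<longleftrightarrow> y \<in> ?P"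
        using s by (auto simp: cone_set_eq cross_section_def d inner_diff_left inner_add_left L ww)
      have 2: "(p - s *\<^sub>R \<omega> + L y - p) \<bullet> \<theta> = L y \<bullet> \<theta>" using \<theta> by (simp add: inner_diff_left inner_add_left)
      show "indicator ?P y *\<^sub>R (1 / (complex_of_real s - \<i> * complex_of_real (L y \<bullet> \<theta>)) ^ 3) =
        indicator ?C (p - s *\<^sub>R \<omega> + L y) *\<^sub>R (1 / (complex_of_real s - \<i> * complex_of_real ((p - s *\<^sub>R \<omega> + L y - p) \<bullet> \<theta>)) ^ 3)"
        unfolding 2 indicator_def 1 ..
    qed
  qed
  finally have "I = cone_const p \<omega> \<delta> Q \<theta> s / complex_of_real (\<tau> ^ 3)"
    by (simp add: cone_const_def set_lebesgue_integral_def)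
  then show ?thesis using hb by simp
qed

section \<open>Freezing the amplitude at the vertex\<close>

text \<open>\<open>G\<close> is the source times an amplitude and \<open>g0\<close> its value at the
  vertex. The constant is obtained before \<tau>, \<theta>, \<open>G\<close> and \<open>g0\<close>
  are introduced, which is where the uniformity in \<theta> comes from.\<close>

lemma cone_estimate:
  fixes \<rho> :: "real^3 \<Rightarrow> complex" and \<delta>' \<alpha> k B C :: real
  assumes D: "D \<in> sets lebesgue" and \<rho>: "set_integrable lebesgue D \<rho>" and \<delta>': "0 < \<delta>'"
    and D0: "\<And>x. x \<in> D \<Longrightarrow> depth x > 0"
    and Dcone: "\<And>x. 0 < depth x \<Longrightarrow> depth x < \<delta>' \<Longrightarrow> x \<in> D \<longleftrightarrow> x \<in> infinite_cone"
    and \<alpha>: "0 < \<alpha>" "\<alpha> \<le> 1" and B: "B \<ge> 0" and C: "C \<ge> 0"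
  obtains K where "\<And>\<tau> \<theta> G g0. \<tau> \<ge> 1 \<Longrightarrow> norm \<theta> = 1 \<Longrightarrow> \<omega> \<bullet> \<theta> = 0 \<Longrightarrow> set_borel_measurable lebesgue D G \<Longrightarrow>
    (\<And>x. x \<in> D \<Longrightarrow> cmod (G x) \<le> B * cmod (\<rho> x)) \<Longrightarrow> cmod g0 \<le> B \<Longrightarrow>
    (AE x in lebesgue. x \<in> D \<and> depth x < \<delta>' \<longrightarrow> cmod (G x - g0) \<le> C * (depth x powr \<alpha> + 1 / \<tau>)) \<Longrightarrow>
    cmod (complex_of_real (\<tau> ^ 3) * (LINT x:D|lebesgue. G x * phase \<tau> (sqrt (\<tau>\<^sup>2 + k\<^sup>2)) \<theta> x) - g0 * cone_const p \<omega> \<delta> Q \<theta> s)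
      \<le> K * \<tau> powr (- \<alpha>)"
proof -
  from cone_moment obtain A where "A \<ge> 0" and A0: "\<forall>\<tau> n. \<tau> > 0 \<longrightarrow> has_bochner_integral lborel
    (\<lambda>x. indicator infinite_cone x * (depth x ^ n * exp (- \<tau> * depth x))) (A * (fact (n + 2) / \<tau> ^ (n + 3)))"
    by blast
  note A = \<open>A \<ge> 0\<close> A0[rule_format]
  obtain M where M: "M \<ge> 0" "\<And>x. x \<in> infinite_cone \<Longrightarrow> norm (x - p) \<le> M * depth x" using infinite_cone_bound by metis
  \<comment> \<open>One \<open>C\<close> each for the terms \<open>depth x powr \<alpha>\<close> and
    \<open>1 / \<tau>\<close>, then the frequency change, then the tail of the cone beyond depth
    \<delta>'.\<close>
  define C1 where "C1 = 2 * C + B * k\<^sup>2 * M + B / \<delta>'"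
  define R where "R = (LINT x|lebesgue. indicator D x * cmod (\<rho> x))"
  have iR: "integrable lebesgue (\<lambda>x. indicator D x * cmod (\<rho> x))"
    using integrable_norm[OF \<rho>[unfolded set_integrable_def]] by simp
  have R: "R \<ge> 0" unfolding R_def by (intro integral_nonneg_AE) simp
  have C1: "C1 \<ge> 0" using B C M \<delta>' by (simp add: C1_def)
  show ?thesis
  proof (rule that[of "256 * B * R / \<delta>' ^ 4 + 8 * A * C1"])
    fix \<tau> :: real and \<theta> G g0
    assume \<tau>: "\<tau> \<ge> 1" and \<theta>: "norm \<theta> = 1" "\<omega> \<bullet> \<theta> = 0" and Gm: "set_borel_measurable lebesgue D G"
      and GB: "\<And>x. x \<in> D \<Longrightarrow> cmod (G x) \<le> B * cmod (\<rho> x)" and g0: "cmod g0 \<le> B"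
      and ae: "AE x in lebesgue. x \<in> D \<and> depth x < \<delta>' \<longrightarrow> cmod (G x - g0) \<le> C * (depth x powr \<alpha> + 1 / \<tau>)"
    define \<sigma> where "\<sigma> = sqrt (\<tau>\<^sup>2 + k\<^sup>2)"
    have \<sigma>: "\<bar>\<sigma> - \<tau>\<bar> \<le> k\<^sup>2" using sqrt_sum_squares_diff[OF \<tau>, of k] by (simp add: \<sigma>_def)
    have \<tau>0: "\<tau> > 0" using \<tau> by simp
    have inv: "1 / \<tau> \<le> \<tau> powr (- \<alpha>)"
      using powr_mono[of "- 1" "- \<alpha>" \<tau>] \<tau> \<alpha> by (simp add: powr_minus_divide)
    define P where "P x = indicator infinite_cone x *\<^sub>R phase \<tau> \<tau> \<theta> x" for x
    define T where "T x = indicator D x *\<^sub>R (G x * phase \<tau> \<sigma> \<theta> x)" for x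
    \<comment> \<open>A majorant for all errors on the cone. Its integral is
      \<open>8 * A / \<tau> ^ 3\<close>, with 8 = 2! + 3! from the moments of order 0 and 1.\<close>
    define N where "N x = indicator infinite_cone x * ((1 + \<tau> * depth x) * exp (- \<tau> * depth x))" for x
    \<comment> \<open>The first summand bounds the contribution of \<open>D\<close> at depth at least \<open>\<delta>'\<close>, the second one everything
      else: on the truncated tail of the cone because \<open>1 \<le> depth x / \<delta>'\<close> there.\<close>
    define H where "H x = B * exp (- \<tau> * \<delta>') * (indicator D x * cmod (\<rho> x)) + C1 * \<tau> powr (- \<alpha>) * N x" for x
    have hP: "has_bochner_integral lebesgue P (cone_const p \<omega> \<delta> Q \<theta> s / complex_of_real (\<tau> ^ 3))"
      unfolding P_def[abs_def] by (rule has_bochner_integral_lebesgue[OF cone_phase[OF \<tau>0 \<theta>(2)]])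
    have hN: "has_bochner_integral lebesgue N (8 * A / \<tau> ^ 3)"
    proof -
      have "has_bochner_integral lborel (\<lambda>x. indicator infinite_cone x * (depth x ^ 0 * exp (- \<tau> * depth x)) +
          \<tau> * (indicator infinite_cone x * (depth x ^ 1 * exp (- \<tau> * depth x))))
          (A * (fact (0 + 2) / \<tau> ^ (0 + 3)) + \<tau> * (A * (fact (1 + 2) / \<tau> ^ (1 + 3))))"
        by (intro has_bochner_integral_add has_bochner_integral_mult_right A \<tau>0)
      moreover have "A * (fact (0 + 2) / \<tau> ^ (0 + 3)) + \<tau> * (A * (fact (1 + 2) / \<tau> ^ (1 + 3))) = 8 * A / \<tau> ^ 3"
        using \<tau>0 by (simp add: fact_numeral power4_eq_xxxx power3_eq_cube field_simps)
      moreover have "(\<lambda>x. indicator infinite_cone x * (depth x ^ 0 * exp (- \<tau> * depth x)) +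
          \<tau> * (indicator infinite_cone x * (depth x ^ 1 * exp (- \<tau> * depth x)))) = N"
        by (simp add: N_def[abs_def] fun_eq_iff algebra_simps)
      ultimately have "has_bochner_integral lborel N (8 * A / \<tau> ^ 3)" by simp
      then show ?thesis by (rule has_bochner_integral_lebesgue)
    qed
    have iT: "integrable lebesgue T"
    proof (rule Bochner_Integration.integrable_bound[OF iR[THEN integrable_mult_right, of B]])
      have "(\<lambda>x. (indicator D x *\<^sub>R G x) * phase \<tau> \<sigma> \<theta> x) \<in> borel_measurable lebesgue"
        using Gm measurable_completion[of "phase \<tau> \<sigma> \<theta>" lborel borel] borel_measurable_continuous_onI[OF continuous_phase]
        unfolding set_borel_measurable_def by (intro borel_measurable_times) auto
      then show "T \<in> borel_measurable lebesgue" by (simp add: T_def[abs_def])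
      show "AE x in lebesgue. norm (T x) \<le> norm (B * (indicator D x * cmod (\<rho> x)))"
      proof (rule AE_I2)
        fix x
        show "norm (T x) \<le> norm (B * (indicator D x * cmod (\<rho> x)))"
        proof (cases "x \<in> D")
          case True
          have "exp (- \<tau> * depth x) \<le> 1" using D0[OF True] \<tau>0 by simp
          then have "cmod (G x) * exp (- \<tau> * depth x) \<le> (B * cmod (\<rho> x)) * 1"
            using GB[OF True] B by (intro mult_mono) auto
          then show ?thesis using True B by (simp add: T_def norm_mult norm_phase)
        qed (simp add: T_def)
      qed
    qed
    have bd: "AE x in lebesgue. norm (T x - g0 * P x) \<le> H x"
      using ae
    proof eventually_elim
      case (elim x)
      let ?e = "exp (- \<tau> * depth x)"
      have N0: "0 \<le> C1 * \<tau> powr (- \<alpha>) * N x" using C1 \<tau>0 by (auto simp: N_def indicator_def infinite_cone_def)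
      show ?case
      proof (cases "x \<in> infinite_cone \<and> depth x < \<delta>'")
        case True
        then have r: "depth x > 0" by (simp add: infinite_cone_def)
        have xD: "x \<in> D" using Dcone[OF r] True by simp
        \<comment> \<open>Amplitude and frequency are replaced one after the other; both phases have
          the same modulus \<open>?e\<close>.\<close>
        have "G x * phase \<tau> \<sigma> \<theta> x - g0 * phase \<tau> \<tau> \<theta> x = (G x - g0) * phase \<tau> \<sigma> \<theta> x + g0 * (phase \<tau> \<sigma> \<theta> x - phase \<tau> \<tau> \<theta> x)"
          by (simp add: algebra_simps)
        then have "norm (T x - g0 * P x) \<le> cmod (G x - g0) * ?e + cmod g0 * cmod (phase \<tau> \<sigma> \<theta> x - phase \<tau> \<tau> \<theta> x)"
          using True xD norm_triangle_ineq[of "(G x - g0) * phase \<tau> \<sigma> \<theta> x" "g0 * (phase \<tau> \<sigma> \<theta> x - phase \<tau> \<tau> \<theta> x)"]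
          by (simp add: T_def P_def norm_mult norm_phase)
        also have "\<dots> \<le> (2 * C * \<tau> powr (- \<alpha>) * (1 + \<tau> * depth x)) * ?e + B * ((k\<^sup>2 * M * (\<tau> powr (- \<alpha>) * (1 + \<tau> * depth x))) * ?e)"
        proof (intro add_mono mult_mono g0)
          have "cmod (G x - g0) \<le> C * (depth x powr \<alpha> + 1 / \<tau>)" using elim xD True by simp
          also have "\<dots> \<le> C * (\<tau> powr (- \<alpha>) * (1 + \<tau> * depth x) + \<tau> powr (- \<alpha>) * (1 + \<tau> * depth x))"
          proof (intro mult_left_mono add_mono C)
            show "depth x powr \<alpha> \<le> \<tau> powr (- \<alpha>) * (1 + \<tau> * depth x)" using r \<tau>0 \<alpha> by (intro powr_le_scaled) auto
            have "\<tau> powr (- \<alpha>) * 1 \<le> \<tau> powr (- \<alpha>) * (1 + \<tau> * depth x)" using r \<tau>0 by (intro mult_left_mono) auto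
            then show "1 / \<tau> \<le> \<tau> powr (- \<alpha>) * (1 + \<tau> * depth x)" using inv by simp
          qed
          finally show "cmod (G x - g0) \<le> 2 * C * \<tau> powr (- \<alpha>) * (1 + \<tau> * depth x)" by (simp add: algebra_simps)
          have dd: "depth x \<le> \<tau> powr (- \<alpha>) * (1 + \<tau> * depth x)"
          proof -
            have "depth x = 1 / \<tau> * (\<tau> * depth x)" using \<tau>0 by simp
            also have "\<dots> \<le> \<tau> powr (- \<alpha>) * (1 + \<tau> * depth x)" using inv r \<tau>0 by (intro mult_mono) auto
            finally show ?thesis .
          qed
          have "phase \<tau> \<sigma> \<theta> x - phase \<tau> \<tau> \<theta> x = complex_of_real ?e *
              (exp (\<i> * complex_of_real (\<sigma> * ((x - p) \<bullet> \<theta>))) - exp (\<i> * complex_of_real (\<tau> * ((x - p) \<bullet> \<theta>))))"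
            unfolding phase_def exp_add exp_of_real by (simp only: right_diff_distrib)
          then have "cmod (phase \<tau> \<sigma> \<theta> x - phase \<tau> \<tau> \<theta> x) = ?e *
             cmod (exp (\<i> * complex_of_real (\<sigma> * ((x - p) \<bullet> \<theta>))) - exp (\<i> * complex_of_real (\<tau> * ((x - p) \<bullet> \<theta>))))"
            by (simp only: norm_mult norm_of_real) simp
          also have "\<dots> \<le> ?e * \<bar>\<sigma> * ((x - p) \<bullet> \<theta>) - \<tau> * ((x - p) \<bullet> \<theta>)\<bar>"
            by (intro mult_left_mono norm_exp_i_diff) simp
          also have "\<bar>\<sigma> * ((x - p) \<bullet> \<theta>) - \<tau> * ((x - p) \<bullet> \<theta>)\<bar> = \<bar>\<sigma> - \<tau>\<bar> * \<bar>(x - p) \<bullet> \<theta>\<bar>"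
            by (simp add: left_diff_distrib[symmetric] abs_mult)
          also have "\<dots> \<le> k\<^sup>2 * (M * depth x)"
          proof (intro mult_mono \<sigma>)
            have "\<bar>(x - p) \<bullet> \<theta>\<bar> \<le> norm (x - p)" using Cauchy_Schwarz_ineq2[of "x - p" \<theta>] \<theta> by simp
            then show "\<bar>(x - p) \<bullet> \<theta>\<bar> \<le> M * depth x" using M(2)[of x] True by simp
          qed auto
          finally have "cmod (phase \<tau> \<sigma> \<theta> x - phase \<tau> \<tau> \<theta> x) \<le> ?e * (k\<^sup>2 * (M * depth x))" by simp
          also have "\<dots> \<le> ?e * (k\<^sup>2 * (M * (\<tau> powr (- \<alpha>) * (1 + \<tau> * depth x))))"
            by (intro mult_left_mono dd M(1)) auto
          finally show "cmod (phase \<tau> \<sigma> \<theta> x - phase \<tau> \<tau> \<theta> x) \<le> k\<^sup>2 * M * (\<tau> powr (- \<alpha>) * (1 + \<tau> * depth x)) * ?e"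
            by (simp only: mult_ac)
        qed (use B C M r \<tau>0 in auto)
        also have "\<dots> = (2 * C + B * k\<^sup>2 * M) * \<tau> powr (- \<alpha>) * N x" using True by (simp add: N_def algebra_simps)
        also have "\<dots> \<le> C1 * \<tau> powr (- \<alpha>) * N x"
          using True r \<tau>0 B \<delta>' by (intro mult_right_mono) (auto simp: C1_def N_def)
        also have "\<dots> \<le> H x" using B by (simp add: H_def)
        finally show ?thesis .
      next
        case False
        \<comment> \<open>Outside the near part of the cone the two integrands are bounded
          separately, as no cancellation is available there.\<close>
        have 1: "norm (T x) \<le> B * exp (- \<tau> * \<delta>') * (indicator D x * cmod (\<rho> x))"
        proof (cases "x \<in> D")
          case True
          then have "\<delta>' \<le> depth x" using False Dcone[OF D0[OF True]] by force
          then have "?e \<le> exp (- \<tau> * \<delta>')" using \<tau>0 by simp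
          then have "cmod (G x) * ?e \<le> (B * cmod (\<rho> x)) * exp (- \<tau> * \<delta>')"
            using GB[OF True] B by (intro mult_mono) auto
          then show ?thesis using True by (simp add: T_def norm_mult norm_phase mult_ac)
        qed (simp add: T_def)
        have 2: "norm (g0 * P x) \<le> C1 * \<tau> powr (- \<alpha>) * N x"
        proof (cases "x \<in> infinite_cone")
          case True
          then have r: "\<delta>' \<le> depth x" using False by simp
          have "cmod g0 \<le> B * (depth x / \<delta>')"
          proof -
            have "B * 1 \<le> B * (depth x / \<delta>')" using r \<delta>' B by (intro mult_left_mono) (auto simp: field_simps)
            then show ?thesis using g0 by simp
          qed
          also have "\<dots> = B / \<delta>' * (1 / \<tau> * (\<tau> * depth x))" using \<tau>0 by simp
          also have "\<dots> \<le> C1 * (\<tau> powr (- \<alpha>) * (1 + \<tau> * depth x))"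
            using B C M \<delta>' inv r \<tau>0 by (intro mult_mono) (auto simp: C1_def)
          finally have "cmod g0 * ?e \<le> C1 * (\<tau> powr (- \<alpha>) * (1 + \<tau> * depth x)) * ?e"
            by (intro mult_right_mono) auto
          then show ?thesis using True by (simp add: P_def N_def norm_mult norm_phase mult_ac)
        qed (simp add: P_def N_def)
        show ?thesis using 1 2 norm_triangle_ineq4[of "T x" "g0 * P x"] by (simp add: H_def)
      qed
    qed
    have iP: "integrable lebesgue P" "(LINT x|lebesgue. P x) = cone_const p \<omega> \<delta> Q \<theta> s / complex_of_real (\<tau> ^ 3)"
      using hP by (auto simp: has_bochner_integral_iff)
    have hH: "has_bochner_integral lebesgue H (B * exp (- \<tau> * \<delta>') * R + C1 * \<tau> powr (- \<alpha>) * (8 * A / \<tau> ^ 3))"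
      unfolding H_def[abs_def] using iR by (intro has_bochner_integral_add has_bochner_integral_mult_right hN)
        (auto simp: has_bochner_integral_iff R_def)
    have "complex_of_real (\<tau> ^ 3) * (LINT x:D|lebesgue. G x * phase \<tau> \<sigma> \<theta> x) - g0 * cone_const p \<omega> \<delta> Q \<theta> s =
      complex_of_real (\<tau> ^ 3) * (LINT x|lebesgue. T x - g0 * P x)"
      using iT iP \<tau>0 by (simp add: T_def[abs_def] set_lebesgue_integral_def algebra_simps)
    then have "cmod (complex_of_real (\<tau> ^ 3) * (LINT x:D|lebesgue. G x * phase \<tau> \<sigma> \<theta> x) - g0 * cone_const p \<omega> \<delta> Q \<theta> s) =
      \<tau> ^ 3 * cmod (LINT x|lebesgue. T x - g0 * P x)"
      using \<tau>0 by (simp add: norm_mult norm_power)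
    also have "\<dots> \<le> \<tau> ^ 3 * (B * exp (- \<tau> * \<delta>') * R + C1 * \<tau> powr (- \<alpha>) * (8 * A / \<tau> ^ 3))"
    proof (rule mult_left_mono)
      have "cmod (LINT x|lebesgue. T x - g0 * P x) \<le> (LINT x|lebesgue. H x)"
      proof (rule order_trans[OF integral_norm_bound integral_mono_AE])
        show "integrable lebesgue (\<lambda>x. norm (T x - g0 * P x))"
          using iT iP by (intro integrable_norm Bochner_Integration.integrable_diff integrable_mult_right)
      qed (use bd hH in \<open>auto simp: has_bochner_integral_iff\<close>)
      then show "cmod (LINT x|lebesgue. T x - g0 * P x) \<le> B * exp (- \<tau> * \<delta>') * R + C1 * \<tau> powr (- \<alpha>) * (8 * A / \<tau> ^ 3)"
        using hH by (simp add: has_bochner_integral_iff)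
    qed (use \<tau>0 in simp)
    also have "\<dots> = B * R * (\<tau> ^ 3 * exp (- \<tau> * \<delta>')) + 8 * A * C1 * \<tau> powr (- \<alpha>)"
      using \<tau>0 by (simp add: field_simps)
    also have "\<dots> \<le> B * R * (256 / \<delta>' ^ 4 * \<tau> powr (- \<alpha>)) + 8 * A * C1 * \<tau> powr (- \<alpha>)"
    proof (intro add_mono mult_left_mono order_refl)
      have "\<tau> ^ 3 * exp (- \<tau> * \<delta>') \<le> 256 / \<delta>' ^ 4 * (1 / \<tau>)" using cube_exp_bound[OF \<tau>0 \<delta>'] by simp
      also have "\<dots> \<le> 256 / \<delta>' ^ 4 * \<tau> powr (- \<alpha>)" using inv \<delta>' by (intro mult_left_mono) auto
      finally show "\<tau> ^ 3 * exp (- \<tau> * \<delta>') \<le> 256 / \<delta>' ^ 4 * \<tau> powr (- \<alpha>)" .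
    qed (use B R A C1 in auto)
    also have "\<dots> = (256 * B * R / \<delta>' ^ 4 + 8 * A * C1) * \<tau> powr (- \<alpha>)" by (simp add: algebra_simps)
    finally show "cmod (complex_of_real (\<tau> ^ 3) * (LINT x:D|lebesgue. G x * phase \<tau> (sqrt (\<tau>\<^sup>2 + k\<^sup>2)) \<theta> x) - g0 * cone_const p \<omega> \<delta> Q \<theta> s)
      \<le> (256 * B * R / \<delta>' ^ 4 + 8 * A * C1) * \<tau> powr (- \<alpha>)" by (simp only: \<sigma>_def)
  qed
qed

end

section \<open>Complex geometrical optics solutions\<close>

lemma bdot_commute: "bdot a b = bdot b a"
  by (simp add: bdot_def mult.commute)

lemma bdot_add_left: "bdot (a + b) c = bdot a c + bdot b c"
  by (simp add: bdot_commute[of _ c] bdot_add_right)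

lemma bdot_scale_left: "bdot (t *s a) c = t * bdot a c"
  by (simp add: bdot_commute[of _ c] bdot_scale_right)

lemma bounded_linear_bdot_cvec: "bounded_linear (\<lambda>x. bdot (cvec x) z)"
proof -
  have "linear (\<lambda>x. bdot (cvec x) z)"
    by (intro linearI) (simp_all add: bdot_def cvec_def sum.distrib distrib_right sum_distrib_left mult.assoc scaleR_conv_of_real[where 'a = complex])
  then show ?thesis by (simp add: linear_conv_bounded_linear)
qed

lemma bdot_cvec_axis: "bdot (cvec (axis j 1)) z = z $ j"
  by (simp add: bdot_def cvec_def axis_def if_distrib[where f = complex_of_real] if_distrib[where f = "\<lambda>t. t * _"] cong: if_cong)

text \<open>Covers both test functions: \<open>a = 1\<close> and \<xi> = 0 give the exponential
  solution, \<open>a = 0\<close> and \<xi> the \<tau>-derivative of \<zeta> give its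
  \<tau>-derivative.\<close>

definition wave :: "complex \<Rightarrow> complex^3 \<Rightarrow> complex^3 \<Rightarrow> real^3 \<Rightarrow> complex" where
  "wave a \<xi> \<zeta> x = (a + bdot (cvec x) \<xi>) * exp (bdot (cvec x) \<zeta>)"

lemma bdot_cvec_has_derivative: "((\<lambda>x. bdot (cvec x) z) has_derivative (\<lambda>h. bdot (cvec h) z)) (at x)"
  by (rule bounded_linear_imp_has_derivative[OF bounded_linear_bdot_cvec])

lemma exp_bdot_has_derivative:
  "((\<lambda>x. exp (bdot (cvec x) \<zeta>)) has_derivative (\<lambda>h. bdot (cvec h) \<zeta> * exp (bdot (cvec x) \<zeta>))) (at x)"
  by (rule has_derivative_compose[OF bdot_cvec_has_derivative DERIV_exp[unfolded has_field_derivative_def], THEN has_derivative_eq_rhs])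
    (simp add: mult.commute)

lemma continuous_bdot_cvec: "continuous_on S (\<lambda>x. bdot (cvec x) z)"
  by (rule linear_continuous_on[OF bounded_linear_bdot_cvec])

lemma grad_wave: "grad (wave a \<xi> \<zeta>) x $ j = (\<xi> $ j + (a + bdot (cvec x) \<xi>) * \<zeta> $ j) * exp (bdot (cvec x) \<zeta>)"
proof -
  have "(wave a \<xi> \<zeta> has_derivative (\<lambda>h. (a + bdot (cvec x) \<xi>) * (bdot (cvec h) \<zeta> * exp (bdot (cvec x) \<zeta>)) +
      bdot (cvec h) \<xi> * exp (bdot (cvec x) \<zeta>))) (at x)"
    unfolding wave_def[abs_def]
    by (rule has_derivative_mult[OF _ exp_bdot_has_derivative])
      (auto intro!: derivative_eq_intros bdot_cvec_has_derivative)
  from frechet_derivative_at[OF this, symmetric] show ?thesis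
    by (simp add: grad_def bdot_cvec_axis algebra_simps)
qed

lemma wave_C1:
  "C1_deriv (\<lambda>x. grad (wave a \<xi> \<zeta>) x $ j) (\<lambda>x h. (\<xi> $ j + (a + bdot (cvec x) \<xi>) * \<zeta> $ j) * (bdot (cvec h) \<zeta> * exp (bdot (cvec x) \<zeta>)) +
     (bdot (cvec h) \<xi> * \<zeta> $ j) * exp (bdot (cvec x) \<zeta>))"
  unfolding C1_deriv_def grad_wave
proof (intro conjI allI)
  fix x
  show "((\<lambda>x. (\<xi> $ j + (a + bdot (cvec x) \<xi>) * \<zeta> $ j) * exp (bdot (cvec x) \<zeta>)) has_derivative
     (\<lambda>h. (\<xi> $ j + (a + bdot (cvec x) \<xi>) * \<zeta> $ j) * (bdot (cvec h) \<zeta> * exp (bdot (cvec x) \<zeta>)) +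
     (bdot (cvec h) \<xi> * \<zeta> $ j) * exp (bdot (cvec x) \<zeta>))) (at x)"
    by (rule has_derivative_mult[OF _ exp_bdot_has_derivative])
      (auto intro!: derivative_eq_intros bdot_cvec_has_derivative)
qed (intro continuous_intros continuous_bdot_cvec)

text \<open>The Laplacian produces \<open>2 * bdot \<xi> \<zeta>\<close> in addition to the
  amplitude times \<open>bdot \<zeta> \<zeta>\<close>; the former vanishes by assumption.\<close>

lemma wave_helmholtz:
  assumes "bdot \<zeta> \<zeta> = c" "bdot \<xi> \<zeta> = 0"
  shows "(\<Sum>j\<in>UNIV. (\<xi> $ j + (a + bdot (cvec x) \<xi>) * \<zeta> $ j) * (bdot (cvec (axis j 1)) \<zeta> * exp (bdot (cvec x) \<zeta>)) +
     (bdot (cvec (axis j 1)) \<xi> * \<zeta> $ j) * exp (bdot (cvec x) \<zeta>)) = c * wave a \<xi> \<zeta> x"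
proof -
  have "(\<Sum>j\<in>UNIV. (\<xi> $ j + (a + bdot (cvec x) \<xi>) * \<zeta> $ j) * (bdot (cvec (axis j 1)) \<zeta> * exp (bdot (cvec x) \<zeta>)) +
     (bdot (cvec (axis j 1)) \<xi> * \<zeta> $ j) * exp (bdot (cvec x) \<zeta>)) =
     (2 * bdot \<xi> \<zeta> + (a + bdot (cvec x) \<xi>) * bdot \<zeta> \<zeta>) * exp (bdot (cvec x) \<zeta>)"
    unfolding bdot_cvec_axis bdot_def[of \<xi> \<zeta>] bdot_def[of \<zeta> \<zeta>]
    by (simp add: sum_distrib_left sum_distrib_right sum.distrib[symmetric] algebra_simps)
  then show ?thesis using assms by (simp add: wave_def mult_ac)
qed

lemma continuous_wave: "continuous_on S (wave a \<xi> \<zeta>)"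
  unfolding wave_def by (intro continuous_intros continuous_bdot_cvec)

definition cgo_amplitude :: "real \<Rightarrow> real^3 \<Rightarrow> real^3 \<Rightarrow> real \<Rightarrow> real^3 \<Rightarrow> complex" where
  "cgo_amplitude k \<omega> \<theta> \<tau> x =
     complex_of_real (x \<bullet> \<omega>) + \<i> * complex_of_real (\<tau> / sqrt (\<tau>\<^sup>2 + k\<^sup>2) * (x \<bullet> \<theta>))"

lemma cgo_tau_eq: "cgo_tau k \<omega> \<theta> \<tau> x = cgo_amplitude k \<omega> \<theta> \<tau> x * cgo k \<omega> \<theta> \<tau> x"
  by (simp add: cgo_tau_def cgo_amplitude_def bdot_add_right bdot_scale_right bdot_cvec)

lemma cgo_exp: "cgo k \<omega> \<theta> \<tau> x = exp (complex_of_real (\<tau> * (x \<bullet> \<omega>)) + \<i> * complex_of_real (sqrt (\<tau>\<^sup>2 + k\<^sup>2) * (x \<bullet> \<theta>)))"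
  by (simp add: cgo_def bdot_add_right bdot_scale_right bdot_cvec mult.assoc)

context C2_domain begin

lemma cgo_boundary_form:
  assumes \<theta>: "norm \<omega> = 1" "norm \<theta> = 1" "\<omega> \<bullet> \<theta> = 0" and \<tau>: "\<tau> > 0"
    and u: "L2_on \<Omega> u" "L2_on \<Omega> Du" "has_trace \<Omega> u Du tu"
    and D: "D \<subseteq> \<Omega>" and \<rho>: "set_integrable lebesgue D \<rho>" and Dm: "D \<in> sets lebesgue"
  shows "boundary_form \<Omega> k (source \<rho> D) u Du tu (cgo k \<omega> \<theta> \<tau>) = (LINT x:D|lebesgue. \<rho> x * cgo k \<omega> \<theta> \<tau> x)" (is ?A)
    and "boundary_form \<Omega> k (source \<rho> D) u Du tu (cgo_tau k \<omega> \<theta> \<tau>) = (LINT x:D|lebesgue. \<rho> x * cgo_tau k \<omega> \<theta> \<tau> x)" (is ?B)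
proof -
  define \<sigma> where "\<sigma> = sqrt (\<tau>\<^sup>2 + k\<^sup>2)"
  define \<zeta> where "\<zeta> = complex_of_real \<tau> *s cvec \<omega> + (\<i> * complex_of_real \<sigma>) *s cvec \<theta>"
  define \<xi> where "\<xi> = cvec \<omega> + (\<i> * complex_of_real (\<tau> / \<sigma>)) *s cvec \<theta>"
  have in1: "\<omega> \<bullet> \<omega> = 1" "\<theta> \<bullet> \<theta> = 1" "\<theta> \<bullet> \<omega> = 0" using \<theta> by (auto simp: norm_eq_1 inner_commute)
  have \<sigma>: "\<sigma>\<^sup>2 = \<tau>\<^sup>2 + k\<^sup>2" "\<sigma> > 0" using \<tau> by (auto simp: \<sigma>_def add_pos_nonneg)
  have "bdot \<zeta> \<zeta> = complex_of_real (\<tau>\<^sup>2 - \<sigma>\<^sup>2)"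
    by (simp add: \<zeta>_def bdot_add_left bdot_add_right bdot_scale_left bdot_scale_right bdot_cvec in1 \<theta> power2_eq_square mult_ac)
  then have zz: "bdot \<zeta> \<zeta> = - complex_of_real (k\<^sup>2)" by (simp add: \<sigma>)
  \<comment> \<open>\<xi> is the \<tau>-derivative of \<zeta> while
    \<open>bdot \<zeta> \<zeta>\<close> does not depend on \<tau>; explicitly, \<tau> minus \<sigma>
    times \<tau> / \<sigma>.\<close>
  have xz: "bdot \<xi> \<zeta> = 0"
    using \<sigma>(2) by (simp add: \<zeta>_def \<xi>_def bdot_add_left bdot_add_right bdot_scale_left bdot_scale_right bdot_cvec in1 \<theta>)
  have form: "boundary_form \<Omega> k (source \<rho> D) u Du tu (wave a x \<zeta>) = (LINT y:D|lebesgue. \<rho> y * wave a x \<zeta> y)"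
    if "bdot x \<zeta> = 0" for a x
  proof -
    obtain B where B: "B \<ge> 0" "\<And>y. y \<in> closure \<Omega> \<Longrightarrow> norm (wave a x \<zeta> y) \<le> B"
      using continuous_bounded_closure[OF continuous_wave] by metis
    have i: "set_integrable lebesgue D (\<lambda>y. wave a x \<zeta> y * \<rho> y)"
    proof (rule set_integrable_bounded_mult[OF \<rho>])
      show "set_borel_measurable lebesgue D (wave a x \<zeta>)"
        by (rule continuous_set_borel_measurable_lebesgue[OF continuous_wave Dm])
      show "cmod (wave a x \<zeta> y) \<le> B" if "y \<in> D" for y using B(2)[of y] that D closure_subset[of \<Omega>] by auto
    qed
    have eq: "indicator \<Omega> y *\<^sub>R (source \<rho> D y * wave a x \<zeta> y) = indicator D y *\<^sub>R (wave a x \<zeta> y * \<rho> y)" for y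
      using D by (auto simp: source_def indicator_def)
    have "boundary_form \<Omega> k (source \<rho> D) u Du tu (wave a x \<zeta>) = (LINT y:\<Omega>|lebesgue. source \<rho> D y * wave a x \<zeta> y)"
    proof (rule boundary_form_eq[OF u wave_C1 _ continuous_wave])
      show "set_integrable lebesgue \<Omega> (\<lambda>y. source \<rho> D y * wave a x \<zeta> y)"
        using i unfolding set_integrable_def eq .
    qed (rule wave_helmholtz[OF zz that])
    then show ?thesis unfolding set_lebesgue_integral_def eq by (simp add: mult.commute)
  qed
  have z0: "bdot 0 \<zeta> = 0" by (simp add: bdot_def)
  have "cgo k \<omega> \<theta> \<tau> = wave 1 0 \<zeta>" by (simp add: fun_eq_iff cgo_def wave_def \<zeta>_def \<sigma>_def) (simp add: bdot_def)
  then show ?A using form[OF z0, of 1] by simp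
  have "cgo_tau k \<omega> \<theta> \<tau> = wave 0 \<xi> \<zeta>" by (simp add: fun_eq_iff cgo_tau_def cgo_def wave_def \<xi>_def \<zeta>_def \<sigma>_def)
  then show ?B using form[OF xz, of 0] by simp
qed

end

section \<open>The contact point and the expansion there\<close>

lemma regular_contact_point:
  assumes "regular_direction D \<omega>"
  shows "contact_point D \<omega> \<in> closure D" "contact_point D \<omega> \<bullet> \<omega> = support_fun D \<omega>"
proof -
  obtain p where p: "{x \<in> closure D. x \<bullet> \<omega> = support_fun D \<omega>} = {p}" using assms by (auto simp: regular_direction_def)
  then have "contact_point D \<omega> = p" by (auto simp: contact_point_def)
  then show "contact_point D \<omega> \<in> closure D" "contact_point D \<omega> \<bullet> \<omega> = support_fun D \<omega>" using p by auto
qed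

text \<open>From a point of the open set \<open>D\<close> one can still move a little in direction
  \<omega>, so the supremum is not attained in \<open>D\<close>.\<close>

lemma inner_less_support_fun:
  assumes "open D" "bounded D" "norm \<omega> = 1" "x \<in> D"
  shows "x \<bullet> \<omega> < support_fun D \<omega>"
proof -
  have ww: "\<omega> \<bullet> \<omega> = 1" using assms by (simp add: norm_eq_1)
  have "bounded ((\<lambda>x. x \<bullet> \<omega>) ` D)" by (rule bounded_linear_image[OF assms(2) bounded_linear_inner_left])
  then have bdd: "bdd_above ((\<lambda>x. x \<bullet> \<omega>) ` D)" by (rule bounded_imp_bdd_above)
  obtain e where e: "e > 0" "cball x e \<subseteq> D" using assms open_contains_cball by blast
  have "x + e *\<^sub>R \<omega> \<in> D" using e assms(3) by (intro subsetD[OF e(2)]) (simp add: dist_norm)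
  then have "(x + e *\<^sub>R \<omega>) \<bullet> \<omega> \<le> support_fun D \<omega>" unfolding support_fun_def by (rule cSUP_upper[OF _ bdd])
  then show ?thesis using e by (simp add: inner_add_left ww)
qed

text \<open>With \<open>q = \<tau> / sqrt (\<tau>\<^sup>2 + k\<^sup>2)\<close> the error splits into
  moving \<open>x\<close> to \<open>p\<close> and \<open>q\<close> to 1; the latter costs at most
  \<open>k\<^sup>2 / \<tau>\<close>. The bounds contain \<theta> only through its norm.\<close>

lemma cgo_amplitude_bounds:
  assumes \<theta>: "norm \<omega> = 1" "norm \<theta> = 1" and \<tau>: "\<tau> \<ge> 1" and R: "norm x \<le> R" "norm p \<le> R"
  shows "cmod (cgo_amplitude k \<omega> \<theta> \<tau> x) \<le> 2 * R"
    "cmod (complex_of_real (p \<bullet> \<omega>) + \<i> * complex_of_real (p \<bullet> \<theta>)) \<le> 2 * R"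
    "cmod (cgo_amplitude k \<omega> \<theta> \<tau> x - (complex_of_real (p \<bullet> \<omega>) + \<i> * complex_of_real (p \<bullet> \<theta>)))
      \<le> 2 * norm (x - p) + k\<^sup>2 * R / \<tau>"
proof -
  define \<sigma> where "\<sigma> = sqrt (\<tau>\<^sup>2 + k\<^sup>2)"
  have \<sigma>: "\<sigma> \<ge> \<tau>" "\<sigma> - \<tau> \<le> k\<^sup>2" using sqrt_sum_squares_diff[OF \<tau>, of k] by (auto simp: \<sigma>_def)
  define q where "q = \<tau> / \<sigma>"
  have q: "0 \<le> q" "q \<le> 1" using \<sigma> \<tau> by (auto simp: q_def)
  have q2: "1 - q \<le> k\<^sup>2 / \<tau>"
  proof -
    have "1 - q = (\<sigma> - \<tau>) / \<sigma>" using \<sigma> \<tau> by (simp add: q_def field_simps)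
    also have "\<dots> \<le> k\<^sup>2 / \<tau>" using \<sigma> \<tau> by (intro frac_le) auto
    finally show ?thesis .
  qed
  have i1: "\<bar>y \<bullet> \<omega>\<bar> \<le> norm y" "\<bar>y \<bullet> \<theta>\<bar> \<le> norm y" for y
    using Cauchy_Schwarz_ineq2[of y \<omega>] Cauchy_Schwarz_ineq2[of y \<theta>] \<theta> by auto
  have tri: "cmod (complex_of_real s + \<i> * complex_of_real t) \<le> \<bar>s\<bar> + \<bar>t\<bar>" for s t
    using norm_triangle_ineq[of "complex_of_real s" "\<i> * complex_of_real t"] by (simp add: norm_mult)
  have am: "cgo_amplitude k \<omega> \<theta> \<tau> x = complex_of_real (x \<bullet> \<omega>) + \<i> * complex_of_real (q * (x \<bullet> \<theta>))"
    by (simp add: cgo_amplitude_def q_def \<sigma>_def)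
  have qx: "\<bar>q * (y \<bullet> \<theta>)\<bar> \<le> norm y" for y
    using mult_mono[OF q(2) i1(2)[of y]] q by (simp add: abs_mult)
  show "cmod (cgo_amplitude k \<omega> \<theta> \<tau> x) \<le> 2 * R"
    unfolding am using tri[of "x \<bullet> \<omega>" "q * (x \<bullet> \<theta>)"] i1(1)[of x] qx[of x] R by linarith
  show "cmod (complex_of_real (p \<bullet> \<omega>) + \<i> * complex_of_real (p \<bullet> \<theta>)) \<le> 2 * R"
    using tri[of "p \<bullet> \<omega>" "p \<bullet> \<theta>"] i1[of p] R by linarith
  have "cgo_amplitude k \<omega> \<theta> \<tau> x - (complex_of_real (p \<bullet> \<omega>) + \<i> * complex_of_real (p \<bullet> \<theta>)) =
     complex_of_real ((x - p) \<bullet> \<omega>) + \<i> * complex_of_real (q * ((x - p) \<bullet> \<theta>) - (1 - q) * (p \<bullet> \<theta>))"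
    unfolding am by (simp add: inner_diff_left algebra_simps)
  then have "cmod (cgo_amplitude k \<omega> \<theta> \<tau> x - (complex_of_real (p \<bullet> \<omega>) + \<i> * complex_of_real (p \<bullet> \<theta>)))
     \<le> \<bar>(x - p) \<bullet> \<omega>\<bar> + \<bar>q * ((x - p) \<bullet> \<theta>) - (1 - q) * (p \<bullet> \<theta>)\<bar>" by (simp only: tri)
  moreover have "\<bar>(1 - q) * (p \<bullet> \<theta>)\<bar> \<le> k\<^sup>2 / \<tau> * R"
    unfolding abs_mult using q q2 i1(2)[of p] R \<tau> by (intro mult_mono) auto
  ultimately show "cmod (cgo_amplitude k \<omega> \<theta> \<tau> x - (complex_of_real (p \<bullet> \<omega>) + \<i> * complex_of_real (p \<bullet> \<theta>)))
      \<le> 2 * norm (x - p) + k\<^sup>2 * R / \<tau>"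
    using i1(1)[of "x - p"] qx[of "x - p"] by simp
qed

lemma uniformly_O_cong:
  assumes "uniformly_O \<Theta> \<alpha> g" "\<And>\<theta> \<tau>. \<theta> \<in> \<Theta> \<Longrightarrow> \<tau> \<ge> 1 \<Longrightarrow> f \<theta> \<tau> = g \<theta> \<tau>"
  shows "uniformly_O \<Theta> \<alpha> f"
proof -
  obtain K where "\<forall>\<^sub>F \<tau> in at_top. \<forall>\<theta>\<in>\<Theta>. cmod (g \<theta> \<tau>) \<le> K * \<tau> powr (- \<alpha>)"
    using assms(1) by (auto simp: uniformly_O_def)
  then have "\<forall>\<^sub>F \<tau> in at_top. \<forall>\<theta>\<in>\<Theta>. cmod (f \<theta> \<tau>) \<le> K * \<tau> powr (- \<alpha>)"
    using eventually_ge_at_top[of 1] by eventually_elim (simp add: assms(2))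
  then show ?thesis unfolding uniformly_O_def by blast
qed

text \<open>An abstract amplitude \<open>b\<close> with frozen value \<open>b0\<close> serves both
  expansions. Its error is linear in the distance to \<open>p\<close>, which is no worse than the
  Hoelder error of the density at depths below 1.\<close>

lemma (in truncated_cone) cone_expansion:
  fixes \<rho> \<rho>' :: "real^3 \<Rightarrow> complex" and b :: "real^3 \<Rightarrow> real \<Rightarrow> real^3 \<Rightarrow> complex" and b0 :: "real^3 \<Rightarrow> complex"
  assumes Dm: "D \<in> sets lebesgue" and below: "\<And>x. x \<in> D \<Longrightarrow> x \<bullet> \<omega> < p \<bullet> \<omega>"
    and cs: "D \<inter> {x. p \<bullet> \<omega> - \<delta> < x \<bullet> \<omega> \<and> x \<bullet> \<omega> < p \<bullet> \<omega>} = cone_set p \<omega> \<delta> Q"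
    and \<rho>: "set_integrable lebesgue D \<rho>"
    and \<eta>: "\<eta> > 0" and \<alpha>: "0 < \<alpha>" "\<alpha> \<le> 1" and holder: "holder_on (cball p \<eta>) \<alpha> \<rho>'"
    and eq: "AE x in lebesgue. x \<in> ball p \<eta> \<inter> D \<longrightarrow> \<rho> x = \<rho>' x"
    and cont: "\<And>\<theta> \<tau>. continuous_on UNIV (b \<theta> \<tau>)"
    and b1: "\<And>\<theta> \<tau> x. \<theta> \<in> S_perp \<omega> \<Longrightarrow> \<tau> \<ge> 1 \<Longrightarrow> x \<in> D \<Longrightarrow> cmod (b \<theta> \<tau> x) \<le> B"
    and b2: "\<And>\<theta>. \<theta> \<in> S_perp \<omega> \<Longrightarrow> cmod (b0 \<theta>) \<le> B"
    and b3: "\<And>\<theta> \<tau> x. \<theta> \<in> S_perp \<omega> \<Longrightarrow> \<tau> \<ge> 1 \<Longrightarrow> x \<in> D \<Longrightarrow>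
      cmod (b \<theta> \<tau> x - b0 \<theta>) \<le> C * (norm (x - p) + 1 / \<tau>)"
    and B: "B \<ge> 0" and C: "C \<ge> 0"
  shows "uniformly_O (S_perp \<omega>) \<alpha> (\<lambda>\<theta> \<tau>.
      complex_of_real (\<tau> ^ 3 * exp (- \<tau> * (p \<bullet> \<omega>))) * exp (- \<i> * complex_of_real (sqrt (\<tau>\<^sup>2 + k\<^sup>2) * (p \<bullet> \<theta>)))
        * (LINT x:D|lebesgue. \<rho> x * (b \<theta> \<tau> x * cgo k \<omega> \<theta> \<tau> x))
      - \<rho>' p * b0 \<theta> * cone_const p \<omega> \<delta> Q \<theta> s)"
proof -
  have dep: "depth x = p \<bullet> \<omega> - x \<bullet> \<omega>" for x by (simp add: depth_def inner_diff_left)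
  have D0: "depth x > 0" if "x \<in> D" for x
    using below[OF that] by (simp add: dep)
  obtain M where M: "M \<ge> 0" "\<And>x. x \<in> infinite_cone \<Longrightarrow> norm (x - p) \<le> M * depth x" using infinite_cone_bound by metis
  \<comment> \<open>Below \<delta> the set \<open>D\<close> is the cone, below 1 a depth is at most
    its power \<alpha>, and the last bound keeps this part of \<open>D\<close> in the ball where
    \<open>\<rho>\<close> equals \<open>\<rho>'\<close>. \<open>M + 1\<close> avoids division by
    0.\<close>
  define \<delta>' where "\<delta>' = min (min \<delta> 1) (\<eta> / (M + 1))"
  have \<delta>': "0 < \<delta>'" "\<delta>' \<le> \<delta>" "\<delta>' \<le> 1" "(M + 1) * \<delta>' \<le> \<eta>"
  proof -
    show "0 < \<delta>'" "\<delta>' \<le> \<delta>" "\<delta>' \<le> 1" using \<delta> \<eta> M by (auto simp: \<delta>'_def)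
    have "(M + 1) * \<delta>' \<le> (M + 1) * (\<eta> / (M + 1))" using M by (intro mult_left_mono) (auto simp: \<delta>'_def)
    then show "(M + 1) * \<delta>' \<le> \<eta>" using M by simp
  qed
  have Dcone: "x \<in> D \<longleftrightarrow> x \<in> infinite_cone" if "0 < depth x" "depth x < \<delta>'" for x
  proof -
    have "x \<in> D \<longleftrightarrow> x \<in> D \<inter> {x. p \<bullet> \<omega> - \<delta> < x \<bullet> \<omega> \<and> x \<bullet> \<omega> < p \<bullet> \<omega>}" using that \<delta>'(2) by (auto simp: dep)
    also have "\<dots> \<longleftrightarrow> x \<in> infinite_cone" unfolding cs cone_set_eq using that \<delta>'(2) by auto
    finally show ?thesis .
  qed
  have near: "norm (x - p) \<le> M * depth x" "x \<in> ball p \<eta>" if "x \<in> D" "depth x < \<delta>'" for x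
  proof -
    show n: "norm (x - p) \<le> M * depth x" using M(2) Dcone[OF D0[OF that(1)] that(2)] that(1) by simp
    also have "\<dots> < (M + 1) * \<delta>'" using M(1) that(2) D0[OF that(1)] by (intro mult_strict_mono) auto
    also have "\<dots> \<le> \<eta>" by (rule \<delta>'(4))
    finally show "x \<in> ball p \<eta>" by (simp add: dist_norm norm_minus_commute)
  qed
  obtain L0 where L0: "\<And>x y. x \<in> cball p \<eta> \<Longrightarrow> y \<in> cball p \<eta> \<Longrightarrow> cmod (\<rho>' x - \<rho>' y) \<le> L0 * dist x y powr \<alpha>"
    using holder unfolding holder_on_def by blast
  \<comment> \<open>The Hoelder constant may be negative as given; its modulus, times
    \<open>M powr \<alpha>\<close>, is the constant with respect to depth.\<close>
  define Lc where "Lc = \<bar>L0\<bar> * M powr \<alpha>"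
  have Lc: "Lc \<ge> 0" by (simp add: Lc_def)
  have hold: "cmod (\<rho>' x - \<rho>' p) \<le> Lc * depth x powr \<alpha>" if "x \<in> D" "depth x < \<delta>'" for x
  proof -
    have "x \<in> cball p \<eta>" "p \<in> cball p \<eta>" using near(2)[OF that] \<eta> by auto
    then have "cmod (\<rho>' x - \<rho>' p) \<le> L0 * dist x p powr \<alpha>" by (rule L0)
    also have "\<dots> \<le> \<bar>L0\<bar> * (M * depth x) powr \<alpha>"
      using near(1)[OF that] \<alpha>(1) by (intro mult_mono powr_mono2) (auto simp: dist_norm)
    also have "\<dots> = Lc * depth x powr \<alpha>" using M D0[OF that(1)] by (simp add: Lc_def powr_mult)
    finally show ?thesis .
  qed
  have ae: "AE x in lebesgue. x \<in> D \<and> depth x < \<delta>' \<longrightarrow> \<rho> x = \<rho>' x"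
    using eq by eventually_elim (use near(2) in auto)
  have depa: "depth x \<le> depth x powr \<alpha>" if "x \<in> D" "depth x < \<delta>'" for x
    using powr_mono'[of \<alpha> 1 "depth x"] D0[OF that(1)] that(2) \<delta>'(3) \<alpha>(2) by simp
  \<comment> \<open>The normalising prefactor is exactly the reciprocal of the exponential solution
    at \<open>p\<close>, which turns the solution into \<open>phase\<close>.\<close>
  have factor: "complex_of_real (\<tau> ^ 3 * exp (- \<tau> * (p \<bullet> \<omega>))) * exp (- \<i> * complex_of_real (sqrt (\<tau>\<^sup>2 + k\<^sup>2) * (p \<bullet> \<theta>)))
      * (LINT x:D|lebesgue. \<rho> x * (a x * cgo k \<omega> \<theta> \<tau> x)) =
      complex_of_real (\<tau> ^ 3) * (LINT x:D|lebesgue. (\<rho> x * a x) * phase \<tau> (sqrt (\<tau>\<^sup>2 + k\<^sup>2)) \<theta> x)" for \<tau> \<theta> a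
  proof -
    define \<sigma> where "\<sigma> = sqrt (\<tau>\<^sup>2 + k\<^sup>2)"
    let ?c = "complex_of_real (exp (- \<tau> * (p \<bullet> \<omega>))) * exp (- \<i> * complex_of_real (\<sigma> * (p \<bullet> \<theta>)))"
    have eq: "?c * (\<rho> x * (a x * cgo k \<omega> \<theta> \<tau> x)) = (\<rho> x * a x) * phase \<tau> \<sigma> \<theta> x" for x
    proof -
      have "?c * cgo k \<omega> \<theta> \<tau> x = phase \<tau> \<sigma> \<theta> x"
        unfolding cgo_exp phase_def \<sigma>_def[symmetric] exp_of_real[symmetric] exp_add[symmetric]
        by (intro arg_cong[where f = exp]) (simp add: dep inner_diff_left algebra_simps)
      then show ?thesis by (metis mult.assoc mult.commute)
    qed
    have "?c * (LINT x:D|lebesgue. \<rho> x * (a x * cgo k \<omega> \<theta> \<tau> x)) = (LINT x:D|lebesgue. (\<rho> x * a x) * phase \<tau> \<sigma> \<theta> x)"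
      by (subst set_integral_mult_right[symmetric]) (simp only: eq)
    then show ?thesis by (simp add: \<sigma>_def mult.assoc)
  qed
  define B' where "B' = (1 + cmod (\<rho>' p)) * B"
  define C' where "C' = Lc * B + cmod (\<rho>' p) * (C * (M + 1))"
  have B': "B' \<ge> 0" using B by (simp add: B'_def)
  have C': "C' \<ge> 0" using B Lc C M by (simp add: C'_def)
  have "B \<le> B'" using B by (simp add: B'_def distrib_right)
  obtain K where K: "\<And>\<tau> \<theta> G g0. \<tau> \<ge> 1 \<Longrightarrow> norm \<theta> = 1 \<Longrightarrow> \<omega> \<bullet> \<theta> = 0 \<Longrightarrow> set_borel_measurable lebesgue D G \<Longrightarrow>
    (\<And>x. x \<in> D \<Longrightarrow> cmod (G x) \<le> B' * cmod (\<rho> x)) \<Longrightarrow> cmod g0 \<le> B' \<Longrightarrow>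
    (AE x in lebesgue. x \<in> D \<and> depth x < \<delta>' \<longrightarrow> cmod (G x - g0) \<le> C' * (depth x powr \<alpha> + 1 / \<tau>)) \<Longrightarrow>
    cmod (complex_of_real (\<tau> ^ 3) * (LINT x:D|lebesgue. G x * phase \<tau> (sqrt (\<tau>\<^sup>2 + k\<^sup>2)) \<theta> x) - g0 * cone_const p \<omega> \<delta> Q \<theta> s)
      \<le> K * \<tau> powr (- \<alpha>)"
    using cone_estimate[OF Dm \<rho> \<delta>'(1) D0 Dcone \<alpha> B' C'] by blast
  show ?thesis unfolding uniformly_O_def
  proof (intro exI[of _ K] eventually_mono[OF eventually_ge_at_top[of 1]] ballI)
    fix \<tau> :: real and \<theta> assume \<tau>: "1 \<le> \<tau>" and \<theta>: "\<theta> \<in> S_perp \<omega>"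
    then have n: "norm \<theta> = 1" "\<omega> \<bullet> \<theta> = 0" by (auto simp: S_perp_def)
    have "cmod (complex_of_real (\<tau> ^ 3) * (LINT x:D|lebesgue. (\<rho> x * b \<theta> \<tau> x) * phase \<tau> (sqrt (\<tau>\<^sup>2 + k\<^sup>2)) \<theta> x)
        - (\<rho>' p * b0 \<theta>) * cone_const p \<omega> \<delta> Q \<theta> s) \<le> K * \<tau> powr (- \<alpha>)"
    proof (rule K[OF \<tau> n])
      have "set_integrable lebesgue D (\<lambda>x. b \<theta> \<tau> x * \<rho> x)"
        by (rule set_integrable_bounded_mult[OF \<rho> continuous_set_borel_measurable_lebesgue[OF cont Dm] b1[OF \<theta> \<tau>]])
      then show "set_borel_measurable lebesgue D (\<lambda>x. \<rho> x * b \<theta> \<tau> x)"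
        unfolding set_integrable_def set_borel_measurable_def by (simp add: mult.commute borel_measurable_integrable)
      show "cmod (\<rho> x * b \<theta> \<tau> x) \<le> B' * cmod (\<rho> x)" if "x \<in> D" for x
        using mult_left_mono[OF order_trans[OF b1[OF \<theta> \<tau> that] \<open>B \<le> B'\<close>], of "cmod (\<rho> x)"]
        by (simp add: norm_mult mult.commute)
      show "cmod (\<rho>' p * b0 \<theta>) \<le> B'"
        unfolding norm_mult B'_def using b2[OF \<theta>] by (intro mult_mono) auto
      show "AE x in lebesgue. x \<in> D \<and> depth x < \<delta>' \<longrightarrow>
          cmod (\<rho> x * b \<theta> \<tau> x - \<rho>' p * b0 \<theta>) \<le> C' * (depth x powr \<alpha> + 1 / \<tau>)"
        using ae
      proof eventually_elim
        case (elim x)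
        show ?case
        proof
          assume x: "x \<in> D \<and> depth x < \<delta>'"
          let ?t = "depth x powr \<alpha> + 1 / \<tau>"
          have t0: "0 \<le> ?t" "depth x powr \<alpha> \<le> ?t" using \<tau> by auto
          have "\<rho> x * b \<theta> \<tau> x - \<rho>' p * b0 \<theta> = (\<rho>' x - \<rho>' p) * b \<theta> \<tau> x + \<rho>' p * (b \<theta> \<tau> x - b0 \<theta>)"
            using elim x by (simp add: algebra_simps)
          then have "cmod (\<rho> x * b \<theta> \<tau> x - \<rho>' p * b0 \<theta>) \<le>
              cmod (\<rho>' x - \<rho>' p) * cmod (b \<theta> \<tau> x) + cmod (\<rho>' p) * cmod (b \<theta> \<tau> x - b0 \<theta>)"
            using norm_triangle_ineq[of "(\<rho>' x - \<rho>' p) * b \<theta> \<tau> x" "\<rho>' p * (b \<theta> \<tau> x - b0 \<theta>)"] by (simp add: norm_mult)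
          also have "\<dots> \<le> (Lc * ?t) * B + cmod (\<rho>' p) * (C * ((M + 1) * ?t))"
          proof (intro add_mono mult_mono mult_left_mono)
            have "cmod (\<rho>' x - \<rho>' p) \<le> Lc * depth x powr \<alpha>" using hold x by simp
            also have "\<dots> \<le> Lc * ?t" using t0 Lc by (intro mult_left_mono)
            finally show "cmod (\<rho>' x - \<rho>' p) \<le> Lc * ?t" .
            have "norm (x - p) + 1 / \<tau> \<le> M * ?t + 1 * ?t"
            proof (intro add_mono)
              have "depth x \<le> ?t" using depa[of x] x t0(2) by linarith
              then have "M * depth x \<le> M * ?t" using M(1) by (rule mult_left_mono)
              then show "norm (x - p) \<le> M * ?t" using near(1)[of x] x by linarith
            qed simp
            then have "C * (norm (x - p) + 1 / \<tau>) \<le> C * ((M + 1) * ?t)"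
              using C by (intro mult_left_mono) (simp_all add: distrib_right)
            then show "cmod (b \<theta> \<tau> x - b0 \<theta>) \<le> C * ((M + 1) * ?t)" using b3[OF \<theta> \<tau>, of x] x by linarith
          qed (use b1[OF \<theta> \<tau>] x Lc t0 in auto)
          also have "\<dots> = C' * ?t" by (simp add: C'_def algebra_simps add_divide_distrib)
          finally show "cmod (\<rho> x * b \<theta> \<tau> x - \<rho>' p * b0 \<theta>) \<le> C' * ?t" .
        qed
      qed
    qed
    then show "cmod (complex_of_real (\<tau> ^ 3 * exp (- \<tau> * (p \<bullet> \<omega>))) * exp (- \<i> * complex_of_real (sqrt (\<tau>\<^sup>2 + k\<^sup>2) * (p \<bullet> \<theta>)))
      * (LINT x:D|lebesgue. \<rho> x * (b \<theta> \<tau> x * cgo k \<omega> \<theta> \<tau> x)) - \<rho>' p * b0 \<theta> * cone_const p \<omega> \<delta> Q \<theta> s) \<le> K * \<tau> powr (- \<alpha>)"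
      unfolding factor .
  qed
qed

text \<open>The two expansions differ only in the amplitude: constant 1 for the solution,
  \<open>cgo_amplitude\<close> for its \<tau>-derivative. Frozen at \<open>x = p\<close> with the
  ratio of \<tau> to the frequency replaced by 1, the latter becomes the factor of the second
  formula.\<close>

theorem theorem1p1:
  fixes \<Omega> D Q :: "(real^3) set"
    and \<rho> \<rho>' u tu :: "real^3 \<Rightarrow> complex"
    and Du :: "real^3 \<Rightarrow> complex^3"
    and \<omega> :: "real^3"
    and k \<delta> \<eta> \<alpha> s :: real
  assumes "open \<Omega>" "connected \<Omega>" "\<Omega> \<noteq> {}" "bounded \<Omega>" "C2_boundary \<Omega>"
    and "k \<ge> 0"
    and "open D" "D \<noteq> {}" "closure D \<subseteq> \<Omega>"
    and "L2_on D \<rho>"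
    and "H1_with_grad \<Omega> u Du"
    and "has_trace \<Omega> u Du tu"
    and "weak_helmholtz \<Omega> k (source \<rho> D) u Du"
    and "norm \<omega> = 1"
    and "regular_direction D \<omega>"
    and "conical_singularity D \<omega> \<delta> Q"
    and "\<eta> > 0" "0 < \<alpha>" "\<alpha> \<le> 1"
    and "holder_on (cball (contact_point D \<omega>) \<eta>) \<alpha> \<rho>'"
    and "AE x in lebesgue. x \<in> ball (contact_point D \<omega>) \<eta> \<inter> D \<longrightarrow> \<rho> x = \<rho>' x"
    and "0 < s" "s < \<delta>"
  shows "uniformly_O (S_perp \<omega>) \<alpha> (\<lambda>\<theta> \<tau>.
      complex_of_real (\<tau> ^ 3 * exp (- \<tau> * support_fun D \<omega>))
        * exp (- \<i> * complex_of_real (sqrt (\<tau>\<^sup>2 + k\<^sup>2) * (contact_point D \<omega> \<bullet> \<theta>)))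
        * boundary_form \<Omega> k (source \<rho> D) u Du tu (cgo k \<omega> \<theta> \<tau>)
      - \<rho>' (contact_point D \<omega>) * cone_const (contact_point D \<omega>) \<omega> \<delta> Q \<theta> s)
    \<and> uniformly_O (S_perp \<omega>) \<alpha> (\<lambda>\<theta> \<tau>.
      complex_of_real (\<tau> ^ 3 * exp (- \<tau> * support_fun D \<omega>))
        * exp (- \<i> * complex_of_real (sqrt (\<tau>\<^sup>2 + k\<^sup>2) * (contact_point D \<omega> \<bullet> \<theta>)))
        * boundary_form \<Omega> k (source \<rho> D) u Du tu (cgo_tau k \<omega> \<theta> \<tau>)
      - \<rho>' (contact_point D \<omega>)
        * (complex_of_real (support_fun D \<omega>) + \<i> * complex_of_real (contact_point D \<omega> \<bullet> \<theta>))
        * cone_const (contact_point D \<omega>) \<omega> \<delta> Q \<theta> s)"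
proof -
  define p where "p = contact_point D \<omega>"
  define h where "h = support_fun D \<omega>"
  have p: "p \<in> closure D" and ph: "p \<bullet> \<omega> = h"
    using regular_contact_point[OF \<open>regular_direction D \<omega>\<close>] by (auto simp: p_def h_def)
  have D\<Omega>: "D \<subseteq> \<Omega>" using \<open>closure D \<subseteq> \<Omega>\<close> closure_subset by blast
  have bD: "bounded D" using D\<Omega> \<open>bounded \<Omega>\<close> bounded_subset by blast
  have Dm: "D \<in> sets lebesgue" using \<open>open D\<close> by simp
  have Dfin: "emeasure lebesgue D < \<infinity>" using emeasure_bounded_finite[OF bD] \<open>open D\<close> by simp
  have \<rho>: "set_integrable lebesgue D \<rho>"
    by (rule square_integrable_imp_integrable[OF Dm Dfin]) (use \<open>L2_on D \<rho>\<close> in \<open>auto simp: L2_on_def\<close>)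
  have cb: "cone_base p \<omega> \<delta> Q"
    and cs: "D \<inter> {x. p \<bullet> \<omega> - \<delta> < x \<bullet> \<omega> \<and> x \<bullet> \<omega> < p \<bullet> \<omega>} = cone_set p \<omega> \<delta> Q"
    using \<open>conical_singularity D \<omega> \<delta> Q\<close>
    unfolding conical_singularity_def p_def[symmetric] h_def[symmetric] ph by blast+
  \<comment> \<open>The finite cone is \<open>D\<close> cut by an open slab, which provides the
    openness required by \<open>truncated_cone\<close>.\<close>
  have "open (D \<inter> {x. p \<bullet> \<omega> - \<delta> < x \<bullet> \<omega> \<and> x \<bullet> \<omega> < p \<bullet> \<omega>})"
    by (intro open_Int \<open>open D\<close> open_Collect_conj open_Collect_less continuous_intros)
  then have oc: "open (cone_set p \<omega> \<delta> Q)" by (simp add: cs)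
  have cone: "truncated_cone p \<omega> \<delta> s Q"
    by (rule truncated_cone.intro[OF \<open>norm \<omega> = 1\<close> \<open>0 < s\<close> \<open>s < \<delta>\<close> cb oc])
  have dom: "C2_domain \<Omega>"
    by (rule C2_domain.intro[OF \<open>open \<Omega>\<close> \<open>bounded \<Omega>\<close> \<open>C2_boundary \<Omega>\<close>])
  have below: "x \<bullet> \<omega> < p \<bullet> \<omega>" if "x \<in> D" for x
    using inner_less_support_fun[OF \<open>open D\<close> bD \<open>norm \<omega> = 1\<close> that] by (simp add: ph h_def)
  have L2: "L2_on \<Omega> u" "L2_on \<Omega> Du" using \<open>H1_with_grad \<Omega> u Du\<close> by (auto simp: H1_with_grad_def)
  note form = C2_domain.cgo_boundary_form[OF dom \<open>norm \<omega> = 1\<close> _ _ _ L2 \<open>has_trace \<Omega> u Du tu\<close> D\<Omega> \<rho> Dm]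
  note expansion = truncated_cone.cone_expansion[OF cone Dm below cs \<rho> \<open>\<eta> > 0\<close> \<open>0 < \<alpha>\<close> \<open>\<alpha> \<le> 1\<close>
      \<open>holder_on (cball (contact_point D \<omega>) \<eta>) \<alpha> \<rho>'\<close>[folded p_def]
      \<open>AE x in lebesgue. x \<in> ball (contact_point D \<omega>) \<eta> \<inter> D \<longrightarrow> \<rho> x = \<rho>' x\<close>[folded p_def],
      where k = k, unfolded ph]
  obtain R where R: "\<And>x. x \<in> closure D \<Longrightarrow> norm x \<le> R" using bounded_closure[OF bD] unfolding bounded_iff by blast
  have R0: "R \<ge> 0" using order_trans[OF norm_ge_zero R[OF p]] .
  have S: "norm \<theta> = 1" "\<omega> \<bullet> \<theta> = 0" if "\<theta> \<in> S_perp \<omega>" for \<theta> using that by (auto simp: S_perp_def)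
  have "uniformly_O (S_perp \<omega>) \<alpha> (\<lambda>\<theta> \<tau>.
      complex_of_real (\<tau> ^ 3 * exp (- \<tau> * h)) * exp (- \<i> * complex_of_real (sqrt (\<tau>\<^sup>2 + k\<^sup>2) * (p \<bullet> \<theta>)))
        * boundary_form \<Omega> k (source \<rho> D) u Du tu (cgo k \<omega> \<theta> \<tau>)
      - \<rho>' p * cone_const p \<omega> \<delta> Q \<theta> s)"
  \<comment> \<open>A constant amplitude has no freezing error, hence the last constant 0.\<close>
  proof (rule uniformly_O_cong[OF expansion[of "\<lambda>_ _ _. 1" 1 "\<lambda>_. 1" 0]])
    fix \<theta> and \<tau> :: real assume \<theta>: "\<theta> \<in> S_perp \<omega>" and \<tau>: "\<tau> \<ge> 1"
    have "boundary_form \<Omega> k (source \<rho> D) u Du tu (cgo k \<omega> \<theta> \<tau>) = (LINT x:D|lebesgue. \<rho> x * (1 * cgo k \<omega> \<theta> \<tau> x))"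
      using form(1)[OF S[OF \<theta>], of \<tau> k] \<tau> by simp
    then show "complex_of_real (\<tau> ^ 3 * exp (- \<tau> * h)) * exp (- \<i> * complex_of_real (sqrt (\<tau>\<^sup>2 + k\<^sup>2) * (p \<bullet> \<theta>)))
        * boundary_form \<Omega> k (source \<rho> D) u Du tu (cgo k \<omega> \<theta> \<tau>) - \<rho>' p * cone_const p \<omega> \<delta> Q \<theta> s =
      complex_of_real (\<tau> ^ 3 * exp (- \<tau> * h)) * exp (- \<i> * complex_of_real (sqrt (\<tau>\<^sup>2 + k\<^sup>2) * (p \<bullet> \<theta>)))
        * (LINT x:D|lebesgue. \<rho> x * (1 * cgo k \<omega> \<theta> \<tau> x)) - \<rho>' p * 1 * cone_const p \<omega> \<delta> Q \<theta> s"
      by (simp only: mult_1_right)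
  qed simp_all
  moreover have "uniformly_O (S_perp \<omega>) \<alpha> (\<lambda>\<theta> \<tau>.
      complex_of_real (\<tau> ^ 3 * exp (- \<tau> * h)) * exp (- \<i> * complex_of_real (sqrt (\<tau>\<^sup>2 + k\<^sup>2) * (p \<bullet> \<theta>)))
        * boundary_form \<Omega> k (source \<rho> D) u Du tu (cgo_tau k \<omega> \<theta> \<tau>)
      - \<rho>' p * (complex_of_real h + \<i> * complex_of_real (p \<bullet> \<theta>)) * cone_const p \<omega> \<delta> Q \<theta> s)"
  \<comment> \<open>\<open>R\<close> bounds the closure of \<open>D\<close>, so it serves at
    \<open>p\<close> too; \<open>2 + k\<^sup>2 * R\<close> dominates both coefficients, 2 and
    \<open>k\<^sup>2 * R\<close>, of the amplitude error.\<close>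
  proof (rule uniformly_O_cong[OF expansion[of "cgo_amplitude k \<omega>" "2 * R"
        "\<lambda>\<theta>. complex_of_real h + \<i> * complex_of_real (p \<bullet> \<theta>)" "2 + k\<^sup>2 * R"]])
    fix \<theta> and \<tau> :: real and x assume \<theta>: "\<theta> \<in> S_perp \<omega>" and \<tau>: "\<tau> \<ge> 1" and "x \<in> D"
    then have x: "x \<in> closure D" using closure_subset by blast
    note bounds = cgo_amplitude_bounds[OF \<open>norm \<omega> = 1\<close> S(1)[OF \<theta>] \<tau> R R[OF p], unfolded ph]
    show "cmod (cgo_amplitude k \<omega> \<theta> \<tau> x) \<le> 2 * R" by (rule bounds(1)[OF x])
    have "2 * norm (x - p) + k\<^sup>2 * R * (1 / \<tau>) \<le> (2 + k\<^sup>2 * R) * norm (x - p) + (2 + k\<^sup>2 * R) * (1 / \<tau>)"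
      using R0 \<tau> by (intro add_mono mult_right_mono) auto
    then show "cmod (cgo_amplitude k \<omega> \<theta> \<tau> x - (complex_of_real h + \<i> * complex_of_real (p \<bullet> \<theta>)))
        \<le> (2 + k\<^sup>2 * R) * (norm (x - p) + 1 / \<tau>)"
      using bounds(3)[OF x, of k] by (simp add: distrib_left)
  next
    fix \<theta> and \<tau> :: real
    show "continuous_on UNIV (cgo_amplitude k \<omega> \<theta> \<tau>)" unfolding cgo_amplitude_def by (intro continuous_intros)
    assume \<theta>: "\<theta> \<in> S_perp \<omega>"
    show "cmod (complex_of_real h + \<i> * complex_of_real (p \<bullet> \<theta>)) \<le> 2 * R"
      using cgo_amplitude_bounds(2)[OF \<open>norm \<omega> = 1\<close> S(1)[OF \<theta>] order_refl R[OF p] R[OF p], unfolded ph] .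
    assume \<tau>: "\<tau> \<ge> 1"
    have "boundary_form \<Omega> k (source \<rho> D) u Du tu (cgo_tau k \<omega> \<theta> \<tau>) =
        (LINT x:D|lebesgue. \<rho> x * (cgo_amplitude k \<omega> \<theta> \<tau> x * cgo k \<omega> \<theta> \<tau> x))"
      using form(2)[OF S[OF \<theta>], of \<tau> k] \<tau> by (simp add: cgo_tau_eq)
    then show "complex_of_real (\<tau> ^ 3 * exp (- \<tau> * h)) * exp (- \<i> * complex_of_real (sqrt (\<tau>\<^sup>2 + k\<^sup>2) * (p \<bullet> \<theta>)))
        * boundary_form \<Omega> k (source \<rho> D) u Du tu (cgo_tau k \<omega> \<theta> \<tau>)
        - \<rho>' p * (complex_of_real h + \<i> * complex_of_real (p \<bullet> \<theta>)) * cone_const p \<omega> \<delta> Q \<theta> s =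
      complex_of_real (\<tau> ^ 3 * exp (- \<tau> * h)) * exp (- \<i> * complex_of_real (sqrt (\<tau>\<^sup>2 + k\<^sup>2) * (p \<bullet> \<theta>)))
        * (LINT x:D|lebesgue. \<rho> x * (cgo_amplitude k \<omega> \<theta> \<tau> x * cgo k \<omega> \<theta> \<tau> x))
        - \<rho>' p * (complex_of_real h + \<i> * complex_of_real (p \<bullet> \<theta>)) * cone_const p \<omega> \<delta> Q \<theta> s"
      by (simp only:)
  qed (use R0 in simp_all)
  ultimately show ?thesis unfolding p_def h_def by blast
qed

end
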